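(* Let $S$ be a simply connected square tiled surface in which every interior vertex is surrounded by exactly four squares, and suppose that $S$ is domino tileable. Let $T,T'$ be domino tilings of $S$ and let $F = F^{+}\cup F^{-}$ be the filling shape associated to $T$ and $T'$. Then $$d_{\mathcal{F}_S}(T,T') = \mathrm{vol}(F^{+}) - \mathrm{vol}(F^{-}),$$ where the part $F^-$ lying below $S$ is counted with negative volume.
   Context: A square tiled surface $S$ is a (compact) surface with boundary obtained by pasting together finitely many $1\times 1$ Euclidean squares along edges. $V(S)$ is the set of images of the corners of the squares. The standing assumption is that $S$ is simply connected and that every vertex in the interior of $S$ is surrounded by exactly four squares; $S$ need not be embeddable in the plane. Consequently $S$ carries a chessboard (black/white) coloring of its squares (squares sharing an edge have different colors) and an orientation inherited from an immersion in the chessboard-colored Euclidean plane; both are fixed. The dual graph $S^*$ has the squares of $S$ as vertices, drawn at the centers of the squares, with an edge between two squares that share an edge. A domino tiling of $S$ is a tiling of $S$ by $2\times 1$ rectangles (dominos), equivalently a perfect matching of $S^*$. If two dominos of a tiling share a long edge, they fill a $2\times 2$ square, and rotating this square by a quarter turn yields a new tiling; this operation is a flip. The flip graph $\mathcal{F}_S$ has the domino tilings of $S$ as vertices, with an edge between two tilings related by a single flip. $d_{\mathcal{F}_S}$ is the graph distance on its vertices, all edges having length $1$. Given an ordered pair $T,T'$ of tilings, superimpose the corresponding perfect matchings in $S^*$ and erase all edges belonging to both. The remaining edges form a collection $\mathcal{C}(T,T')$ of disjoint cycles, whose edges alternate between $T$ and $T'$. Each cycle is oriented so that its edges belonging to $T$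 are traversed from black to white. A cycle is positive if it is oriented counterclockwise and negative otherwise. The filling shape $F$ is a subset of $S\times\mathbb{R}$ (with $S$ identified with $S\times\{0\}$) constructed as follows. Process the cycles of $\mathcal{C}(T,T')$ in any order: for each positive cycle, add a layer of thickness $1$ over the region of $S$ enclosed by the cycle; for each negative cycle, dig out (remove) a layer of thickness $1$ over the region enclosed by the cycle. Layers stack, holes below level $0$ count as negative volume, and a positive and a negative layer over the same place cancel. Explicitly, each interior vertex $v$ of $S$ is the center of a unit square cell whose corners are the centers of the four squares around $v$; if $\nu^+(v)$ (resp. $\nu^-(v)$) is the number of positive (resp. negative) cycles enclosing $v$, then over this cell $F$ is a column of unit cubes of signed height $\nu^+(v)-\nu^-(v)$, above $S$ if this is positive and below $S$ if it is negative. $F^+$ is the part of $F$ above $S$, with its usual volume $\mathrm{vol}(F^+)\ge 0$; $F^-$ is the part of $F$ below $S$ (the holes), with volume counted negatively, so $\mathrm{vol}(F^-)\le 0$. *)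

theory Defs
  imports "HOL-Analysis.Analysis" "Graph_Theory.Graph_Theory"
begin

section \<open>Quotient topologies and simple connectedness\<close>

definition quotient_topology :: "'a topology \<Rightarrow> ('a \<Rightarrow> 'b) \<Rightarrow> 'b topology" where
  "quotient_topology X f =
     topology (\<lambda>U. U \<subseteq> f ` topspace X \<and> openin X {x \<in> topspace X. f x \<in> U})"

lemma openin_quotient_topology:
  "openin (quotient_topology X f) U \<longleftrightarrow>
     U \<subseteq> f ` topspace X \<and> openin X {x \<in> topspace X. f x \<in> U}"
proof -
  have Int: "openin X {x \<in> topspace X. f x \<in> U \<inter> V}"
    if "openin X {x \<in> topspace X. f x \<in> U}" "openin X {x \<in> topspace X. f x \<in> V}" for U V
  proof -
    have "{x \<in> topspace X. f x \<in> U \<inter> V} = {x \<in> topspace X. f x \<in> U} \<inter> {x \<in> topspace X. f x \<in> V}"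
      by blast
    then show ?thesis using that by (simp add: openin_Int)
  qed
  have Un: "openin X {x \<in> topspace X. f x \<in> \<Union>K}"
    if "\<forall>U\<in>K. openin X {x \<in> topspace X. f x \<in> U}" for K
  proof -
    have "{x \<in> topspace X. f x \<in> \<Union>K} = (\<Union>U\<in>K. {x \<in> topspace X. f x \<in> U})"
      by blast
    moreover have "openin X (\<Union>U\<in>K. {x \<in> topspace X. f x \<in> U})"
      by (rule openin_Union) (use that in blast)
    ultimately show ?thesis by simp
  qed
  have "istopology (\<lambda>U. U \<subseteq> f ` topspace X \<and> openin X {x \<in> topspace X. f x \<in> U})"
    unfolding istopology_def using Int Un by blast
  from topology_inverse'[OF this] show ?thesis
    unfolding quotient_topology_def by simp
qed

lemma topspace_quotient_topology: "topspace (quotient_topology X f) = f ` topspace X"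
proof (rule subset_antisym)
  show "topspace (quotient_topology X f) \<subseteq> f ` topspace X"
    using openin_topspace [of "quotient_topology X f"]
    by (simp only: openin_quotient_topology)
  have "{x \<in> topspace X. f x \<in> f ` topspace X} = topspace X"
    by blast
  then have "openin (quotient_topology X f) (f ` topspace X)"
    by (simp add: openin_quotient_topology)
  then show "f ` topspace X \<subseteq> topspace (quotient_topology X f)"
    by (rule openin_subset)
qed

lemma quotient_map_quotient_topology: "quotient_map X (quotient_topology X f) f"
  unfolding quotient_map_def topspace_quotient_topology openin_quotient_topology by blast

text \<open>\<^const>\<open>simply_connected\<close> only concerns subsets of a \<^class>\<open>topological_space\<close> type; this is
  its counterpart for the type of abstract topologies.\<close>

definition simply_connected_space :: "'a topology \<Rightarrow> bool" where
  "simply_connected_space X \<longleftrightarrow>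
     path_connected_space X \<and>
     (\<forall>p. pathin X p \<and> p 1 = p 0 \<longrightarrow>
        homotopic_with (\<lambda>r. r 1 = r 0) (top_of_set {0..1}) X p (\<lambda>_. p 0))"


section \<open>Square tiled surfaces\<close>

text \<open>Corners are numbered \<open>0, 1, 2, 3\<close> counterclockwise starting at the lower left one,
  and side \<open>i\<close> runs from corner \<open>i\<close> to corner \<open>i + 1\<close>, all modulo 4.\<close>

definition corner :: "nat \<Rightarrow> real \<times> real" where
  "corner i = [(0, 0), (1, 0), (1, 1), (0, 1)] ! (i mod 4)"

definition side_point :: "nat \<Rightarrow> real \<Rightarrow> real \<times> real" where
  "side_point i t = (1 - t) *\<^sub>R corner i + t *\<^sub>R corner (i + 1)"

definition center :: "real \<times> real" where
  "center = (1/2, 1/2)"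

definition unit_square :: "(real \<times> real) set" where
  "unit_square = {0..1} \<times> {0..1}"

text \<open>A pasting pattern: \<open>glue S (q, i) = Some (q', j)\<close> says that side \<open>i\<close> of the square \<open>q\<close>
  is pasted to side \<open>j\<close> of the square \<open>q'\<close>; the sides with \<open>glue S (q, i) = None\<close> are free.
  Pasting reverses the direction of sides, so the counterclockwise orientations of the
  squares match up: this common orientation is the fixed orientation of the surface.
  Corners are identified only as a consequence of the pasting of sides, and hence the
  result is a compact surface with boundary.\<close>

record 'a square_pasting =
  squares :: "'a set"
  glue :: "'a \<times> nat \<rightharpoonup> 'a \<times> nat"

definition square_tiled_surface :: "'a square_pasting \<Rightarrow> bool" where
  "square_tiled_surface S \<longleftrightarrow>
     finite (squares S) \<and>
     dom (glue S) \<subseteq> squares S \<times> {..<4} \<and>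
     (\<forall>s s'. glue S s = Some s' \<longrightarrow> s' \<noteq> s \<and> glue S s' = Some s)"

definition pieces :: "'a square_pasting \<Rightarrow> ('a \<times> real \<times> real) topology" where
  "pieces S = prod_topology (discrete_topology (squares S)) (top_of_set unit_square)"

definition paste :: "'a square_pasting \<Rightarrow> ('a \<times> real \<times> real) rel" where
  "paste S = {((q, side_point i t), (q', side_point j (1 - t))) | q i q' j t.
                glue S (q, i) = Some (q', j) \<and> t \<in> {0..1}}"

text \<open>The relation \<^term>\<open>paste S\<close> is symmetric when \<^term>\<open>square_tiled_surface S\<close> holds, so
  its reflexive transitive closure is the equivalence relation it generates. Points of the
  surface are the equivalence classes.\<close>

definition proj :: "'a square_pasting \<Rightarrow> 'a \<times> real \<times> real \<Rightarrow> ('a \<times> real \<times> real) set" where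
  "proj S x = (paste S)\<^sup>* `` {x}"

definition surface :: "'a square_pasting \<Rightarrow> ('a \<times> real \<times> real) set topology" where
  "surface S = quotient_topology (pieces S) (proj S)"

definition boundary :: "'a square_pasting \<Rightarrow> ('a \<times> real \<times> real) set set" where
  "boundary S = {proj S (q, side_point i t) | q i t.
                   q \<in> squares S \<and> i < 4 \<and> glue S (q, i) = None \<and> t \<in> {0..1}}"

definition vertices :: "'a square_pasting \<Rightarrow> ('a \<times> real \<times> real) set set" where
  "vertices S = {proj S (q, corner i) | q i. q \<in> squares S \<and> i < 4}"

definition interior_vertices :: "'a square_pasting \<Rightarrow> ('a \<times> real \<times> real) set set" where
  "interior_vertices S = vertices S - boundary S"

text \<open>The squares around a vertex, each listed with the corner by which it touches the vertex.\<close>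

definition corners_at ::
    "'a square_pasting \<Rightarrow> ('a \<times> real \<times> real) set \<Rightarrow> ('a \<times> nat) set" where
  "corners_at S v = {(q, i). q \<in> squares S \<and> i < 4 \<and> proj S (q, corner i) = v}"

definition four_squares_around_interior_vertices :: "'a square_pasting \<Rightarrow> bool" where
  "four_squares_around_interior_vertices S \<longleftrightarrow>
     (\<forall>v \<in> interior_vertices S. card (corners_at S v) = 4)"

definition chessboard_coloring :: "'a square_pasting \<Rightarrow> ('a \<Rightarrow> bool) \<Rightarrow> bool" where
  "chessboard_coloring S black \<longleftrightarrow>
     (\<forall>q i q' j. glue S (q, i) = Some (q', j) \<longrightarrow> black q \<noteq> black q')"


section \<open>Domino tilings and the flip graph\<close>

text \<open>The edges of the dual graph; a domino is identified with the edge joining its two squares.\<close>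

definition dual_edges :: "'a square_pasting \<Rightarrow> 'a set set" where
  "dual_edges S = {{q, q'} | q q'. q \<noteq> q' \<and> (\<exists>i j. glue S (q, i) = Some (q', j))}"

definition domino_tiling :: "'a square_pasting \<Rightarrow> 'a set set \<Rightarrow> bool" where
  "domino_tiling S T \<longleftrightarrow> T \<subseteq> dual_edges S \<and> (\<forall>q \<in> squares S. \<exists>!e. e \<in> T \<and> q \<in> e)"

text \<open>Four squares filling a 2-by-2 square, in counterclockwise order around its midpoint,
  which is corner \<open>i\<close> of \<open>a\<close>, \<open>j\<close> of \<open>b\<close>, \<open>k\<close> of \<open>c\<close> and \<open>l\<close> of \<open>d\<close>.
  Side \<open>i + 3\<close> (that is, \<open>i - 1\<close>) of a square ends at its corner \<open>i\<close>.\<close>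

definition two_by_two :: "'a square_pasting \<Rightarrow> 'a \<Rightarrow> 'a \<Rightarrow> 'a \<Rightarrow> 'a \<Rightarrow> bool" where
  "two_by_two S a b c d \<longleftrightarrow>
     (\<exists>i j k l. glue S (a, (i + 3) mod 4) = Some (b, j) \<and>
                glue S (b, (j + 3) mod 4) = Some (c, k) \<and>
                glue S (c, (k + 3) mod 4) = Some (d, l) \<and>
                glue S (d, (l + 3) mod 4) = Some (a, i))"

definition flip :: "'a square_pasting \<Rightarrow> 'a set set \<Rightarrow> 'a set set \<Rightarrow> bool" where
  "flip S T T' \<longleftrightarrow>
     (\<exists>a b c d. two_by_two S a b c d \<and> {a, b} \<in> T \<and> {c, d} \<in> T \<and>
        T' = T - {{a, b}, {c, d}} \<union> {{b, c}, {d, a}})"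

text \<open>An undirected graph is rendered as a digraph with a symmetric set of arcs.\<close>

definition flip_graph :: "'a square_pasting \<Rightarrow> 'a set set pair_pre_digraph" where
  "flip_graph S =
     \<lparr> pverts = {T. domino_tiling S T},
       parcs = {(T, T'). domino_tiling S T \<and> domino_tiling S T' \<and> (flip S T T' \<or> flip S T' T)} \<rparr>"

text \<open>\<open>wf_digraph.\<mu>\<close> is the infimum of the weights of all walks, \<open>\<infinity>\<close> if there is none.\<close>

definition flip_distance :: "'a square_pasting \<Rightarrow> 'a set set \<Rightarrow> 'a set set \<Rightarrow> ereal" where
  "flip_distance S T T' = wf_digraph.\<mu> (with_proj (flip_graph S)) (\<lambda>_. 1) T T'"


section \<open>Cycles of a pair of tilings\<close>

text \<open>Every square lies on no or on exactly two of the edges that belong to just one of the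
  tilings, so the connected components of these edges are cycles. A cycle is represented by
  its set of edges.\<close>

definition cycles :: "'a set set \<Rightarrow> 'a set set \<Rightarrow> 'a set set set" where
  "cycles T T' =
     (let D = (T - T') \<union> (T' - T)
      in D // {(e, f). e \<in> D \<and> f \<in> D \<and> e \<inter> f \<noteq> {}}\<^sup>*)"

text \<open>The cycle as a closed curve in the surface: each of its edges consists of the two
  segments from the centers of the squares to the midpoint of the common side.\<close>

definition drawing :: "'a square_pasting \<Rightarrow> 'a set set \<Rightarrow> ('a \<times> real \<times> real) set set" where
  "drawing S C = {proj S (q, p) | q i q' j p.
     glue S (q, i) = Some (q', j) \<and> {q, q'} \<in> C \<and> p \<in> closed_segment center (side_point i (1/2))}"

text \<open>The points off the cycle that it separates from the boundary of the surface.\<close>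

definition enclosed_region :: "'a square_pasting \<Rightarrow> 'a set set \<Rightarrow> ('a \<times> real \<times> real) set set" where
  "enclosed_region S C =
     {x \<in> topspace (surface S) - drawing S C.
        connected_component_of_set
          (subtopology (surface S) (topspace (surface S) - drawing S C)) x \<inter> boundary S = {}}"

text \<open>The edges of a cycle directed so that edges of \<open>T\<close> go from black to white; the other
  edges, which belong to \<open>T'\<close>, then go from white to black.\<close>

definition directed_edges ::
    "('a \<Rightarrow> bool) \<Rightarrow> 'a set set \<Rightarrow> 'a set set \<Rightarrow> ('a \<times> 'a) set" where
  "directed_edges black T C = {(q, q'). {q, q'} \<in> C \<and> ({q, q'} \<in> T \<longleftrightarrow> black q)}"

text \<open>Counterclockwise means that the enclosed region lies to the left. When one leaves the
  square \<open>q\<close> through side \<open>i\<close>, the endpoint of that side on the left is corner \<open>i + 1\<close>.\<close>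

definition positive_cycle ::
    "'a square_pasting \<Rightarrow> ('a \<Rightarrow> bool) \<Rightarrow> 'a set set \<Rightarrow> 'a set set \<Rightarrow> bool" where
  "positive_cycle S black T C \<longleftrightarrow>
     (\<forall>(q, q') \<in> directed_edges black T C. \<forall>i j. glue S (q, i) = Some (q', j) \<longrightarrow>
        proj S (q, corner (i + 1)) \<in> enclosed_region S C)"


section \<open>The filling shape\<close>

definition signed_height ::
    "'a square_pasting \<Rightarrow> ('a \<Rightarrow> bool) \<Rightarrow> 'a set set \<Rightarrow> 'a set set
       \<Rightarrow> ('a \<times> real \<times> real) set \<Rightarrow> int" where
  "signed_height S black T T' v =
     int (card {C \<in> cycles T T'. positive_cycle S black T C \<and> v \<in> enclosed_region S C}) -
     int (card {C \<in> cycles T T'. \<not> positive_cycle S black T C \<and> v \<in> enclosed_region S C})"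

text \<open>The unit square cell around an interior vertex: it consists of one quarter of each of
  the surrounding squares.\<close>

definition cell ::
    "'a square_pasting \<Rightarrow> ('a \<times> real \<times> real) set \<Rightarrow> ('a \<times> real \<times> real) set set" where
  "cell S v = {proj S (q, x, y) | q i x y. (q, i) \<in> corners_at S v \<and> (x, y) \<in> unit_square \<and>
                 \<bar>x - fst (corner i)\<bar> \<le> 1/2 \<and> \<bar>y - snd (corner i)\<bar> \<le> 1/2}"

definition filling_shape ::
    "'a square_pasting \<Rightarrow> ('a \<Rightarrow> bool) \<Rightarrow> 'a set set \<Rightarrow> 'a set set
       \<Rightarrow> (('a \<times> real \<times> real) set \<times> real) set" where
  "filling_shape S black T T' =
     (\<Union>v \<in> {v \<in> interior_vertices S. signed_height S black T T' v > 0}.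
        cell S v \<times> {0 .. real_of_int (signed_height S black T T' v)}) \<union>
     (\<Union>v \<in> {v \<in> interior_vertices S. signed_height S black T T' v < 0}.
        cell S v \<times> {real_of_int (signed_height S black T T' v) .. 0})"

text \<open>The usual volume on the product of the surface with the real line, computed square by
  square; the sides of the squares contribute nothing.\<close>

definition volume :: "'a square_pasting \<Rightarrow> (('a \<times> real \<times> real) set \<times> real) set \<Rightarrow> real" where
  "volume S A =
     (\<Sum>q \<in> squares S.
        measure lebesgue {(x, y, z). (x, y) \<in> unit_square \<and> (proj S (q, x, y), z) \<in> A})"

definition part_above :: "('b \<times> real) set \<Rightarrow> ('b \<times> real) set" where
  "part_above F = {(x, z) \<in> F. z \<ge> 0}"

definition part_below :: "('b \<times> real) set \<Rightarrow> ('b \<times> real) set" where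
  "part_below F = {(x, z) \<in> F. z \<le> 0}"

definition vol_above :: "'a square_pasting \<Rightarrow> (('a \<times> real \<times> real) set \<times> real) set \<Rightarrow> real" where
  "vol_above S F = volume S (part_above F)"

text \<open>Holes count as negative volume.\<close>

definition vol_below :: "'a square_pasting \<Rightarrow> (('a \<times> real \<times> real) set \<times> real) set \<Rightarrow> real" where
  "vol_below S F = - volume S (part_below F)"

end

theory Submission
  imports Defs
begin

text \<open>
  The proof rests on height functions. Let every domino of \<open>T\<close> carry one unit of flow from its black
  to its white square, and every domino of \<open>T'\<close> one unit from white to black. What leaves a square
  through one domino enters it through the other, so this flow has no divergence. On a simply connected
  surface it is therefore the increment, along the sides of the squares, of a function \<open>H\<close> of the
  vertices that vanishes on the boundary (\<open>flow_is_boundary\<close>). This \<open>H\<close> is the signed height of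
  the filling shape. Indeed the flow is the sum of its restrictions to the cycles. The potential of the
  flow along one cycle changes by one across the cycle and nowhere else. Each of the two sides of the
  cycle is connected, and the boundary can only meet the side on which the potential vanishes; the
  other side is the enclosed region, where the potential is \<open>1\<close> or \<open>-1\<close> depending on the
  orientation (\<open>h_enclosed\<close>, \<open>signed_height_step\<close>). Since four quarters of squares surround every
  interior vertex, the volume of the filling shape is the sum of \<open>\<bar>H v\<bar>\<close> over the interior vertices
  (\<open>volume_eq_total_height\<close>).

  A flip changes \<open>H\<close> by one at a single vertex (\<open>flip_around\<close>), so the distance is at least that sum.
  Conversely, suppose that \<open>H\<close> is positive somewhere; otherwise exchange the tilings. The tiling \<open>T\<close>
  itself has a height function, which rises by one along each side that has a white square on its left
  and is not crossed by a domino, and falls by three if it is crossed. Among the vertices with positive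
  \<open>H\<close> take one where this function is largest. Moving on from there along a side where it rises would
  lead to a vertex that is higher, with \<open>H\<close> still positive. So the two sides that leave the vertex with a
  white square on their left are crossed by dominoes. This means that the vertex is the midpoint of two
  parallel dominoes, and flipping them lowers the sum by one (\<open>flip_towards\<close>).

  Simple connectedness is used through one statement about local systems (\<open>global_section\<close>): if a
  set is attached to every square, sets of squares that share a side are identified, and these
  identifications compose to the identity around every interior vertex, then there is a consistent
  choice of elements. It is proved by lifting a contraction of a loop. It is applied three times: to
  positions in the complex plane, which gives the developing map of the surface; to integers, which
  gives the height function of a tiling; and to cosets of the group of boundaries of vertex chains, which
  shows that divergence-free flows are boundaries and replaces the Jordan curve theorem.
\<close>

section \<open>Sides, corners and pasted points\<close>

lemma less_4_cases: "(i::nat) < 4 \<longleftrightarrow> i = 0 \<or> i = 1 \<or> i = 2 \<or> i = 3"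
  by auto

lemma corner_simps [simp]:
  "corner 0 = (0, 0)" "corner (Suc 0) = (1, 0)" "corner 2 = (1, 1)" "corner 3 = (0, 1)"
  "corner 4 = (0, 0)"
  by (auto simp: corner_def)

lemma corner_Suc_simps [simp]: "corner (Suc (Suc 0)) = (1, 1)" "corner (Suc (Suc (Suc 0))) = (0, 1)"
  by (simp_all add: corner_def)

lemma corner_mod [simp]: "corner (i mod 4) = corner i"
  by (simp add: corner_def)

lemma corner_Suc_mod [simp]: "corner (Suc (i mod 4)) = corner (Suc i)"
  by (metis corner_mod mod_Suc_eq)

lemma side_point_mod [simp]: "side_point (i mod 4) t = side_point i t"
  by (simp add: side_point_def)

lemma side_point_0 [simp]: "side_point i 0 = corner i"
  and side_point_1 [simp]: "side_point i 1 = corner (Suc i)"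
  by (simp_all add: side_point_def)

lemma side_point_simps:
  "side_point 0 t = (t, 0)" "side_point (Suc 0) t = (1, t)"
  "side_point 2 t = (1 - t, 1)" "side_point 3 t = (0, 1 - t)"
  by (simp_all add: side_point_def corner_def)

lemma side_point_inject:
  assumes "side_point m t = side_point i s" "m < 4" "i < 4" "0 < t" "t < 1" "0 \<le> s" "s \<le> 1"
  shows "m = i \<and> s = t"
  using assms by (auto simp: less_4_cases side_point_simps)

lemma side_point_eq_corner:
  assumes "side_point m t = corner i" "m < 4" "i < 4" "0 \<le> t" "t \<le> 1"
  shows "t = 0 \<and> m = i \<or> t = 1 \<and> i = (m + 1) mod 4"
  using assms by (auto simp: less_4_cases side_point_simps)

lemma corner_inject: "corner i = corner j \<Longrightarrow> i < 4 \<Longrightarrow> j < 4 \<Longrightarrow> i = j"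
  by (auto simp: less_4_cases)

lemma side_point_in_unit_square: "0 \<le> t \<Longrightarrow> t \<le> 1 \<Longrightarrow> side_point i t \<in> unit_square"
proof -
  assume t: "0 \<le> t" "t \<le> 1"
  define k where "k = i mod 4"
  have "k < 4" by (simp add: k_def)
  then have "side_point k t \<in> unit_square"
    using t by (auto simp: less_4_cases side_point_simps unit_square_def)
  then show ?thesis by (simp add: k_def)
qed

lemma corner_in_unit_square: "corner i \<in> unit_square"
  using side_point_in_unit_square[of 0 i] by simp

lemma center_in_unit_square: "center \<in> unit_square"
  by (simp add: center_def unit_square_def)

lemma unit_square_boundary_cases:
  assumes "p \<in> unit_square"
  obtains (interior) "0 < fst p" "fst p < 1" "0 < snd p" "snd p < 1"
  | (side) i t where "i < 4" "0 < t" "t < 1" "p = side_point i t"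
  | (corner) i where "i < 4" "p = corner i"
proof -
  obtain x y where p: "p = (x, y)" by (cases p)
  have xy: "0 \<le> x" "x \<le> 1" "0 \<le> y" "y \<le> 1"
    using assms by (auto simp: p unit_square_def)
  consider "x = 0" "y = 0" | "x = 1" "y = 0" | "x = 1" "y = 1" | "x = 0" "y = 1"
    | "y = 0" "0 < x" "x < 1" | "x = 1" "0 < y" "y < 1" | "y = 1" "0 < x" "x < 1"
    | "x = 0" "0 < y" "y < 1" | "0 < x" "x < 1" "0 < y" "y < 1"
  proof -
    have "x = 0 \<or> x = 1 \<or> 0 < x \<and> x < 1" "y = 0 \<or> y = 1 \<or> 0 < y \<and> y < 1"
      using xy by auto
    then show thesis using that by blast
  qed
  then show thesis
  proof cases
    case 1 then show thesis using corner[of 0] p by simp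
  next
    case 2 then show thesis using corner[of 1] p by simp
  next
    case 3 then show thesis using corner[of 2] p by simp
  next
    case 4 then show thesis using corner[of 3] p by simp
  next
    case 5 then show thesis using side[of 0 x] p by (simp add: side_point_simps)
  next
    case 6 then show thesis using side[of 1 y] p by (simp add: side_point_simps)
  next
    case 7 then show thesis using side[of 2 "1 - x"] p by (simp add: side_point_simps)
  next
    case 8 then show thesis using side[of 3 "1 - y"] p by (simp add: side_point_simps)
  next
    case 9 then show thesis using interior p by simp
  qed
qed

lemma closed_segment_center_side:
  assumes "p \<in> closed_segment center (side_point i (1/2))" "i < 4"
  shows "p = side_point i (1/2) \<or> 0 < fst p \<and> fst p < 1 \<and> 0 < snd p \<and> snd p < 1"
proof -
  obtain u where u: "0 \<le> u" "u \<le> 1" "p = (1 - u) *\<^sub>R center + u *\<^sub>R side_point i (1/2)"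
    using assms by (auto simp: in_segment)
  from assms(2) have "i = 0 \<or> i = 1 \<or> i = 2 \<or> i = 3" by (simp only: less_4_cases)
  then show ?thesis
    using u by (elim disjE) (auto simp: side_point_simps center_def field_simps)
qed

type_synonym 'a point = "'a \<times> real \<times> real"

text \<open>The carrier of the topology \<open>pieces S\<close>: the points of the squares before pasting.\<close>

abbreviation pc :: "'a square_pasting \<Rightarrow> 'a point set" where
  "pc S \<equiv> squares S \<times> unit_square"

definition vx :: "'a square_pasting \<Rightarrow> 'a \<Rightarrow> nat \<Rightarrow> 'a point set" where
  "vx S q i = proj S (q, corner i)"

lemma vx_mod [simp]: "vx S q (i mod 4) = vx S q i"
  and vx_Suc_mod [simp]: "vx S q (Suc (i mod 4)) = vx S q (Suc i)"
  by (simp_all add: vx_def)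

lemma vx_4 [simp]: "vx S q 4 = vx S q 0"
  by (simp add: vx_def)

lemma vx_add_4 [simp]: "vx S q (4 + i) = vx S q i" "vx S q (i + 4) = vx S q i"
  by (simp_all add: vx_def corner_def)

lemma topspace_pieces [simp]: "topspace (pieces S) = pc S"
  by (simp add: pieces_def)

lemma topspace_surface: "topspace (surface S) = proj S ` pc S"
  by (simp add: surface_def topspace_quotient_topology)

lemma continuous_map_proj: "continuous_map (pieces S) (surface S) (proj S)"
  unfolding surface_def using quotient_map_quotient_topology quotient_imp_continuous_map by blast

lemma openin_pieces:
  "openin (pieces S) A \<longleftrightarrow>
     A \<subseteq> pc S \<and> (\<forall>q\<in>squares S. openin (top_of_set unit_square) {p. (q, p) \<in> A})"
proof (intro iffI conjI ballI)
  assume A: "openin (pieces S) A"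
  then show "A \<subseteq> pc S" using openin_subset by fastforce
  fix q assume q: "q \<in> squares S"
  have "continuous_map (top_of_set unit_square) (pieces S) (\<lambda>p. (q, p))"
    unfolding pieces_def using q by (simp add: continuous_map_pairedI)
  from openin_continuous_map_preimage[OF this A]
  have "openin (top_of_set unit_square) {p \<in> unit_square. (q, p) \<in> A}" by simp
  moreover have "{p \<in> unit_square. (q, p) \<in> A} = {p. (q, p) \<in> A}"
    using \<open>A \<subseteq> pc S\<close> by auto
  ultimately show "openin (top_of_set unit_square) {p. (q, p) \<in> A}" by simp
next
  assume A: "A \<subseteq> pc S \<and> (\<forall>q\<in>squares S. openin (top_of_set unit_square) {p. (q, p) \<in> A})"
  have "A = (\<Union>q\<in>squares S. {q} \<times> {p. (q, p) \<in> A})" using A by auto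
  moreover have "openin (pieces S) ({q} \<times> {p. (q, p) \<in> A})" if "q \<in> squares S" for q
    using A that by (simp add: pieces_def openin_prod_Times_iff)
  ultimately show "openin (pieces S) A" by (metis (no_types, lifting) openin_clauses(3) imageE)
qed

text \<open>The sets of this kind are the preimages of the open subsets of the surface.\<close>

definition saturated_open :: "'a square_pasting \<Rightarrow> 'a point set \<Rightarrow> bool" where
  "saturated_open S W \<longleftrightarrow> openin (pieces S) W \<and> (\<forall>a b. (a, b) \<in> paste S \<longrightarrow> a \<in> W \<longrightarrow> b \<in> W)"

locale pasted_squares =
  fixes S :: "'a square_pasting"
  assumes pasted: "square_tiled_surface S"
begin

lemma finite_squares: "finite (squares S)"
  using pasted by (simp add: square_tiled_surface_def)

lemma glueD:
  assumes "glue S (q, i) = Some (q', j)"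
  shows "q \<in> squares S" "i < 4" "q' \<in> squares S" "j < 4" "glue S (q', j) = Some (q, i)"
    "(q', j) \<noteq> (q, i)"
proof -
  have surf: "dom (glue S) \<subseteq> squares S \<times> {..<4}"
    "\<And>s s'. glue S s = Some s' \<Longrightarrow> s' \<noteq> s \<and> glue S s' = Some s"
    using pasted unfolding square_tiled_surface_def by blast+
  from surf(2)[OF assms] show *: "glue S (q', j) = Some (q, i)" "(q', j) \<noteq> (q, i)"
    by simp_all
  have "(q, i) \<in> squares S \<times> {..<4}" "(q', j) \<in> squares S \<times> {..<4}"
    using surf(1) domI[where m = "glue S", OF assms] domI[where m = "glue S", OF *(1)] by blast+
  then show "q \<in> squares S" "i < 4" "q' \<in> squares S" "j < 4" by simp_all
qed

lemma paste_iff: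
  "(a, b) \<in> paste S \<longleftrightarrow> (\<exists>q i q' j t. a = (q, side_point i t) \<and> b = (q', side_point j (1 - t)) \<and>
     glue S (q, i) = Some (q', j) \<and> 0 \<le> t \<and> t \<le> 1)"
  by (simp only: paste_def mem_Collect_eq prod.inject atLeastAtMost_iff conj_assoc)

lemma paste_sym: assumes "(a, b) \<in> paste S" shows "(b, a) \<in> paste S"
proof -
  from assms obtain q i q' j t where *: "a = (q, side_point i t)" "b = (q', side_point j (1 - t))"
    "glue S (q, i) = Some (q', j)" "0 \<le> t" "t \<le> 1"
    unfolding paste_iff by blast
  have "a = (q, side_point i (1 - (1 - t)))" "0 \<le> 1 - t" "1 - t \<le> 1" using * by auto
  with *(2) glueD(5)[OF *(3)] show ?thesis
    unfolding paste_iff by blast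
qed

lemma paste_pc: "(a, b) \<in> paste S \<Longrightarrow> a \<in> pc S \<and> b \<in> pc S"
  unfolding paste_iff
  by (elim exE conjE) (simp add: glueD(1,3) side_point_in_unit_square)

lemma paste_rtrancl_sym: "(a, b) \<in> (paste S)\<^sup>* \<Longrightarrow> (b, a) \<in> (paste S)\<^sup>*"
  using sym_rtrancl[of "paste S"] paste_sym unfolding sym_def by blast

lemma proj_eq_iff: "proj S a = proj S b \<longleftrightarrow> (a, b) \<in> (paste S)\<^sup>*"
proof
  assume "proj S a = proj S b"
  moreover have "b \<in> proj S b" by (simp add: proj_def)
  ultimately show "(a, b) \<in> (paste S)\<^sup>*" by (auto simp: proj_def)
next
  assume ab: "(a, b) \<in> (paste S)\<^sup>*"
  show "proj S a = proj S b"
    using ab paste_rtrancl_sym[OF ab] by (auto simp: proj_def intro: rtrancl_trans)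
qed

lemma proj_self: "a \<in> proj S a"
  by (simp add: proj_def)

lemma proj_paste: "(a, b) \<in> paste S \<Longrightarrow> proj S a = proj S b"
  by (simp add: proj_eq_iff r_into_rtrancl)

lemma rtrancl_paste_pc: "(a, b) \<in> (paste S)\<^sup>* \<Longrightarrow> a \<in> pc S \<Longrightarrow> b \<in> pc S"
  by (induction rule: rtrancl_induct) (simp_all only: paste_pc)

lemma in_topspace_surface:
  assumes "x \<in> topspace (surface S)" "b \<in> x"
  shows "b \<in> pc S \<and> x = proj S b"
proof -
  from assms(1) obtain a where a: "a \<in> pc S" "x = proj S a"
    unfolding topspace_surface by blast
  from assms(2) a have ab: "(a, b) \<in> (paste S)\<^sup>*" by (simp add: proj_def)
  show ?thesis using a(2) rtrancl_paste_pc[OF ab a(1)] proj_eq_iff[of a b] ab by simp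
qed

lemma proj_interior:
  assumes "0 < fst p" "fst p < 1" "0 < snd p" "snd p < 1"
  shows "proj S (q, p) = {(q, p)}"
proof -
  have "((q, p), b) \<notin> paste S" for b
  proof
    assume "((q, p), b) \<in> paste S"
    then obtain i t q' j where "p = side_point i t" "glue S (q, i) = Some (q', j)"
      unfolding paste_iff prod.inject by blast
    then have "p = side_point i t" "i < 4" by (auto dest: glueD(2))
    then show False using assms by (auto simp: less_4_cases side_point_simps)
  qed
  then have "((q, p), b) \<in> (paste S)\<^sup>* \<longleftrightarrow> b = (q, p)" for b
    by (metis converse_rtranclE rtrancl.rtrancl_refl)
  then show ?thesis unfolding proj_def by blast
qed

lemma pasteE:
  assumes "((q, p), b) \<in> paste S"
  obtains i q' j t where "p = side_point i t" "b = (q', side_point j (1 - t))"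
    "glue S (q, i) = Some (q', j)" "0 \<le> t" "t \<le> 1"
  using assms unfolding paste_iff prod.inject by blast

lemma paste_open_side:
  assumes "((q, side_point i t), b) \<in> paste S" "i < 4" "0 < t" "t < 1"
  shows "\<exists>q' j. glue S (q, i) = Some (q', j) \<and> b = (q', side_point j (1 - t))"
  using assms(1)
proof (rule pasteE)
  fix i0 q' j t0
  assume *: "side_point i t = side_point i0 t0" "b = (q', side_point j (1 - t0))"
    "glue S (q, i0) = Some (q', j)" "0 \<le> t0" "t0 \<le> 1"
  have "i = i0 \<and> t0 = t"
    by (rule side_point_inject[OF *(1) assms(2) glueD(2)[OF *(3)] assms(3,4) *(4,5)])
  with * show ?thesis by blast
qed

lemma glue_paste:
  assumes "glue S (q, i) = Some (q', j)" "0 \<le> t" "t \<le> 1"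
  shows "((q, side_point i t), (q', side_point j (1 - t))) \<in> paste S"
  using assms unfolding paste_iff by (intro exI conjI) auto

lemma proj_open_side:
  assumes "i < 4" "0 < t" "t < 1"
  shows "proj S (q, side_point i t) =
    {(q, side_point i t)} \<union> {(q', side_point j (1 - t)) | q' j. glue S (q, i) = Some (q', j)}"
    (is "_ = ?R")
proof -
  have "b \<in> ?R" if "((q, side_point i t), b) \<in> (paste S)\<^sup>*" for b
    using that
  proof (induction rule: rtrancl_induct)
    case base show ?case by simp
  next
    case (step y z)
    from step.IH consider "y = (q, side_point i t)" |
      q' j where "y = (q', side_point j (1 - t))" "glue S (q, i) = Some (q', j)" by auto
    then show ?case
    proof cases
      case 1
      with paste_open_side[of q i t z] step.hyps assms show ?thesis by auto
    next
      case 2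
      from glueD[OF 2(2)] have g: "glue S (q', j) = Some (q, i)" "j < 4" by auto
      with paste_open_side[of q' j "1 - t" z] step.hyps 2 assms show ?thesis by auto
    qed
  qed
  moreover have "b \<in> proj S (q, side_point i t)" if "b \<in> ?R" for b
  proof -
    from that consider "b = (q, side_point i t)"
      | q' j where "glue S (q, i) = Some (q', j)" "b = (q', side_point j (1 - t))" by auto
    then show ?thesis
    proof cases
      case 1 then show ?thesis by (simp add: proj_def)
    next
      case 2
      then have "((q, side_point i t), b) \<in> paste S"
        using assms glue_paste by simp
      then show ?thesis unfolding proj_def by blast
    qed
  qed
  ultimately show ?thesis unfolding proj_def by blast
qed

section \<open>Open sets of the surface\<close>

lemma saturated_openD: "saturated_open S W \<Longrightarrow> (a, b) \<in> paste S \<Longrightarrow> a \<in> W \<Longrightarrow> b \<in> W"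
  unfolding saturated_open_def by meson

lemma saturated_open_rtrancl:
  assumes "saturated_open S W" "(a, b) \<in> (paste S)\<^sup>*"
  shows "a \<in> W \<longleftrightarrow> b \<in> W"
proof -
  have *: "b \<in> W" if "a \<in> W" "(a, b) \<in> (paste S)\<^sup>*" for a b
    using that(2,1) by (induction rule: rtrancl_induct) (simp_all only: saturated_openD[OF assms(1)])
  show ?thesis using *[of a b] *[of b a] assms(2) paste_rtrancl_sym[OF assms(2)] by metis
qed

lemma saturated_open_subset: "saturated_open S W \<Longrightarrow> a \<in> W \<Longrightarrow> a \<in> pc S"
  unfolding saturated_open_def openin_pieces by blast

lemma proj_in_image_saturated:
  assumes "saturated_open S W"
  shows "proj S a \<in> proj S ` W \<longleftrightarrow> a \<in> W"
proof
  assume "proj S a \<in> proj S ` W"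
  then obtain b where b: "b \<in> W" "proj S a = proj S b" by blast
  then show "a \<in> W" using saturated_open_rtrancl[OF assms] proj_eq_iff by simp
qed simp

lemma openin_surface_image:
  assumes "saturated_open S W"
  shows "openin (surface S) (proj S ` W)"
proof -
  have "{x \<in> topspace (pieces S). proj S x \<in> proj S ` W} = W"
    using proj_in_image_saturated[OF assms] saturated_open_subset[OF assms] by auto
  moreover have "openin (pieces S) W" using assms by (simp add: saturated_open_def)
  moreover from this have "proj S ` W \<subseteq> proj S ` topspace (pieces S)"
    using openin_subset by blast
  ultimately show ?thesis
    unfolding surface_def openin_quotient_topology by simp
qed

section \<open>Vertices\<close>

lemma glue_vx:
  assumes "glue S (q, i) = Some (q', j)"
  shows "vx S q i = vx S q' (Suc j)" "vx S q (Suc i) = vx S q' j"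
proof -
  from proj_paste[OF glue_paste[OF assms, of 0]] proj_paste[OF glue_paste[OF assms, of 1]]
  show "vx S q i = vx S q' (Suc j)" "vx S q (Suc i) = vx S q' j"
    by (simp_all add: vx_def)
qed

text \<open>Pasting reverses sides, so the start of side \<open>i\<close> is identified with corner \<open>j + 1\<close> of the
  neighbour and its end with corner \<open>j\<close>. A function of corners that respects these two identifications
  is a function of vertices, because a chain of pastings that starts at a corner only meets corners.\<close>

lemma corner_class:
  assumes inv: "\<And>q i q' j. glue S (q, i) = Some (q', j) \<Longrightarrow>
      f q i = f q' ((j + 1) mod 4) \<and> f q ((i + 1) mod 4) = f q' j"
    and "((q, corner i), b) \<in> (paste S)\<^sup>*" "i < 4"
  shows "\<exists>q' i'. i' < 4 \<and> b = (q', corner i') \<and> f q' i' = f q i"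
  using assms(2)
proof (induction rule: rtrancl_induct)
  case base show ?case using \<open>i < 4\<close> by auto
next
  case (step y z)
  then obtain q1 i1 where 1: "i1 < 4" "y = (q1, corner i1)" "f q1 i1 = f q i" by blast
  from step.hyps(2)[unfolded 1(2)] obtain m q2 j t where 2: "corner i1 = side_point m t"
    "z = (q2, side_point j (1 - t))" "glue S (q1, m) = Some (q2, j)" "0 \<le> t" "t \<le> 1"
    by (rule pasteE)
  note g = glueD[OF 2(3)]
  have "t = 0 \<and> m = i1 \<or> t = 1 \<and> i1 = (m + 1) mod 4"
    using side_point_eq_corner[OF 2(1)[symmetric]] g 1 2 by auto
  then show ?case
  proof
    assume t: "t = 0 \<and> m = i1"
    then have "z = (q2, corner ((j + 1) mod 4))" using 2(2) by simp
    moreover have "f q2 ((j + 1) mod 4) = f q i" using inv[OF 2(3)] t 1(3) by simp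
    ultimately show ?case by (metis mod_less_divisor zero_less_numeral)
  next
    assume t: "t = 1 \<and> i1 = (m + 1) mod 4"
    then have "z = (q2, corner j)" using 2(2) by simp
    moreover have "f q2 j = f q i" using inv[OF 2(3)] t 1(3) by simp
    ultimately show ?case using g(4) by blast
  qed
qed

lemma vx_eq_imp:
  assumes "\<And>q i q' j. glue S (q, i) = Some (q', j) \<Longrightarrow>
      f q i = f q' ((j + 1) mod 4) \<and> f q ((i + 1) mod 4) = f q' j"
    and "vx S q i = vx S q' i'" "i < 4" "i' < 4"
  shows "f q i = f q' i'"
proof -
  have "((q, corner i), (q', corner i')) \<in> (paste S)\<^sup>*"
    using assms(2) by (simp add: vx_def proj_eq_iff)
  from corner_class[where f = f, OF assms(1) this assms(3)]
  obtain i2 where "i2 < 4" "corner i' = corner i2" "f q' i2 = f q i" by auto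
  with corner_inject assms(4) show ?thesis by metis
qed

lemma vertices_alt: "vertices S = {vx S q i | q i. q \<in> squares S \<and> i < 4}"
  by (simp add: vertices_def vx_def)

lemma vx_in_vertices: "q \<in> squares S \<Longrightarrow> vx S q i \<in> vertices S"
  unfolding vertices_alt using vx_mod[of S q i]
  by (metis (mono_tags, lifting) mem_Collect_eq mod_less_divisor zero_less_numeral)

lemma in_corners_at: "(q, i) \<in> corners_at S v \<longleftrightarrow> q \<in> squares S \<and> i < 4 \<and> vx S q i = v"
  by (simp add: corners_at_def vx_def)

lemma finite_vertices: "finite (vertices S)"
proof -
  have "vertices S = (\<lambda>(q, i). vx S q i) ` (squares S \<times> {..<4})"
    unfolding vertices_alt by auto
  then show ?thesis using finite_squares by simp
qed

lemma vx_boundary_iff: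
  "v \<in> vertices S \<Longrightarrow> v \<in> boundary S \<longleftrightarrow>
    (\<exists>q i. q \<in> squares S \<and> i < 4 \<and> glue S (q, i) = None \<and> (v = vx S q i \<or> v = vx S q (Suc i)))"
proof
  assume "v \<in> vertices S" "v \<in> boundary S"
  from \<open>v \<in> vertices S\<close> obtain q1 i1 where v: "v = vx S q1 i1" "q1 \<in> squares S" "i1 < 4"
    unfolding vertices_alt by blast
  from \<open>v \<in> boundary S\<close> obtain q i t where
    b: "v = proj S (q, side_point i t)" "q \<in> squares S" "i < 4" "glue S (q, i) = None" "t \<in> {0..1}"
    unfolding boundary_def by blast
  note * = v(1,3,2) b(1-4) b(5)[unfolded atLeastAtMost_iff]
  have "((q1, corner i1), (q, side_point i t)) \<in> (paste S)\<^sup>*"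
    using v(1) b(1) by (simp add: vx_def proj_eq_iff[symmetric])
  from corner_class[where f = "\<lambda>_ _. ()", OF _ this v(3)]
  obtain i' where "i' < 4" "side_point i t = corner i'" by auto
  from side_point_eq_corner[OF this(2)] b(3,5) \<open>i' < 4\<close> have "t = 0 \<or> t = 1" by auto
  then have "v = vx S q i \<or> v = vx S q (Suc i)"
    using b(1) by (auto simp: vx_def)
  with b show "\<exists>q i. q \<in> squares S \<and> i < 4 \<and> glue S (q, i) = None \<and> (v = vx S q i \<or> v = vx S q (Suc i))"
    by blast
next
  assume "\<exists>q i. q \<in> squares S \<and> i < 4 \<and> glue S (q, i) = None \<and> (v = vx S q i \<or> v = vx S q (Suc i))"
  then obtain q i t where "q \<in> squares S" "i < 4" "glue S (q, i) = None"
    "v = proj S (q, side_point i t)" "t \<in> {0..1}"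
    unfolding vx_def by (metis atLeastAtMost_iff order_refl side_point_0 side_point_1 zero_le_one)
  then show "v \<in> boundary S" unfolding boundary_def by blast
qed

end

section \<open>Turning around a vertex\<close>

locale tiled_disc = pasted_squares S for S :: "'a square_pasting" +
  fixes black :: "'a \<Rightarrow> bool"
  assumes simply_connected: "simply_connected_space (surface S)"
    and four_squares: "four_squares_around_interior_vertices S"
    and chessboard: "chessboard_coloring S black"
begin

lemma glue_color: "glue S (q, i) = Some (q', j) \<Longrightarrow> black q' \<longleftrightarrow> \<not> black q"
  using chessboard unfolding chessboard_coloring_def by blast

lemma glue_neq: "glue S (q, i) = Some (q', j) \<Longrightarrow> q' \<noteq> q"
  using glue_color by blast

text \<open>Side \<open>i + 3\<close> ends at corner \<open>i\<close>, so crossing it leads from corner \<open>i\<close> of \<open>a\<close> to the next corner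
  around the same vertex.\<close>

abbreviation turn :: "'a \<Rightarrow> nat \<Rightarrow> 'a \<Rightarrow> nat \<Rightarrow> bool" where
  "turn a i b j \<equiv> glue S (a, (i + 3) mod 4) = Some (b, j)"

lemma interior_glued:
  assumes "v \<in> interior_vertices S" "q \<in> squares S" "i < 4" "vx S q i = v \<or> vx S q (Suc i) = v"
  shows "\<exists>q' j. glue S (q, i) = Some (q', j)"
proof (rule ccontr)
  assume "\<not> ?thesis"
  then have "glue S (q, i) = None" by (cases "glue S (q, i)") auto
  with assms vx_boundary_iff[of v] show False
    unfolding interior_vertices_def by blast
qed

lemma add3_mod: "((i + 3) mod 4 + 1) mod 4 = i" if "i < 4" for i :: nat
  using that by presburger

lemma Suc_add3_mod: "Suc ((i + 3) mod 4) mod 4 = i" if "i < 4" for i :: nat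
  using that by presburger

lemma vx_add3 [simp]: "i < 4 \<Longrightarrow> vx S q (Suc ((i + 3) mod 4)) = vx S q i"
  using vx_mod[of S q "Suc ((i + 3) mod 4)"] Suc_add3_mod[of i] by simp

lemma interior_vertex_next:
  assumes "v \<in> interior_vertices S" "(a, i) \<in> corners_at S v"
  obtains b j where "turn a i b j" "(b, j) \<in> corners_at S v"
proof -
  have ai: "a \<in> squares S" "i < 4" "vx S a i = v" using assms(2) by (auto simp: in_corners_at)
  obtain b j where g: "turn a i b j"
    using interior_glued[OF assms(1) ai(1), of "(i + 3) mod 4"] ai by auto
  moreover have "(b, j) \<in> corners_at S v"
    using glueD(3,4)[OF g] glue_vx(2)[OF g] ai by (simp add: in_corners_at)
  ultimately show thesis by (rule that)
qed

lemma next_inject: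
  assumes "glue S (a, (i + 3) mod 4) = Some c" "glue S (b, (j + 3) mod 4) = Some c" "i < 4" "j < 4"
  shows "(a, i) = (b, j)"
proof -
  obtain q k where c: "c = (q, k)" by (cases c)
  have "(a, (i + 3) mod 4) = (b, (j + 3) mod 4)"
    using glueD(5)[OF assms(1)[unfolded c]] glueD(5)[OF assms(2)[unfolded c]] by simp
  then show ?thesis using add3_mod[of i] add3_mod[of j] assms(3,4) by auto
qed

text \<open>Pasting side \<open>m\<close> to side \<open>j\<close> identifies corner \<open>m + 1\<close> with corner \<open>j\<close> and, read backwards, corner \<open>m\<close> with corner
  \<open>j + 1\<close>. As corners are identified only through pastings, a set of corners that respects these
  identifications contains all corners at a vertex or none.\<close>

lemma corners_at_closed:
  assumes "(a, i) \<in> A"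
    and closed: "\<And>q m q' j. glue S (q, m) = Some (q', j) \<Longrightarrow> (q, (m + 1) mod 4) \<in> A \<longleftrightarrow> (q', j) \<in> A"
    and "(a, i) \<in> corners_at S v"
  shows "corners_at S v \<subseteq> A"
proof
  fix c assume "c \<in> corners_at S v"
  then obtain b j where c: "c = (b, j)" "b \<in> squares S" "j < 4" "vx S b j = v"
    by (cases c) (auto simp: in_corners_at)
  have ai: "i < 4" "vx S a i = v" using assms(3) by (auto simp: in_corners_at)
  have "((a, i) \<in> A) = ((b, j) \<in> A)"
  proof (rule vx_eq_imp[where f = "\<lambda>q i. (q, i) \<in> A"])
    fix q i q' j assume g: "glue S (q, i) = Some (q', j)"
    show "((q, i) \<in> A) = ((q', (j + 1) mod 4) \<in> A) \<and> ((q, (i + 1) mod 4) \<in> A) = ((q', j) \<in> A)"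
      using closed[OF g] closed[OF glueD(5)[OF g]] by simp
  qed (use ai c in auto)
  then show "c \<in> A" using assms(1) c by simp
qed

text \<open>On a finite set of corners the injective map to the next corner is a permutation once it maps the
  set into itself, so closure in one direction is enough.\<close>

lemma corners_at_next_closed:
  assumes "(a, i) \<in> A" "finite A"
    and closed: "\<And>x. x \<in> A \<Longrightarrow> snd x < 4 \<and> glue S (fst x, (snd x + 3) mod 4) \<in> Some ` A"
    and ai: "(a, i) \<in> corners_at S v"
  shows "corners_at S v \<subseteq> A"
proof -
  define n where "n x = the (glue S (fst x, (snd x + 3) mod 4))" for x
  have n: "glue S (fst x, (snd x + 3) mod 4) = Some (n x)" "n x \<in> A" "snd x < 4" if "x \<in> A" for x
    using closed[OF that] by (auto simp: n_def)
  have "inj_on n A"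
  proof (rule inj_onI)
    fix x y assume "x \<in> A" "y \<in> A" "n x = n y"
    then show "x = y"
      using next_inject[of "fst x" "snd x" "n x" "fst y" "snd y"] n[of x] n[of y] by (simp add: prod_eq_iff)
  qed
  then have surj: "n ` A = A" using \<open>finite A\<close> n(2) by (simp add: endo_inj_surj image_subsetI)
  show ?thesis
  proof (rule corners_at_closed[OF assms(1) _ ai])
    fix q m q' j assume g: "glue S (q, m) = Some (q', j)"
    have m: "((m + 1) mod 4 + 3) mod 4 = m" using glueD(2)[OF g] by presburger
    show "((q, (m + 1) mod 4) \<in> A) = ((q', j) \<in> A)"
    proof
      assume "(q, (m + 1) mod 4) \<in> A"
      from n(1,2)[OF this] show "(q', j) \<in> A" using m g by simp
    next
      assume "(q', j) \<in> A"
      then obtain x where x: "x \<in> A" "n x = (q', j)" using surj by (metis imageE)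
      with n(1)[OF x(1)] have "glue S (fst x, (snd x + 3) mod 4) = Some (q', j)" by simp
      then have "glue S (q', j) = Some (fst x, (snd x + 3) mod 4)" by (rule glueD(5))
      with glueD(5)[OF g] have "fst x = q" "(snd x + 3) mod 4 = m" by auto
      with add3_mod[of "snd x"] n(3)[OF x(1)] have "x = (q, (m + 1) mod 4)" by (cases x) auto
      then show "(q, (m + 1) mod 4) \<in> A" using x(1) by simp
    qed
  qed
qed

text \<open>No side at an interior vertex is free, so turning around the vertex permutes the four corners at it.
  Since all of them are reached from any single one, the permutation is a 4-cycle.\<close>

lemma interior_vertex_cycle:
  assumes v: "v \<in> interior_vertices S" and ai: "(a, i) \<in> corners_at S v"
  obtains b j c k d l where
    "turn a i b j" "turn b j c k"
    "turn c k d l" "turn d l a i"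
    "corners_at S v = {(a, i), (b, j), (c, k), (d, l)}" "distinct [(a, i), (b, j), (c, k), (d, l)]"
proof -
  have vv: "v \<in> vertices S" using v by (simp add: interior_vertices_def)
  have card: "card (corners_at S v) = 4"
    using four_squares v unfolding four_squares_around_interior_vertices_def by blast
  obtain b j where b: "turn a i b j" "(b, j) \<in> corners_at S v"
    using interior_vertex_next[OF v ai] .
  obtain c k where c: "turn b j c k" "(c, k) \<in> corners_at S v"
    using interior_vertex_next[OF v b(2)] .
  obtain d l where d: "turn c k d l" "(d, l) \<in> corners_at S v"
    using interior_vertex_next[OF v c(2)] .
  obtain e m where e: "turn d l e m" "(e, m) \<in> corners_at S v"
    using interior_vertex_next[OF v d(2)] .
  have lt: "i < 4" "j < 4" "k < 4" "l < 4" "m < 4"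
    using ai b c d e by (auto simp: in_corners_at)
  have inj: "x = y" if "glue S (fst x, (snd x + 3) mod 4) = glue S (fst y, (snd y + 3) mod 4)"
    "glue S (fst x, (snd x + 3) mod 4) \<noteq> None" "snd x < 4" "snd y < 4" for x y :: "'a \<times> nat"
    using that next_inject[of "fst x" "snd x" _ "fst y" "snd y"] by auto
  have closed: "corners_at S v \<subseteq> A"
    if "(a, i) \<in> A" "finite A" "\<And>x. x \<in> A \<Longrightarrow> snd x < 4 \<and> glue S (fst x, (snd x + 3) mod 4) \<in> Some ` A" for A
    by (rule corners_at_next_closed[OF that(1,2) _ ai]) (rule that(3))
  \<comment> \<open>A cycle of fewer than four turns would be closed under turning and so consist of all corners at \<open>v\<close>.\<close>
  have small: False if "corners_at S v \<subseteq> A" "finite A" "card A < 4" for A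
    using card_mono[OF that(2,1)] card that(3) by simp
  have c3: "card {x, y, z} < 4" "card {x, y} < 4" "card {x} < 4" for x y z :: "'a \<times> nat"
    using card_insert_le_m1[of 3 "{y,z}" x] card_insert_le_m1[of 2 "{z}" y]
      card_insert_le_m1[of 2 "{y}" x]  by (auto simp: card_insert_if)
  have 1: "(a, i) \<noteq> (b, j)"
  proof
    assume eq: "(a, i) = (b, j)"
    have "corners_at S v \<subseteq> {(a, i)}" by (rule closed) (use b lt eq in auto)
    then show False using small c3 by blast
  qed
  have 2: "(a, i) \<noteq> (c, k)"
  proof
    assume eq: "(a, i) = (c, k)"
    have "corners_at S v \<subseteq> {(a, i), (b, j)}" by (rule closed) (use b c lt eq in auto)
    then show False using small c3 by blast
  qed
  have 3: "(a, i) \<noteq> (d, l)"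
  proof
    assume eq: "(a, i) = (d, l)"
    have "corners_at S v \<subseteq> {(a, i), (b, j), (c, k)}" by (rule closed) (use b c d lt eq in auto)
    then show False using small c3 by blast
  qed
  have 4: "(b, j) \<noteq> (c, k)" using inj[of "(a, i)" "(b, j)"] b c lt 1 by auto
  have 5: "(b, j) \<noteq> (d, l)" using inj[of "(a, i)" "(c, k)"] b d lt 2 by auto
  have 6: "(c, k) \<noteq> (d, l)" using inj[of "(b, j)" "(c, k)"] c d lt 4 by auto
  have dist: "distinct [(a, i), (b, j), (c, k), (d, l)]" using 1 2 3 4 5 6 by auto
  have fin: "finite (corners_at S v)" using card by (metis card.infinite zero_neq_numeral)
  have all: "corners_at S v = {(a, i), (b, j), (c, k), (d, l)}"
    using card_subset_eq[OF fin, of "{(a, i), (b, j), (c, k), (d, l)}"] ai b c d card dist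
      distinct_card[OF dist] by simp
  have "(e, m) \<noteq> (b, j)" using inj[of "(a, i)" "(d, l)"] b e lt 3 by auto
  moreover have "(e, m) \<noteq> (c, k)" using inj[of "(b, j)" "(d, l)"] c e lt 5 by auto
  moreover have "(e, m) \<noteq> (d, l)" using inj[of "(c, k)" "(d, l)"] d e lt 6 by auto
  ultimately have "(e, m) = (a, i)" using e(2) all by auto
  then show thesis using that b c d e dist all by blast
qed

end

section \<open>Local systems\<close>

text \<open>A local system attaches a copy of the type \<open>'g\<close> to every square; \<open>transport q i\<close> identifies the
  copy at \<open>q\<close> with the one at the neighbour across side \<open>i\<close>. Away from the interior vertices this is a covering
  of the surface, and the condition on the four squares around a vertex extends it over them.\<close>

locale local_system = tiled_disc S black for S :: "'a square_pasting" and black +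
  fixes transport :: "'a \<Rightarrow> nat \<Rightarrow> 'g \<Rightarrow> 'g"
  assumes transport_back: "glue S (q, i) = Some (q', j) \<Longrightarrow> transport q' j (transport q i x) = x"
    and transport_around: "turn a i b j \<Longrightarrow>
      turn b j c k \<Longrightarrow> turn c k d l \<Longrightarrow>
      turn d l a i \<Longrightarrow>
      transport d ((l + 3) mod 4) (transport c ((k + 3) mod 4)
        (transport b ((j + 3) mod 4) (transport a ((i + 3) mod 4) x))) = x"
begin

text \<open>The flat functions are the locally constant sections over an open set, written as functions of points
  before pasting.\<close>

definition flat :: "'a point set \<Rightarrow> ('a point \<Rightarrow> 'g) \<Rightarrow> bool" where
  "flat W g \<longleftrightarrow> saturated_open S W \<and> (\<forall>x. openin (pieces S) {b \<in> W. g b = x}) \<and>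
     (\<forall>q i q' j t. glue S (q, i) = Some (q', j) \<longrightarrow> 0 \<le> t \<longrightarrow> t \<le> 1 \<longrightarrow> (q, side_point i t) \<in> W \<longrightarrow>
        g (q', side_point j (1 - t)) = transport q i (g (q, side_point i t)))"

lemma flat_saturated: "flat W g \<Longrightarrow> saturated_open S W"
  by (simp add: flat_def)

lemma flat_paste:
  assumes "flat W g" "flat W' g'" "(a, b) \<in> paste S" "a \<in> W" "a \<in> W'"
  shows "g a = g' a \<longleftrightarrow> g b = g' b"
proof -
  obtain q i q' j t where *: "a = (q, side_point i t)" "b = (q', side_point j (1 - t))"
    "glue S (q, i) = Some (q', j)" "0 \<le> t" "t \<le> 1"
    using assms(3) unfolding paste_iff by blast
  have "g b = transport q i (g a)" "g' b = transport q i (g' a)"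
    using assms * unfolding flat_def by blast+
  then show ?thesis using transport_back[OF *(3)] by metis
qed

lemma openin_agree:
  assumes "flat W g" "flat W' g'"
  shows "openin (pieces S) {b \<in> W \<inter> W'. g b = g' b}" "openin (pieces S) {b \<in> W \<inter> W'. g b \<noteq> g' b}"
proof -
  have o: "openin (pieces S) ({b \<in> W. g b = x} \<inter> {b \<in> W'. g' b = y})" for x y
    using assms unfolding flat_def by blast
  have "{b \<in> W \<inter> W'. g b = g' b} = (\<Union>x. {b \<in> W. g b = x} \<inter> {b \<in> W'. g' b = x})"
    by auto
  then show "openin (pieces S) {b \<in> W \<inter> W'. g b = g' b}"
    using o by (metis (no_types, lifting) imageE openin_clauses(3))
  have "{b \<in> W \<inter> W'. g b \<noteq> g' b} = (\<Union>xy\<in>{xy. fst xy \<noteq> snd xy}. {b \<in> W. g b = fst xy} \<inter> {b \<in> W'. g' b = snd xy})"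
    by auto
  moreover have "openin (pieces S) \<dots>"
    by (rule openin_clauses(3)) (use o in blast)
  ultimately show "openin (pieces S) {b \<in> W \<inter> W'. g b \<noteq> g' b}" by simp
qed

text \<open>Two flat functions agree, or differ, on whole neighbourhoods and on whole points of the surface. This is
  what makes continuation along paths unique.\<close>

lemma saturated_agree:
  assumes "flat W g" "flat W' g'"
  shows "saturated_open S {b \<in> W \<inter> W'. g b = g' b}" "saturated_open S {b \<in> W \<inter> W'. g b \<noteq> g' b}"
proof -
  note sat = saturated_openD[OF flat_saturated[OF assms(1)]] saturated_openD[OF flat_saturated[OF assms(2)]]
  have "b \<in> {b \<in> W \<inter> W'. g b = g' b}" if "(a, b) \<in> paste S" "a \<in> {b \<in> W \<inter> W'. g b = g' b}" for a b
    using flat_paste[OF assms that(1)] sat[OF that(1)] that(2) by simp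
  then show "saturated_open S {b \<in> W \<inter> W'. g b = g' b}"
    unfolding saturated_open_def using openin_agree[OF assms] by meson
  have "b \<in> {b \<in> W \<inter> W'. g b \<noteq> g' b}" if "(a, b) \<in> paste S" "a \<in> {b \<in> W \<inter> W'. g b \<noteq> g' b}" for a b
    using flat_paste[OF assms that(1)] sat[OF that(1)] that(2) by simp
  then show "saturated_open S {b \<in> W \<inter> W'. g b \<noteq> g' b}"
    unfolding saturated_open_def using openin_agree[OF assms] by meson
qed

lemma flat_restrict:
  assumes "flat W g" "saturated_open S W'" "W' \<subseteq> W"
  shows "flat W' g"
proof -
  have "{b \<in> W'. g b = x} = {b \<in> W. g b = x} \<inter> W'" for x using assms(3) by auto
  moreover have "openin (pieces S) {b \<in> W. g b = x}" for x
    using assms(1) unfolding flat_def by simp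
  moreover have "openin (pieces S) W'" using assms(2) unfolding saturated_open_def by simp
  ultimately have o: "openin (pieces S) {b \<in> W'. g b = x}" for x by (simp add: openin_Int)
  show ?thesis
    unfolding flat_def
  proof (intro conjI allI impI)
    fix q i q' j t
    assume *: "glue S (q, i) = Some (q', j)" "0 \<le> t" "t \<le> 1" "(q, side_point i t) \<in> W'"
    then have "(q, side_point i t) \<in> W" using assms(3) by (simp only: subsetD)
    with * assms(1) show "g (q', side_point j (1 - t)) = transport q i (g (q, side_point i t))"
      unfolding flat_def by simp
  qed (use o assms(2) in simp_all)
qed

text \<open>A chart is an open set over which the local system is trivial.\<close>

definition chart :: "'a point set \<Rightarrow> bool" where
  "chart W \<longleftrightarrow> saturated_open S W \<and> (\<forall>b\<in>W. \<forall>x. \<exists>g. flat W g \<and> g b = x)"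


lemma openin_pieces_single:
  assumes "q \<in> squares S" "open V"
  shows "openin (pieces S) ({q} \<times> (unit_square \<inter> V))"
proof -
  have "{p. (r, p) \<in> {q} \<times> (unit_square \<inter> V)} = (if r = q then unit_square \<inter> V else {})" for r
    by auto
  then show ?thesis using assms unfolding openin_pieces by (auto simp: openin_open_Int)
qed

lemma openin_locally_constant:
  assumes "\<And>q. q \<in> squares S \<Longrightarrow> finite (I q) \<and> (\<forall>i\<in>I q. open (V q i))"
    and "\<And>b. b \<in> W \<longleftrightarrow> b \<in> pc S \<and> (\<exists>i\<in>I (fst b). snd b \<in> V (fst b) i)"
    and "\<And>q i p. q \<in> squares S \<Longrightarrow> i \<in> I q \<Longrightarrow> p \<in> unit_square \<inter> V q i \<Longrightarrow> g (q, p) = f q i"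
  shows "openin (pieces S) {b \<in> W. P (g b)}"
proof -
  have "{b \<in> W. P (g b)} = (\<Union>q\<in>squares S. \<Union>i\<in>{i\<in>I q. P (f q i)}. {q} \<times> (unit_square \<inter> V q i))"
    using assms(2,3) by fastforce
  moreover have "openin (pieces S) ({q} \<times> (unit_square \<inter> V q i))" if "q \<in> squares S" "i \<in> I q" for q i
    using openin_pieces_single assms(1) that by blast
  ultimately show ?thesis by (auto intro!: openin_clauses(3))
qed

definition side_dist :: "nat \<Rightarrow> real \<times> real \<Rightarrow> real" where
  "side_dist m p = [snd p, 1 - fst p, 1 - snd p, fst p] ! m"

lemma side_dist_simps [simp]:
  "side_dist 0 p = snd p" "side_dist (Suc 0) p = 1 - fst p"
  "side_dist 2 p = 1 - snd p" "side_dist 3 p = fst p"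
  by (auto simp: side_dist_def)

definition off_other_sides :: "nat \<Rightarrow> (real \<times> real) set" where
  "off_other_sides i = {p. \<forall>m<4. m \<noteq> i \<longrightarrow> side_dist m p > 0}"

lemma open_side_dist: "m < 4 \<Longrightarrow> open {p. side_dist m p > 0}"
proof -
  assume "m < 4"
  then have "continuous_on UNIV (side_dist m)"
    unfolding less_4_cases
    by (elim disjE) (simp_all add: continuous_on_fst continuous_on_snd continuous_on_diff cong: continuous_on_cong)
  then show ?thesis by (simp add: open_Collect_less)
qed

lemma open_off_other_sides: "open (off_other_sides i)"
proof -
  have "off_other_sides i = (\<Inter>m\<in>{m. m < 4 \<and> m \<noteq> i}. {p. side_dist m p > 0})"
    by (auto simp: off_other_sides_def)
  moreover have "open (\<Inter>m\<in>{m. m < 4 \<and> m \<noteq> i}. {p. side_dist m p > 0})"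
    by (rule open_INT) (auto intro: open_side_dist)
  ultimately show ?thesis by simp
qed

lemma side_point_off_other_sides:
  "m < 4 \<Longrightarrow> i < 4 \<Longrightarrow> side_point m s \<in> off_other_sides i \<longleftrightarrow> m = i \<and> 0 < s \<and> s < 1"
  unfolding off_other_sides_def less_4_cases
  by (elim disjE) (auto simp: side_point_simps)

lemma interior_off_other_sides:
  "0 < fst p \<Longrightarrow> fst p < 1 \<Longrightarrow> 0 < snd p \<Longrightarrow> snd p < 1 \<Longrightarrow> p \<in> off_other_sides i"
  unfolding off_other_sides_def less_4_cases by auto

text \<open>Near the interior of a side the surface consists of one or two squares without their other sides. The
  colours show that the two squares are different, so a value can be chosen on each of them.\<close>

lemma flat_side:
  assumes "q \<in> squares S" "i < 4"
    and W: "W = {b \<in> pc S. fst b = q \<and> snd b \<in> off_other_sides i \<or>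
      (\<exists>j. glue S (q, i) = Some (fst b, j) \<and> snd b \<in> off_other_sides j)}"
  shows "flat W (\<lambda>b. if fst b = q then x else transport q i x)"
proof -
  define I where "I r = (if r = q then {i} else {j. glue S (q, i) = Some (r, j)})" for r
  have WI: "b \<in> W \<longleftrightarrow> b \<in> pc S \<and> (\<exists>j\<in>I (fst b). snd b \<in> off_other_sides j)" for b
  proof (cases "fst b = q")
    case True then show ?thesis using glue_neq[of q i "fst b"] by (auto simp: W I_def)
  next
    case False then show ?thesis by (auto simp: W I_def)
  qed
  have I: "finite (I r)" for r
  proof -
    have "I r \<subseteq> {..<4}" using assms(2) by (auto simp: I_def dest: glueD(4) split: if_splits)
    then show ?thesis by (rule finite_subset) simp
  qed
  have open1: "openin (pieces S) {b \<in> W. P (if fst b = q then x else transport q i x)}" for P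
    by (rule openin_locally_constant[where I = I and V = "\<lambda>_. off_other_sides" and
          f = "\<lambda>r j. if r = q then x else transport q i x"])
      (use I open_off_other_sides WI in auto)
  have inW: "0 < t \<and> t < 1 \<and> (r = q \<and> m = i \<or> r' = q \<and> k = i \<and> glue S (q, i) = Some (r, m))"
    if *: "(r, side_point m t) \<in> W" "glue S (r, m) = Some (r', k)" for r m t r' k
  proof -
    from *(1) consider "r = q" "side_point m t \<in> off_other_sides i"
      | j where "glue S (q, i) = Some (r, j)" "side_point m t \<in> off_other_sides j"
      unfolding W by auto
    then show ?thesis
    proof cases
      case 1 then show ?thesis using side_point_off_other_sides[of m i t] glueD(2)[OF *(2)] assms(2) by simp
    next
      case 2
      then have "0 < t \<and> t < 1 \<and> m = j"
        using side_point_off_other_sides[of m j t] glueD(2)[OF *(2)] glueD(4)[OF 2(1)] by simp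
      then show ?thesis using glueD(5)[OF 2(1)] *(2) 2(1) by simp
    qed
  qed
  have sat: "saturated_open S W"
    unfolding saturated_open_def
  proof (intro conjI allI impI)
    show "openin (pieces S) W" using open1[of "\<lambda>_. True"] by simp
    fix a b assume "(a, b) \<in> paste S" "a \<in> W"
    then obtain r m r' k t where *: "a = (r, side_point m t)" "b = (r', side_point k (1 - t))"
      "glue S (r, m) = Some (r', k)" "0 \<le> t" "t \<le> 1"
      unfolding paste_iff by blast
    from inW[of r m t r' k] *(1,3) \<open>a \<in> W\<close> have t: "0 < t" "t < 1" and
      c: "r = q \<and> m = i \<or> r' = q \<and> k = i \<and> glue S (q, i) = Some (r, m)" by auto
    have "side_point k (1 - t) \<in> unit_square \<inter> off_other_sides k"
      using side_point_off_other_sides[of k k] side_point_in_unit_square t glueD(4)[OF *(3)] by simp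
    then show "b \<in> W" using c *(2,3) glueD(3)[OF *(3)] unfolding W by auto
  qed
  show ?thesis
    unfolding flat_def
  proof (intro conjI allI impI)
    fix r m r' k t
    assume *: "glue S (r, m) = Some (r', k)" "0 \<le> t" "t \<le> 1" "(r, side_point m t) \<in> W"
    from inW[OF *(4,1)] have "r = q \<and> m = i \<or> r' = q \<and> k = i \<and> glue S (q, i) = Some (r, m)" by blast
    then show "(if fst (r', side_point k (1 - t)) = q then x else transport q i x) =
      transport r m (if fst (r, side_point m t) = q then x else transport q i x)"
    proof
      assume "r = q \<and> m = i" then show ?thesis using glue_neq[OF *(1)] by simp
    next
      assume "r' = q \<and> k = i \<and> glue S (q, i) = Some (r, m)"
      then show ?thesis using glue_neq[OF *(1)] transport_back[of q i r m x] by auto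
    qed
  next
    show "openin (pieces S) {b \<in> W. (if fst b = q then x else transport q i x) = y}" for y
      by (rule open1)
  qed (rule sat)
qed

lemma chart_side:
  assumes "q \<in> squares S" "i < 4"
    and W: "W = {b \<in> pc S. fst b = q \<and> snd b \<in> off_other_sides i \<or>
      (\<exists>j. glue S (q, i) = Some (fst b, j) \<and> snd b \<in> off_other_sides j)}"
  shows "chart W"
  unfolding chart_def
proof (intro conjI ballI allI)
  note flat = flat_side[OF assms]
  show "saturated_open S W" using flat_saturated[OF flat] .
  fix b x assume "b \<in> W"
  then consider "fst b = q" | q' j where "glue S (q, i) = Some (q', j)" "fst b = q'"
    unfolding W by auto
  then show "\<exists>g. flat W g \<and> g b = x"
  proof cases
    case 1 then show ?thesis using flat[of x] by auto
  next
    case 2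
    have "transport q i (transport q' j x) = x"
      using transport_back[OF glueD(5)[OF 2(1)]] .
    then show ?thesis using flat[of "transport q' j x"] 2 glue_neq[OF 2(1)]
      by (intro exI[of _ "\<lambda>b. if fst b = q then transport q' j x else transport q i (transport q' j x)"]) auto
  qed
qed

section \<open>Flat functions around a vertex\<close>

text \<open>The open quarters at the corners of one square are disjoint. This keeps the values at different corners of
  a square apart even if they should belong to the same vertex.\<close>

definition quarter :: "nat \<Rightarrow> (real \<times> real) set" where
  "quarter i = {p. \<bar>fst p - fst (corner i)\<bar> < 1/2 \<and> \<bar>snd p - snd (corner i)\<bar> < 1/2}"

lemma open_quarter: "open (quarter i)"
  unfolding quarter_def
  by (intro open_Collect_conj open_Collect_less continuous_intros)

lemma corner_in_quarter: "corner i \<in> quarter i"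
  by (simp add: quarter_def)

lemma quarter_unique: "p \<in> quarter i \<Longrightarrow> p \<in> quarter j \<Longrightarrow> i < 4 \<Longrightarrow> j < 4 \<Longrightarrow> i = j"
  unfolding quarter_def less_4_cases by (elim disjE) (auto simp: abs_if split: if_splits)

lemma side_point_in_quarter:
  assumes "m < 4" "i < 4" "0 \<le> s" "s \<le> 1"
  shows "side_point m s \<in> quarter i \<longleftrightarrow> m = i \<and> s < 1/2 \<or> (m + 1) mod 4 = i \<and> s > 1/2"
  using assms unfolding quarter_def less_4_cases
  by (elim disjE) (auto simp: side_point_simps abs_if split: if_splits)

text \<open>The values that a flat function can take at the corners of squares that meet at \<open>v\<close>; the condition \<open>vx S q (Suc m) = v\<close>
  selects the sides that end at \<open>v\<close>, and every pasting at \<open>v\<close> is of this form for one of the two squares.\<close>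

definition flat_around :: "'a point set \<Rightarrow> ('a \<Rightarrow> nat \<Rightarrow> 'g) \<Rightarrow> bool" where
  "flat_around v \<tau> \<longleftrightarrow> (\<forall>q m q' j. glue S (q, m) = Some (q', j) \<longrightarrow> vx S q (Suc m) = v \<longrightarrow>
     \<tau> q' j = transport q m (\<tau> q ((m + 1) mod 4)))"

lemma flat_around_back:
  assumes "flat_around v \<tau>" "glue S (q, m) = Some (q', j)" "vx S q m = v"
  shows "\<tau> q' ((j + 1) mod 4) = transport q m (\<tau> q m)"
proof -
  note g = glueD(5)[OF assms(2)]
  have "vx S q' (Suc j) = v" using glue_vx(1)[OF assms(2)] assms(3) by simp
  then have "\<tau> q m = transport q' j (\<tau> q' ((j + 1) mod 4))"
    using assms(1) g unfolding flat_around_def by blast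
  then show ?thesis using transport_back[OF g] by simp
qed

lemma flat_vertex:
  assumes "flat_around v \<tau>" and W: "W = {b \<in> pc S. \<exists>i. (fst b, i) \<in> corners_at S v \<and> snd b \<in> quarter i}"
  shows "\<exists>g. flat W g \<and> (\<forall>q i p. (q, i) \<in> corners_at S v \<longrightarrow> p \<in> quarter i \<longrightarrow> g (q, p) = \<tau> q i)"
proof -
  define g where "g b = \<tau> (fst b) (THE i. i < 4 \<and> snd b \<in> quarter i)" for b
  have g: "g (q, p) = \<tau> q i" if "i < 4" "p \<in> quarter i" for q i p
  proof -
    have "(THE i. i < 4 \<and> p \<in> quarter i) = i" using that quarter_unique by blast
    then show ?thesis by (simp add: g_def)
  qed
  define I where "I q = {i. (q, i) \<in> corners_at S v}" for q
  have I: "finite (I q)" for q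
    by (rule finite_subset[of _ "{..<4}"]) (auto simp: I_def in_corners_at)
  have open1: "openin (pieces S) {b \<in> W. P (g b)}" for P
    by (rule openin_locally_constant[where I = I and V = "\<lambda>_. quarter" and f = \<tau>])
      (use I open_quarter g in \<open>simp_all add: W I_def in_corners_at\<close>)
  have step: "(r', side_point k (1 - t)) \<in> W \<and> g (r', side_point k (1 - t)) = transport r m (g (r, side_point m t))"
    if *: "(r, side_point m t) \<in> W" "glue S (r, m) = Some (r', k)" "0 \<le> t" "t \<le> 1" for r m t r' k
  proof -
    note gl = glueD[OF *(2)]
    obtain i where i: "i < 4" "vx S r i = v" "side_point m t \<in> quarter i"
      using *(1) unfolding W by (auto simp: in_corners_at)
    have us: "side_point k (1 - t) \<in> unit_square" using side_point_in_unit_square *(3,4) by simp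
    from i(3) side_point_in_quarter[of m i t] gl * i(1)
    have "m = i \<and> t < 1/2 \<or> (m + 1) mod 4 = i \<and> t > 1/2" by simp
    then show ?thesis
    proof
      assume c: "m = i \<and> t < 1/2"
      have q: "side_point k (1 - t) \<in> quarter ((k + 1) mod 4)"
        using side_point_in_quarter[of k "(k + 1) mod 4" "1 - t"] gl *(3,4) c by simp
      have "vx S r' (Suc k) = v" using glue_vx(1)[OF *(2)] c i by simp
      then have "(r', (k + 1) mod 4) \<in> corners_at S v" using gl by (simp add: in_corners_at)
      then show ?thesis
        using q us g[of "(k + 1) mod 4" _ r'] g[OF i(1,3), of r]
          flat_around_back[OF assms(1) *(2)] c i gl(3) unfolding W by auto
    next
      assume c: "(m + 1) mod 4 = i \<and> t > 1/2"
      have q: "side_point k (1 - t) \<in> quarter k"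
        using side_point_in_quarter[of k k "1 - t"] gl *(3,4) c by simp
      have v: "vx S r (Suc m) = v" using c i vx_mod[of S r "Suc m"] by simp
      then have "(r', k) \<in> corners_at S v" using gl glue_vx(2)[OF *(2)] by (simp add: in_corners_at)
      moreover have "\<tau> r' k = transport r m (\<tau> r i)"
        using assms(1) *(2) v c unfolding flat_around_def by blast
      ultimately show ?thesis
        using q us g[OF gl(4) q] g[OF i(1,3), of r] gl(3) unfolding W by auto
    qed
  qed
  have "flat W g"
    unfolding flat_def saturated_open_def
  proof (intro conjI allI impI)
    show "openin (pieces S) W" using open1[of "\<lambda>_. True"] by simp
    show "openin (pieces S) {b \<in> W. g b = x}" for x by (rule open1)
    fix a b assume "(a, b) \<in> paste S" "a \<in> W"
    then show "b \<in> W" using step unfolding paste_iff by blast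
  qed (use step in blast)
  moreover have "\<forall>q i p. (q, i) \<in> corners_at S v \<longrightarrow> p \<in> quarter i \<longrightarrow> g (q, p) = \<tau> q i"
    using g unfolding in_corners_at by simp
  ultimately show ?thesis by blast
qed


text \<open>The values obtained from \<open>x0\<close> at \<open>e\<close> by following the partial map \<open>n\<close>. If \<open>n\<close> is injective and
  \<open>e\<close> has no predecessor, then no element is reached twice and the values are unique.\<close>

inductive carried :: "('c \<Rightarrow> 'c option) \<Rightarrow> ('c \<Rightarrow> 'g \<Rightarrow> 'g) \<Rightarrow> 'c \<Rightarrow> 'g \<Rightarrow> 'c \<Rightarrow> 'g \<Rightarrow> bool"
  for n tr e x0 where
  start: "carried n tr e x0 e x0"
| step: "carried n tr e x0 c x \<Longrightarrow> n c = Some d \<Longrightarrow> carried n tr e x0 d (tr c x)"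

lemma carried_unique:
  assumes "\<forall>c c' d. n c = Some d \<longrightarrow> n c' = Some d \<longrightarrow> c = c'" "\<forall>c. n c \<noteq> Some e"
    and "carried n tr e x0 c x" "carried n tr e x0 c y"
  shows "x = y"
  using assms(3,4)
proof (induction arbitrary: y)
  case start
  then show ?case by (cases rule: carried.cases) (use assms(2) in auto)
next
  case (step c x d)
  from step.prems show ?case
  proof (cases rule: carried.cases)
    case start then show ?thesis using assms(2) step.hyps(2) by simp
  next
    case (step c' x')
    have "c' = c" using assms(1) step(3) \<open>n c = Some d\<close> by blast
    then show ?thesis using step(1,2) \<open>\<And>y. carried n tr e x0 c y \<Longrightarrow> x = y\<close> by simp
  qed
qed

lemma carried_surj:
  assumes "\<forall>c d y. n c = Some d \<longrightarrow> (\<exists>x. tr c x = y)" "carried n tr e x0 c x"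
  shows "\<exists>x1. carried n tr e x1 c y"
  using assms(2)
proof (induction arbitrary: y)
  case start then show ?case by (intro exI) (rule carried.start)
next
  case (step c x d)
  obtain z where z: "tr c z = y" using assms(1) step.hyps(2) by blast
  obtain x1 where "carried n tr e x1 c z" using step.IH by blast
  from carried.step[of n, OF this step.hyps(2)] show ?case using z by blast
qed

lemma carried_domain:
  assumes "\<forall>c c' d. n c = Some d \<longrightarrow> n c' = Some d \<longrightarrow> c = c'" "\<forall>c. n c \<noteq> Some e" "n c = Some d"
  shows "(\<exists>x. carried n tr e x0 c x) \<longleftrightarrow> (\<exists>x. carried n tr e x0 d x)"
proof
  assume "\<exists>x. carried n tr e x0 c x"
  then obtain x where "carried n tr e x0 c x" ..
  from carried.step[of n, OF this assms(3)] show "\<exists>x. carried n tr e x0 d x" by blast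
next
  assume "\<exists>x. carried n tr e x0 d x"
  then obtain x where "carried n tr e x0 d x" ..
  then show "\<exists>x. carried n tr e x0 c x"
  proof (cases rule: carried.cases)
    case start then show ?thesis using assms(2,3) by simp
  next
    case (step c' x') then show ?thesis using assms(1,3) by blast
  qed
qed

text \<open>The chain starts at \<open>e\<close>, and by \<open>vx_eq_imp\<close> a value at \<open>e\<close> is carried to every corner at the vertex. Since
  the steps are surjective, the value at \<open>e\<close> can be chosen so as to arrive with \<open>x\<close> at the given corner.\<close>

lemma flat_around_chain:
  assumes inj: "\<forall>c c' d. n c = Some d \<longrightarrow> n c' = Some d \<longrightarrow> c = c'" and e: "\<forall>c. n c \<noteq> Some e"
    and surj: "\<forall>c d y. n c = Some d \<longrightarrow> (\<exists>x. tr c x = y)"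
    and link: "\<And>q m q' j. glue S (q, m) = Some (q', j) \<Longrightarrow>
      n (q, (m + 1) mod 4) = Some (q', j) \<and> tr (q, (m + 1) mod 4) = transport q m \<or>
      n (q', j) = Some (q, (m + 1) mod 4) \<and> tr (q', j) = transport q' j"
    and v: "snd e < 4" "vx S (fst e) (snd e) = v" "(q, i) \<in> corners_at S v"
  shows "\<exists>\<tau>. flat_around v \<tau> \<and> \<tau> q i = x"
proof -
  let ?R = "carried n tr e"
  have all: "\<exists>y. ?R x0 (q, i) y" if "vx S q i = v" "i < 4" for x0 q i
  proof -
    have step: "(\<exists>y. ?R x0 (q, (m + 1) mod 4) y) = (\<exists>y. ?R x0 (q', j) y)"
      if "glue S (q, m) = Some (q', j)" for q m q' j
      using link[OF that] carried_domain[of n, OF inj e] by blast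
    have "(\<exists>y. ?R x0 (q, i) y) = (\<exists>y. ?R x0 (fst e, snd e) y)"
    proof (rule vx_eq_imp[where f = "\<lambda>q i. \<exists>y. ?R x0 (q, i) y"])
      show "(\<exists>y. ?R x0 (q, i) y) = (\<exists>y. ?R x0 (q', (j + 1) mod 4) y) \<and>
        (\<exists>y. ?R x0 (q, (i + 1) mod 4) y) = (\<exists>y. ?R x0 (q', j) y)"
        if g: "glue S (q, i) = Some (q', j)" for q i q' j
        using step[OF g] step[OF glueD(5)[OF g]] by simp
    qed (use that v in auto)
    then show ?thesis using carried.start[of n tr e x0] by auto
  qed
  obtain x1 where x1: "?R x1 (q, i) x"
    using all[of q i undefined] carried_surj[of n, OF surj] v(3) unfolding in_corners_at by blast
  define \<tau> where "\<tau> q i = (THE y. ?R x1 (q, i) y)" for q i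
  have \<tau>: "\<tau> q i = y" if "?R x1 (q, i) y" for q i y
    unfolding \<tau>_def using that carried_unique[of n, OF inj e] by blast
  have "\<tau> q' j = transport q m (\<tau> q ((m + 1) mod 4))"
    if g: "glue S (q, m) = Some (q', j)" "vx S q (Suc m) = v" for q m q' j
  proof -
    obtain y where y: "?R x1 (q, (m + 1) mod 4) y" using all[of q "(m + 1) mod 4"] g(2) by auto
    have "vx S q' j = v" using glue_vx(2)[OF g(1)] g(2) by simp
    then obtain y' where y': "?R x1 (q', j) y'" using all[of q' j] glueD(4)[OF g(1)] by blast
    from link[OF g(1)] show ?thesis
    proof (elim disjE conjE)
      assume "n (q, (m + 1) mod 4) = Some (q', j)" "tr (q, (m + 1) mod 4) = transport q m"
      then show ?thesis using \<tau>[OF y] \<tau>[OF carried.step[OF y]] by simp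
    next
      assume "n (q', j) = Some (q, (m + 1) mod 4)" "tr (q', j) = transport q' j"
      then show ?thesis
        using \<tau>[OF y'] \<tau>[OF carried.step[OF y']] transport_back[OF glueD(5)[OF g(1)]] by simp
    qed
  qed
  then show ?thesis using \<tau>[OF x1] unfolding flat_around_def by blast
qed

lemma Suc_mod4_inject: "(m + 1) mod 4 = (n + 1) mod 4 \<Longrightarrow> m < 4 \<Longrightarrow> n < 4 \<Longrightarrow> m = (n::nat)"
  by (auto simp: less_4_cases)

lemma transport_surj: "glue S (q, i) = Some (q', j) \<Longrightarrow> \<exists>x. transport q i x = y"
  using transport_back[OF glueD(5)] by blast

text \<open>The corners around a boundary vertex form a chain with a free side at its end. They are numbered by turning
  away from this free side, in one direction or the other depending on which end of the side lies at the vertex.\<close>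

lemma flat_around_boundary:
  assumes "q0 \<in> squares S" "m0 < 4" "glue S (q0, m0) = None" "v = vx S q0 m0 \<or> v = vx S q0 (Suc m0)"
    and qi: "(q, i) \<in> corners_at S v"
  shows "\<exists>\<tau>. flat_around v \<tau> \<and> \<tau> q i = x"
  using assms(4)
proof
  assume v: "v = vx S q0 m0"
  let ?n = "\<lambda>(q, i). if i < 4 then glue S (q, (i + 3) mod 4) else None"
  show ?thesis
  proof (rule flat_around_chain[of ?n "(q0, m0)" "\<lambda>(q, i). transport q ((i + 3) mod 4)"])
    have "c = c'" if "?n c = Some d" "?n c' = Some d" for c c' d
      using that next_inject[of "fst c" "snd c" d "fst c'" "snd c'"] by (auto split: prod.splits if_splits)
    then show "\<forall>c c' d. ?n c = Some d \<longrightarrow> ?n c' = Some d \<longrightarrow> c = c'" by blast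
    have "?n c \<noteq> Some (q0, m0)" for c
      using glueD(5)[of "fst c" "(snd c + 3) mod 4" q0 m0] assms(3) by (auto split: prod.splits if_splits)
    then show "\<forall>c. ?n c \<noteq> Some (q0, m0)" by blast
    have "\<exists>x. (case c of (q, i) \<Rightarrow> transport q ((i + 3) mod 4)) x = y" if "?n c = Some d" for c d y
      using that transport_surj[of "fst c" "(snd c + 3) mod 4" "fst d" "snd d" y] by (auto split: prod.splits if_splits)
    then show "\<forall>c d y. ?n c = Some d \<longrightarrow> (\<exists>x. (case c of (q, i) \<Rightarrow> transport q ((i + 3) mod 4)) x = y)" by blast
    show "?n (q, (m + 1) mod 4) = Some (q', j) \<and> (case (q, (m + 1) mod 4) of (q, i) \<Rightarrow> transport q ((i + 3) mod 4)) = transport q m \<or>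
      ?n (q', j) = Some (q, (m + 1) mod 4) \<and> (case (q', j) of (q, i) \<Rightarrow> transport q ((i + 3) mod 4)) = transport q' j"
      if g: "glue S (q, m) = Some (q', j)" for q m q' j
    proof -
      have "((m + 1) mod 4 + 3) mod 4 = m" using glueD(2)[OF g] by presburger
      then show ?thesis using g by simp
    qed
  qed (use assms(2) v qi in auto)
next
  assume v: "v = vx S q0 (Suc m0)"
  let ?n = "\<lambda>s. map_option (\<lambda>(q', j). (q', (j + 1) mod 4)) (glue S s)"
  have n: "\<exists>q' j. glue S c = Some (q', j) \<and> d = (q', (j + 1) mod 4)" if "?n c = Some d" for c d
    using that by (cases "glue S c") auto
  show ?thesis
  proof (rule flat_around_chain[of ?n "(q0, (m0 + 1) mod 4)" "\<lambda>(q, i). transport q i"])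
    have "c = c'" if c: "?n c = Some d" "?n c' = Some d" for c c' d
    proof -
      obtain a i where a: "glue S (fst c, snd c) = Some (a, i)" "d = (a, (i + 1) mod 4)"
        using n[OF c(1)] unfolding prod.collapse by blast
      obtain b j where b: "glue S (fst c', snd c') = Some (b, j)" "d = (b, (j + 1) mod 4)"
        using n[OF c(2)] unfolding prod.collapse by blast
      have "i = j" using a(2) b(2) Suc_mod4_inject[of i j] glueD(4)[OF a(1)] glueD(4)[OF b(1)] by simp
      then show ?thesis using a b glueD(5)[OF a(1)] glueD(5)[OF b(1)] by (simp add: prod_eq_iff)
    qed
    then show "\<forall>c c' d. ?n c = Some d \<longrightarrow> ?n c' = Some d \<longrightarrow> c = c'" by blast
    have "?n c \<noteq> Some (q0, (m0 + 1) mod 4)" for c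
    proof
      assume "?n c = Some (q0, (m0 + 1) mod 4)"
      then obtain j where j: "glue S (fst c, snd c) = Some (q0, j)" "(m0 + 1) mod 4 = (j + 1) mod 4" using n by fastforce
      then have "j = m0" using Suc_mod4_inject[of m0 j] glueD(4)[OF j(1)] assms(2) by simp
      then show False using glueD(5)[OF j(1)] assms(3) by simp
    qed
    then show "\<forall>c. ?n c \<noteq> Some (q0, (m0 + 1) mod 4)" by blast
    have "\<exists>x. (case c of (q, i) \<Rightarrow> transport q i) x = y" if "?n c = Some d" for c d y
      using n[OF that] transport_surj[of "fst c" "snd c"] by (auto split: prod.splits)
    then show "\<forall>c d y. ?n c = Some d \<longrightarrow> (\<exists>x. (case c of (q, i) \<Rightarrow> transport q i) x = y)" by blast
    show "?n (q, (m + 1) mod 4) = Some (q', j) \<and> (case (q, (m + 1) mod 4) of (q, i) \<Rightarrow> transport q i) = transport q m \<or>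
      ?n (q', j) = Some (q, (m + 1) mod 4) \<and> (case (q', j) of (q, i) \<Rightarrow> transport q i) = transport q' j"
      if g: "glue S (q, m) = Some (q', j)" for q m q' j using glueD(5)[OF g] by simp
  qed (use assms(2) v qi in auto)
qed

text \<open>At an interior vertex the corners form a cycle instead of a chain, and the values carried around it return
  to the first value because the transport around the vertex is the identity.\<close>

lemma flat_around_exists:
  assumes "(q, i) \<in> corners_at S v"
  shows "\<exists>\<tau>. flat_around v \<tau> \<and> \<tau> q i = x"
proof (cases "v \<in> boundary S")
  case True
  have qi: "q \<in> squares S" "i < 4" "vx S q i = v" using assms by (auto simp: in_corners_at)
  then have "v \<in> vertices S" using vx_in_vertices by blast
  with True vx_boundary_iff obtain q0 m0 where free: "q0 \<in> squares S" "m0 < 4" "glue S (q0, m0) = None"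
    "v = vx S q0 m0 \<or> v = vx S q0 (Suc m0)" by blast
  from flat_around_boundary[OF free assms] show ?thesis .
next
  case False
  then have v: "v \<in> interior_vertices S"
    using assms vx_in_vertices by (auto simp: interior_vertices_def in_corners_at)
  obtain b j c k d l where cyc:
    "turn q i b j" "turn b j c k"
    "turn c k d l" "turn d l q i"
    and all: "corners_at S v = {(q, i), (b, j), (c, k), (d, l)}"
    and dist: "distinct [(q, i), (b, j), (c, k), (d, l)]"
    using interior_vertex_cycle[OF v assms] .
  define xb xc xd where "xb = transport q ((i + 3) mod 4) x"
    and "xc = transport b ((j + 3) mod 4) xb" and "xd = transport c ((k + 3) mod 4) xc"
  have xa: "transport d ((l + 3) mod 4) xd = x"
    unfolding xb_def xc_def xd_def by (rule transport_around[OF cyc])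
  define \<tau> where "\<tau> r m = (if (r, m) = (q, i) then x else if (r, m) = (b, j) then xb
    else if (r, m) = (c, k) then xc else xd)" for r m
  have \<tau>: "\<tau> q i = x" "\<tau> b j = xb" "\<tau> c k = xc" "\<tau> d l = xd" using dist by (auto simp: \<tau>_def)
  have "\<tau> q' j' = transport r m (\<tau> r ((m + 1) mod 4))"
    if g: "glue S (r, m) = Some (q', j')" "vx S r (Suc m) = v" for r m q' j'
  proof -
    have m: "((m + 1) mod 4 + 3) mod 4 = m" using glueD(2)[OF g(1)] by presburger
    have "(r, (m + 1) mod 4) \<in> corners_at S v" using glueD(1)[OF g(1)] g(2) by (simp add: in_corners_at)
    then consider "r = q" "(m + 1) mod 4 = i" | "r = b" "(m + 1) mod 4 = j"
      | "r = c" "(m + 1) mod 4 = k" | "r = d" "(m + 1) mod 4 = l" unfolding all by auto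
    then show ?thesis
    proof cases
      case 1 then show ?thesis using m g(1) cyc(1) \<tau> xb_def by auto
    next
      case 2 then show ?thesis using m g(1) cyc(2) \<tau> xc_def by auto
    next
      case 3 then show ?thesis using m g(1) cyc(3) \<tau> xd_def by auto
    next
      case 4 then show ?thesis using m g(1) cyc(4) \<tau> xa by auto
    qed
  qed
  then show ?thesis using \<tau>(1) unfolding flat_around_def by blast
qed

lemma chart_vertex:
  assumes "v \<in> vertices S"
  shows "chart {b \<in> pc S. \<exists>i. (fst b, i) \<in> corners_at S v \<and> snd b \<in> quarter i}" (is "chart ?W")
  unfolding chart_def
proof (intro conjI ballI allI)
  obtain q i where qi: "(q, i) \<in> corners_at S v"
    using assms unfolding vertices_alt in_corners_at[of _ _ v] by auto
  from flat_around_exists[OF qi, of undefined] obtain \<tau> where "flat_around v \<tau>" by blast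
  from flat_vertex[OF this refl] obtain g where "flat ?W g" by blast
  then show "saturated_open S ?W" by (rule flat_saturated)
  fix b x assume "b \<in> ?W"
  then obtain i where i: "(fst b, i) \<in> corners_at S v" "snd b \<in> unit_square \<inter> quarter i" by auto
  from flat_around_exists[OF i(1), of x] obtain \<tau> where \<tau>: "flat_around v \<tau>" "\<tau> (fst b) i = x" by blast
  from flat_vertex[OF \<tau>(1) refl] obtain g where g: "flat ?W g"
    "\<forall>q i p. (q, i) \<in> corners_at S v \<longrightarrow> p \<in> quarter i \<longrightarrow> g (q, p) = \<tau> q i"
    by blast
  have "g b = x" using g(2)[rule_format, of "fst b" i "snd b"] i \<tau>(2) by simp
  with g(1) show "\<exists>g. flat ?W g \<and> g b = x" by blast
qed

lemma chart_exists:
  assumes "a \<in> pc S"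
  shows "\<exists>W. chart W \<and> a \<in> W"
proof -
  obtain q p where a: "a = (q, p)" "q \<in> squares S" "p \<in> unit_square" using assms by (cases a) auto
  define W where "W i = {b \<in> pc S. fst b = q \<and> snd b \<in> off_other_sides i \<or>
      (\<exists>j. glue S (q, i) = Some (fst b, j) \<and> snd b \<in> off_other_sides j)}" for i
  have W: "chart (W i)" if "i < 4" for i using chart_side[OF a(2) that refl] by (simp add: W_def)
  show ?thesis
    using a(3)
  proof (cases rule: unit_square_boundary_cases)
    case interior
    then have "a \<in> W 0" using a interior_off_other_sides by (simp add: W_def)
    then show ?thesis using W[of 0] by auto
  next
    case (side i t)
    then have "a \<in> W i" using a side_point_off_other_sides[of i i t] by (simp add: W_def)
    then show ?thesis using W[OF side(1)] by blast
  next
    case (corner i)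
    then have "(q, i) \<in> corners_at S (vx S q i)" using a by (simp add: in_corners_at)
    then have "a \<in> {b \<in> pc S. \<exists>j. (fst b, j) \<in> corners_at S (vx S q i) \<and> snd b \<in> quarter j}"
      using a corner corner_in_quarter by auto
    then show ?thesis using chart_vertex[OF vx_in_vertices[OF a(2), of i]] by blast
  qed
qed

end

context local_system
begin

section \<open>Lifting paths and homotopies\<close>

text \<open>A lift of a map \<open>\<phi>\<close> into the surface: \<open>\<Lambda> z\<close> is a function on the representatives of the point
  \<open>\<phi> z\<close>, and near each parameter these functions are restrictions of one flat function.\<close>

definition flat_lift :: "'z::metric_space set \<Rightarrow> ('z \<Rightarrow> 'a point set) \<Rightarrow>
    ('z \<Rightarrow> 'a point \<Rightarrow> 'g) \<Rightarrow> bool" where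
  "flat_lift R \<phi> \<Lambda> \<longleftrightarrow> (\<forall>z\<in>R. \<exists>W g. flat W g \<and> \<phi> z \<subseteq> W \<and>
     (\<exists>d>0. \<forall>z'\<in>R. dist z' z < d \<longrightarrow> \<phi> z' \<subseteq> W \<and> (\<forall>b\<in>\<phi> z'. \<Lambda> z' b = g b)))"

lemma flat_lift_compose:
  assumes "flat_lift R \<phi> \<Lambda>" "continuous_on R' f" "f ` R' \<subseteq> R"
  shows "flat_lift R' (\<lambda>z. \<phi> (f z)) (\<lambda>z. \<Lambda> (f z))"
  unfolding flat_lift_def
proof
  fix z assume z: "z \<in> R'"
  then have "f z \<in> R" using assms(3) by blast
  then obtain W g d where *: "flat W g" "\<phi> (f z) \<subseteq> W" "d > 0"
    "\<And>z'. z' \<in> R \<Longrightarrow> dist z' (f z) < d \<Longrightarrow> \<phi> z' \<subseteq> W \<and> (\<forall>b\<in>\<phi> z'. \<Lambda> z' b = g b)"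
    using assms(1) unfolding flat_lift_def by meson
  obtain e where e: "e > 0" "\<And>z'. z' \<in> R' \<Longrightarrow> dist z' z < e \<Longrightarrow> dist (f z') (f z) < d"
    using assms(2) z *(3) unfolding continuous_on_iff by meson
  have "\<phi> (f z') \<subseteq> W \<and> (\<forall>b\<in>\<phi> (f z'). \<Lambda> (f z') b = g b)" if "z' \<in> R'" "dist z' z < e" for z'
    using *(4)[of "f z'"] e(2)[OF that] assms(3) that(1) by blast
  then show "\<exists>W g. flat W g \<and> \<phi> (f z) \<subseteq> W \<and> (\<exists>d>0. \<forall>z'\<in>R'. dist z' z < d \<longrightarrow>
      \<phi> (f z') \<subseteq> W \<and> (\<forall>b\<in>\<phi> (f z'). \<Lambda> (f z') b = g b))"
    using *(1,2) e(1) by meson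
qed

lemma flat_lift_subset: "flat_lift R \<phi> \<Lambda> \<Longrightarrow> R' \<subseteq> R \<Longrightarrow> flat_lift R' \<phi> \<Lambda>"
  using flat_lift_compose[of R \<phi> \<Lambda> R' "\<lambda>z. z"] by (simp add: continuous_on_id)

lemma flat_lift_cong:
  assumes "flat_lift R \<phi> \<Lambda>" "\<And>z. z \<in> R \<Longrightarrow> \<phi>' z = \<phi> z" "\<And>z. z \<in> R \<Longrightarrow> \<Lambda>' z = \<Lambda> z"
  shows "flat_lift R \<phi>' \<Lambda>'"
  using assms(1) unfolding flat_lift_def
  by (simp add: assms(2,3) cong: conj_cong)

lemma class_subset_saturated:
  assumes "saturated_open S W" "x \<in> topspace (surface S)" "b \<in> x" "b \<in> W"
  shows "x \<subseteq> W"
proof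
  fix c assume "c \<in> x"
  then have "(b, c) \<in> (paste S)\<^sup>*"
    using in_topspace_surface[OF assms(2)] assms(3) proj_eq_iff by metis
  then show "c \<in> W" using saturated_open_rtrancl[OF assms(1)] assms(4) by simp
qed

lemma class_nonempty: "x \<in> topspace (surface S) \<Longrightarrow> \<exists>b. b \<in> x"
  unfolding topspace_surface using proj_self by blast

lemma continuous_into_saturated:
  assumes "continuous_map (top_of_set R) (surface S) \<phi>" "saturated_open S W" "z \<in> R" "\<phi> z \<subseteq> W"
  shows "\<exists>d>0. \<forall>z'\<in>R. dist z' z < d \<longrightarrow> \<phi> z' \<subseteq> W"
proof -
  have top: "\<phi> z' \<in> topspace (surface S)" if "z' \<in> R" for z'
    using assms(1) that by (auto simp: continuous_map_def)
  have o: "openin (top_of_set R) {z' \<in> R. \<phi> z' \<in> proj S ` W}"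
    using openin_continuous_map_preimage[OF assms(1) openin_surface_image[OF assms(2)]] by simp
  have sub: "\<phi> z' \<subseteq> W" if z': "z' \<in> R" "\<phi> z' \<in> proj S ` W" for z'
  proof -
    obtain b where b: "b \<in> W" "\<phi> z' = proj S b" using z'(2) by blast
    have "b \<in> \<phi> z'" using b(2) proj_self by simp
    then show ?thesis using class_subset_saturated[OF assms(2) top[OF z'(1)] _ b(1)] by simp
  qed
  obtain b where "b \<in> \<phi> z" using class_nonempty[OF top[OF assms(3)]] ..
  then have "\<phi> z \<in> proj S ` W" using in_topspace_surface[OF top[OF assms(3)]] assms(4) by blast
  then have "z \<in> {z' \<in> R. \<phi> z' \<in> proj S ` W}" using assms(3) by simp
  with o obtain d where "d > 0" "ball z d \<inter> R \<subseteq> {z' \<in> R. \<phi> z' \<in> proj S ` W}"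
    unfolding openin_contains_ball by meson
  have "\<phi> z' \<subseteq> W" if "z' \<in> R" "dist z' z < d" for z'
  proof -
    have "z' \<in> ball z d \<inter> R" using that by (simp add: dist_commute)
    with \<open>ball z d \<inter> R \<subseteq> _\<close> have "\<phi> z' \<in> proj S ` W" by blast
    then show ?thesis by (rule sub[OF that(1)])
  qed
  with \<open>d > 0\<close> show ?thesis by blast
qed

lemma flat_lift_locally_equal:
  assumes "continuous_map (top_of_set R) (surface S) \<phi>" "flat_lift R \<phi> \<Lambda>1" "flat_lift R \<phi> \<Lambda>2"
    and "z \<in> R" "a \<in> \<phi> z"
  shows "\<exists>d>0. \<forall>z'\<in>R. dist z' z < d \<longrightarrow> (\<forall>b\<in>\<phi> z'. (\<Lambda>1 z' b = \<Lambda>2 z' b) = (\<Lambda>1 z a = \<Lambda>2 z a))"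
proof -
  have top: "\<phi> z \<in> topspace (surface S)" using assms(1,4) by (auto simp: continuous_map_def)
  obtain W1 g1 d1 where 1: "flat W1 g1" "\<phi> z \<subseteq> W1" "d1 > 0"
    "\<And>z'. z' \<in> R \<Longrightarrow> dist z' z < d1 \<Longrightarrow> \<phi> z' \<subseteq> W1 \<and> (\<forall>b\<in>\<phi> z'. \<Lambda>1 z' b = g1 b)"
    using assms(2,4) unfolding flat_lift_def by meson
  obtain W2 g2 d2 where 2: "flat W2 g2" "\<phi> z \<subseteq> W2" "d2 > 0"
    "\<And>z'. z' \<in> R \<Longrightarrow> dist z' z < d2 \<Longrightarrow> \<phi> z' \<subseteq> W2 \<and> (\<forall>b\<in>\<phi> z'. \<Lambda>2 z' b = g2 b)"
    using assms(3,4) unfolding flat_lift_def by meson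
  have a: "\<Lambda>1 z a = g1 a" "\<Lambda>2 z a = g2 a" using 1 2 assms(4,5) by auto
  define E where "E = {b \<in> W1 \<inter> W2. (g1 b = g2 b) = (g1 a = g2 a)}"
  have E: "saturated_open S E"
    using saturated_agree[OF 1(1) 2(1)] by (cases "g1 a = g2 a") (simp_all add: E_def)
  have "a \<in> E" using 1(2) 2(2) assms(5) by (auto simp: E_def)
  from continuous_into_saturated[OF assms(1) E assms(4) class_subset_saturated[OF E top assms(5) this]]
  obtain d where d: "d > 0" "\<And>z'. z' \<in> R \<Longrightarrow> dist z' z < d \<Longrightarrow> \<phi> z' \<subseteq> E" by meson
  have "(\<Lambda>1 z' b = \<Lambda>2 z' b) = (\<Lambda>1 z a = \<Lambda>2 z a)"
    if "z' \<in> R" "dist z' z < min d (min d1 d2)" "b \<in> \<phi> z'" for z' b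
  proof -
    have "b \<in> E" "\<Lambda>1 z' b = g1 b" "\<Lambda>2 z' b = g2 b" using that d(2) 1(4) 2(4) by auto
    then show ?thesis using a by (simp add: E_def)
  qed
  then show ?thesis using d(1) 1(3) 2(3) by (intro exI[of _ "min d (min d1 d2)"]) auto
qed

lemma flat_lift_unique:
  assumes "continuous_map (top_of_set R) (surface S) \<phi>" "flat_lift R \<phi> \<Lambda>1" "flat_lift R \<phi> \<Lambda>2"
    and "topological_space_class.connected R" "z \<in> R" "a \<in> \<phi> z" "\<Lambda>1 z a = \<Lambda>2 z a" "z' \<in> R" "b \<in> \<phi> z'"
  shows "\<Lambda>1 z' b = \<Lambda>2 z' b"
proof -
  have top: "\<phi> z \<in> topspace (surface S)" if "z \<in> R" for z
    using assms(1) that by (auto simp: continuous_map_def)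
  define eq where "eq z \<longleftrightarrow> (\<forall>b\<in>\<phi> z. \<Lambda>1 z b = \<Lambda>2 z b)" for z
  have one: "eq z \<longleftrightarrow> \<Lambda>1 z b = \<Lambda>2 z b" if "z \<in> R" "b \<in> \<phi> z" for z b
    using flat_lift_locally_equal[OF assms(1-3) that] that unfolding eq_def by auto
  have "eq constant_on R"
  proof (rule locally_constant_imp_constant[OF assms(4)])
    fix z assume z: "z \<in> R"
    obtain a where a: "a \<in> \<phi> z" using class_nonempty[OF top[OF z]] ..
    from flat_lift_locally_equal[OF assms(1-3) z a] obtain d where
      d: "d > 0" "\<And>z' b. z' \<in> R \<Longrightarrow> dist z' z < d \<Longrightarrow> b \<in> \<phi> z' \<Longrightarrow> (\<Lambda>1 z' b = \<Lambda>2 z' b) = (\<Lambda>1 z a = \<Lambda>2 z a)"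
      by meson
    have "eq z' = eq z" if z': "z' \<in> R \<inter> ball z d" for z'
    proof -
      have "z' \<in> R" "dist z' z < d" using z' by (simp_all add: dist_commute)
      obtain b where b: "b \<in> \<phi> z'" using class_nonempty[OF top[OF \<open>z' \<in> R\<close>]] ..
      show ?thesis
        using d(2)[OF \<open>z' \<in> R\<close> \<open>dist z' z < d\<close> b] one[OF z a] one[OF \<open>z' \<in> R\<close> b] by simp
    qed
    moreover have "openin (top_of_set R) (R \<inter> ball z d)" by (simp add: openin_open_Int)
    moreover have "z \<in> R \<inter> ball z d" using z d(1) by simp
    ultimately show "\<exists>T. openin (top_of_set R) T \<and> z \<in> T \<and> (\<forall>z'\<in>T. eq z' = eq z)" by meson
  qed
  then have "eq z = eq z'" using assms(5,8) unfolding constant_on_def by metis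
  then show ?thesis using one[OF assms(5,6)] one[OF assms(8,9)] assms(7) by simp
qed

text \<open>Where the two lifts meet, the flat functions that describe them agree near the common value, so one of
  them describes both.\<close>

lemma flat_lift_glue:
  assumes "continuous_map (top_of_set (A \<union> B)) (surface S) \<phi>" "flat_lift A \<phi> \<Lambda>1" "flat_lift B \<phi> \<Lambda>2"
    and "closed A" "closed B" and agree: "\<And>z b. z \<in> A \<Longrightarrow> z \<in> B \<Longrightarrow> b \<in> \<phi> z \<Longrightarrow> \<Lambda>1 z b = \<Lambda>2 z b"
  shows "flat_lift (A \<union> B) \<phi> (\<lambda>z. if z \<in> A then \<Lambda>1 z else \<Lambda>2 z)" (is "flat_lift _ _ ?\<Lambda>")
  unfolding flat_lift_def
proof
  fix z assume z: "z \<in> A \<union> B"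
  have top: "\<phi> z \<in> topspace (surface S)" using assms(1) z by (auto simp: continuous_map_def)
  have away: "\<exists>d>0. \<forall>z'\<in>C. \<not> dist z' z < d" if "closed C" "z \<notin> C" for C :: "'b set"
  proof -
    have "open (- C)" "z \<in> - C" using that by auto
    then obtain d where "d > 0" "ball z d \<subseteq> - C" unfolding open_contains_ball by meson
    then show ?thesis by (auto simp: dist_commute subset_iff)
  qed
  have one: "\<exists>W g. flat W g \<and> \<phi> z \<subseteq> W \<and> (\<exists>d>0. \<forall>z'\<in>A \<union> B. dist z' z < d \<longrightarrow>
      \<phi> z' \<subseteq> W \<and> (\<forall>b\<in>\<phi> z'. ?\<Lambda> z' b = g b))"
    if D: "flat_lift D \<phi> \<Lambda>" "z \<in> D" "closed E" "z \<notin> E" "\<And>z'. z' \<in> A \<union> B \<Longrightarrow> z' \<notin> E \<Longrightarrow> z' \<in> D \<and> ?\<Lambda> z' = \<Lambda> z'" for D E \<Lambda>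
  proof -
    obtain W g d where *: "flat W g" "\<phi> z \<subseteq> W" "d > 0"
      "\<And>z'. z' \<in> D \<Longrightarrow> dist z' z < d \<Longrightarrow> \<phi> z' \<subseteq> W \<and> (\<forall>b\<in>\<phi> z'. \<Lambda> z' b = g b)"
      using D(1,2) unfolding flat_lift_def by meson
    obtain e where e: "e > 0" "\<And>z'. z' \<in> E \<Longrightarrow> \<not> dist z' z < e" using away[OF D(3,4)] by meson
    have "\<phi> z' \<subseteq> W \<and> (\<forall>b\<in>\<phi> z'. ?\<Lambda> z' b = g b)" if z': "z' \<in> A \<union> B" "dist z' z < min d e" for z'
    proof -
      have "z' \<notin> E" using e(2)[of z'] z'(2) by auto
      from D(5)[OF z'(1) this] have "z' \<in> D" "?\<Lambda> z' = \<Lambda> z'" by blast+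
      then show ?thesis using *(4)[of z'] z'(2) by simp
    qed
    then show ?thesis using *(1-3) e(1) by (intro exI[of _ W] exI[of _ g] conjI exI[of _ "min d e"]) auto
  qed
  consider "z \<in> A" "z \<notin> B" | "z \<notin> A" "z \<in> B" | "z \<in> A" "z \<in> B" using z by blast
  then show "\<exists>W g. flat W g \<and> \<phi> z \<subseteq> W \<and> (\<exists>d>0. \<forall>z'\<in>A \<union> B. dist z' z < d \<longrightarrow>
      \<phi> z' \<subseteq> W \<and> (\<forall>b\<in>\<phi> z'. ?\<Lambda> z' b = g b))"
  proof cases
    case 1 then show ?thesis using one[OF assms(2) _ assms(5)] by auto
  next
    case 2 then show ?thesis using one[OF assms(3) _ assms(4)] by auto
  next
    case 3
    obtain W1 g1 d1 where 1: "flat W1 g1" "\<phi> z \<subseteq> W1" "d1 > 0"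
      "\<And>z'. z' \<in> A \<Longrightarrow> dist z' z < d1 \<Longrightarrow> \<phi> z' \<subseteq> W1 \<and> (\<forall>b\<in>\<phi> z'. \<Lambda>1 z' b = g1 b)"
      using assms(2) 3 unfolding flat_lift_def by meson
    obtain W2 g2 d2 where 2: "flat W2 g2" "\<phi> z \<subseteq> W2" "d2 > 0"
      "\<And>z'. z' \<in> B \<Longrightarrow> dist z' z < d2 \<Longrightarrow> \<phi> z' \<subseteq> W2 \<and> (\<forall>b\<in>\<phi> z'. \<Lambda>2 z' b = g2 b)"
      using assms(3) 3 unfolding flat_lift_def by meson
    define E where "E = {b \<in> W1 \<inter> W2. g1 b = g2 b}"
    have E: "saturated_open S E" using saturated_agree(1)[OF 1(1) 2(1)] by (simp add: E_def)
    have fE: "flat E g1" by (rule flat_restrict[OF 1(1) E]) (auto simp: E_def)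
    have zE: "\<phi> z \<subseteq> E"
    proof
      fix b assume b: "b \<in> \<phi> z"
      have "\<Lambda>1 z b = g1 b" "\<Lambda>2 z b = g2 b" using 1(3) 1(4)[of z] 2(3) 2(4)[of z] 3 b by auto
      then show "b \<in> E" using agree[OF 3 b] b 1(2) 2(2) by (auto simp: E_def)
    qed
    obtain d where d: "d > 0" "\<And>z'. z' \<in> A \<union> B \<Longrightarrow> dist z' z < d \<Longrightarrow> \<phi> z' \<subseteq> E"
      using continuous_into_saturated[OF assms(1) E z zE] by meson
    have "\<phi> z' \<subseteq> E \<and> (\<forall>b\<in>\<phi> z'. ?\<Lambda> z' b = g1 b)" if z': "z' \<in> A \<union> B" "dist z' z < min d (min d1 d2)" for z'
    proof (intro conjI ballI)
      show sub: "\<phi> z' \<subseteq> E" using d(2) z' by simp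
      fix b assume b: "b \<in> \<phi> z'"
      then have "g1 b = g2 b" using sub by (auto simp: E_def)
      then show "?\<Lambda> z' b = g1 b" using 1(4)[of z'] 2(4)[of z'] z' b by auto
    qed
    then show ?thesis using fE zE d(1) 1(3) 2(3)
      by (intro exI[of _ E] exI[of _ g1] conjI exI[of _ "min d (min d1 d2)"]) auto
  qed
qed

text \<open>Lifts with an arbitrary value at an arbitrary parameter are required, because gluing two of them needs a
  second lift that starts where the first one arrives.\<close>

definition liftable :: "('z::metric_space \<Rightarrow> 'a point set) \<Rightarrow> 'z set \<Rightarrow> bool" where
  "liftable \<phi> A \<longleftrightarrow> (\<forall>z\<in>A. \<forall>a\<in>\<phi> z. \<forall>x. \<exists>\<Lambda>. flat_lift A \<phi> \<Lambda> \<and> \<Lambda> z a = x)"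

lemma liftable_subset: "liftable \<phi> A \<Longrightarrow> A' \<subseteq> A \<Longrightarrow> liftable \<phi> A'"
  unfolding liftable_def by (meson flat_lift_subset subsetD)

lemma liftable_chart:
  assumes "chart W" "\<And>z. z \<in> A \<Longrightarrow> \<phi> z \<subseteq> W"
  shows "liftable \<phi> A"
  unfolding liftable_def
proof (intro ballI allI)
  fix z a x assume "z \<in> A" "a \<in> \<phi> z"
  then obtain g where g: "flat W g" "g a = x"
    using assms unfolding chart_def by blast
  have "flat_lift A \<phi> (\<lambda>_. g)"
    unfolding flat_lift_def using g(1) assms(2) zero_less_one by blast
  then show "\<exists>\<Lambda>. flat_lift A \<phi> \<Lambda> \<and> \<Lambda> z a = x" using g(2) by blast
qed

lemma liftable_Un_aux:
  assumes "continuous_map (top_of_set (A \<union> B)) (surface S) \<phi>" "liftable \<phi> A" "liftable \<phi> B"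
    and "closed A" "closed B" "topological_space_class.connected (A \<inter> B)" "A \<inter> B \<noteq> {}" "z \<in> A" "a \<in> \<phi> z"
  shows "\<exists>\<Lambda>. flat_lift (A \<union> B) \<phi> \<Lambda> \<and> \<Lambda> z a = x"
proof -
  have top: "\<phi> z \<in> topspace (surface S)" if "z \<in> A \<union> B" for z
    using assms(1) that by (auto simp: continuous_map_def)
  obtain \<Lambda>1 where 1: "flat_lift A \<phi> \<Lambda>1" "\<Lambda>1 z a = x"
    using assms(2,8,9) unfolding liftable_def by blast
  obtain w where w: "w \<in> A" "w \<in> B" using assms(7) by blast
  obtain b where b: "b \<in> \<phi> w" using class_nonempty[OF top] w by blast
  obtain \<Lambda>2 where 2: "flat_lift B \<phi> \<Lambda>2" "\<Lambda>2 w b = \<Lambda>1 w b"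
    using assms(3) w(2) b unfolding liftable_def by meson
  have c: "continuous_map (top_of_set (A \<inter> B)) (surface S) \<phi>"
    using continuous_map_from_subtopology_mono[OF assms(1), of "A \<inter> B"] by blast
  have "\<Lambda>1 z' c = \<Lambda>2 z' c" if "z' \<in> A" "z' \<in> B" "c \<in> \<phi> z'" for z' c
    by (rule flat_lift_unique[OF c flat_lift_subset[OF 1(1)] flat_lift_subset[OF 2(1)] assms(6), of w b])
      (use w b 2(2) that in auto)
  from flat_lift_glue[OF assms(1) 1(1) 2(1) assms(4,5) this] show ?thesis
    using 1(2) assms(8) by (intro exI[of _ "\<lambda>z. if z \<in> A then \<Lambda>1 z else \<Lambda>2 z"]) simp
qed

lemma liftable_Un:
  assumes "continuous_map (top_of_set (A \<union> B)) (surface S) \<phi>" "liftable \<phi> A" "liftable \<phi> B"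
    and "closed A" "closed B" "topological_space_class.connected (A \<inter> B)" "A \<inter> B \<noteq> {}"
  shows "liftable \<phi> (A \<union> B)"
  unfolding liftable_def
proof (intro ballI allI)
  fix z a x assume z: "z \<in> A \<union> B" "a \<in> \<phi> z"
  have "continuous_map (top_of_set (B \<union> A)) (surface S) \<phi>" "topological_space_class.connected (B \<inter> A)" "B \<inter> A \<noteq> {}"
    using assms by (simp_all add: Un_commute Int_commute)
  from liftable_Un_aux[OF this(1) assms(3,2,5,4) this(2,3), of z a x] liftable_Un_aux[OF assms, of z a x] z
  show "\<exists>\<Lambda>. flat_lift (A \<union> B) \<phi> \<Lambda> \<and> \<Lambda> z a = x" by (auto simp: Un_commute)
qed

lemma liftable_nearby:
  assumes "continuous_map (top_of_set R) (surface S) \<phi>" "z \<in> R"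
  shows "\<exists>d>0. liftable \<phi> (R \<inter> ball z d)"
proof -
  have top: "\<phi> z \<in> topspace (surface S)" using assms by (auto simp: continuous_map_def)
  obtain b where b: "b \<in> \<phi> z" using class_nonempty[OF top] ..
  then have "b \<in> pc S" using in_topspace_surface[OF top] by blast
  then obtain W where W: "chart W" "b \<in> W" using chart_exists by blast
  have sat: "saturated_open S W" using W(1) by (simp add: chart_def)
  from continuous_into_saturated[OF assms(1) sat assms(2) class_subset_saturated[OF sat top b W(2)]]
  obtain d where "d > 0" "\<And>z'. z' \<in> R \<Longrightarrow> dist z' z < d \<Longrightarrow> \<phi> z' \<subseteq> W" by meson
  then show ?thesis using liftable_chart[OF W(1), of "R \<inter> ball z d" \<phi>] by (auto simp: dist_commute)
qed

lemma liftable_small: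
  assumes "continuous_map (top_of_set R) (surface S) \<phi>" "compact R" "R \<noteq> {}"
  shows "\<exists>d>0. \<forall>A\<subseteq>R. diameter A < d \<longrightarrow> liftable \<phi> A"
proof -
  define \<C> where "\<C> = {ball z e | z e. liftable \<phi> (R \<inter> ball z e)}"
  have "\<exists>B\<in>\<C>. z \<in> B" if "z \<in> R" for z
    using liftable_nearby[OF assms(1) that] centre_in_ball unfolding \<C>_def by blast
  then have "R \<subseteq> \<Union>\<C>" "\<C> \<noteq> {}" using assms(3) by blast+
  moreover have "open B" if "B \<in> \<C>" for B using that unfolding \<C>_def by auto
  ultimately obtain d where "0 < d" "\<And>A. A \<subseteq> R \<Longrightarrow> diameter A < d \<Longrightarrow> \<exists>B\<in>\<C>. A \<subseteq> B"
    using Lebesgue_number_lemma[OF assms(2)] by metis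
  moreover have "liftable \<phi> A" if "A \<subseteq> R" "A \<subseteq> B" "B \<in> \<C>" for A B
    using that liftable_subset unfolding \<C>_def by blast
  ultimately show ?thesis by meson
qed

text \<open>Bisection in the direction of the coordinate \<open>c\<close>: two layers that meet in a connected slice can be glued.\<close>

lemma liftable_slices:
  fixes c :: "'z::metric_space \<Rightarrow> real"
  assumes \<phi>: "continuous_map (top_of_set R) (surface S) \<phi>" and R: "closed R" "continuous_on R c" "c ` R \<subseteq> {0..1}"
    and slices: "\<And>t. 0 \<le> t \<Longrightarrow> t \<le> 1 \<Longrightarrow> topological_space_class.connected {z \<in> R. c z = t} \<and> {z \<in> R. c z = t} \<noteq> {}"
    and thin: "d > 0" "\<And>s t. 0 \<le> s \<Longrightarrow> s \<le> t \<Longrightarrow> t \<le> 1 \<Longrightarrow> t - s < d \<Longrightarrow> liftable \<phi> {z \<in> R. s \<le> c z \<and> c z \<le> t}"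
  shows "liftable \<phi> R"
proof -
  let ?A = "\<lambda>s t. {z \<in> R. s \<le> c z \<and> c z \<le> t}"
  have "0 \<le> (0::real) \<longrightarrow> 1 \<le> (1::real) \<longrightarrow> liftable \<phi> (?A 0 1)"
  proof (rule Bolzano[where P = "\<lambda>s t. 0 \<le> s \<longrightarrow> t \<le> 1 \<longrightarrow> liftable \<phi> (?A s t)"])
    fix r s t :: real
    assume *: "0 \<le> r \<longrightarrow> s \<le> 1 \<longrightarrow> liftable \<phi> (?A r s)" "0 \<le> s \<longrightarrow> t \<le> 1 \<longrightarrow> liftable \<phi> (?A s t)" "r \<le> s" "s \<le> t"
    show "0 \<le> r \<longrightarrow> t \<le> 1 \<longrightarrow> liftable \<phi> (?A r t)"
    proof (intro impI)
      assume rt: "0 \<le> r" "t \<le> 1"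
      have closed: "closed (?A r s)" for r s
      proof -
        have "?A r s = R \<inter> c -` {r..s}" by auto
        then show ?thesis using continuous_closed_preimage[OF R(2,1) closed_atLeastAtMost] by simp
      qed
      have un: "?A r s \<union> ?A s t = ?A r t" "?A r s \<inter> ?A s t = {z \<in> R. c z = s}" using *(3,4) by auto
      have "continuous_map (top_of_set (?A r t)) (surface S) \<phi>"
        by (rule continuous_map_from_subtopology_mono[OF \<phi>]) auto
      then show "liftable \<phi> (?A r t)"
        using liftable_Un[of "?A r s" "?A s t" \<phi>] closed slices[of s] * rt unfolding un by simp
    qed
  next
    fix x :: real
    show "\<exists>d>0. \<forall>s t. s \<le> x \<and> x \<le> t \<and> t - s < d \<longrightarrow> 0 \<le> s \<longrightarrow> t \<le> 1 \<longrightarrow> liftable \<phi> (?A s t)"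
      using thin by (intro exI[of _ d]) auto
  qed simp
  moreover have "?A 0 1 = R" using R(3) by auto
  ultimately show ?thesis by simp
qed

lemma liftable_interval:
  assumes "continuous_map (top_of_set {0..1::real}) (surface S) \<phi>"
  shows "liftable \<phi> {0..1}"
proof -
  obtain d where d: "d > 0" "\<And>A. A \<subseteq> {0..1} \<Longrightarrow> diameter A < d \<Longrightarrow> liftable \<phi> A"
    using liftable_small[OF assms] by auto
  show ?thesis
  proof (rule liftable_slices[OF assms, of "\<lambda>z. z" d])
    fix s t :: real assume st: "0 \<le> s" "s \<le> t" "t \<le> 1" "t - s < d"
    have "diameter {z \<in> {0..1}. s \<le> z \<and> z \<le> t} \<le> t - s" by (rule diameter_le) (use st in auto)
    then have "diameter {z \<in> {0..1}. s \<le> z \<and> z \<le> t} < d" using st(4) by linarith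
    then show "liftable \<phi> {z \<in> {0..1}. s \<le> z \<and> z \<le> t}" by (intro d(2)) auto
  next
    fix t :: real assume "0 \<le> t" "t \<le> 1"
    then have "{z \<in> {0..1}. z = t} = {t}" by auto
    then show "topological_space_class.connected {z \<in> {0..1}. z = t} \<and> {z \<in> {0..1}. z = t} \<noteq> {}" by simp
  qed (use d(1) in \<open>auto intro: continuous_on_id\<close>)
qed

lemma liftable_square:
  assumes "continuous_map (top_of_set ({0..1} \<times> {0..1::real})) (surface S) \<phi>"
  shows "liftable \<phi> ({0..1::real} \<times> {0..1})"
proof -
  let ?I = "{0..1::real}"
  have "compact (?I \<times> ?I)" by (intro compact_Times) simp_all
  then obtain d where d: "d > 0" "\<And>A. A \<subseteq> ?I \<times> ?I \<Longrightarrow> diameter A < d \<Longrightarrow> liftable \<phi> A"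
    using liftable_small[OF assms] by auto
  have strip: "liftable \<phi> (?I \<times> {u..v})" if uv: "0 \<le> u" "u \<le> v" "v \<le> 1" "v - u < d/2" for u v
  proof (rule liftable_slices[of _ _ fst "d/2"])
    show "continuous_map (top_of_set (?I \<times> {u..v})) (surface S) \<phi>"
      by (rule continuous_map_from_subtopology_mono[OF assms]) (use uv in auto)
    fix s t :: real assume st: "0 \<le> s" "s \<le> t" "t \<le> 1" "t - s < d/2"
    have "diameter {z \<in> ?I \<times> {u..v}. s \<le> fst z \<and> fst z \<le> t} \<le> (t - s) + (v - u)"
    proof (rule diameter_le)
      fix z w assume zw: "z \<in> {z \<in> ?I \<times> {u..v}. s \<le> fst z \<and> fst z \<le> t}" "w \<in> {z \<in> ?I \<times> {u..v}. s \<le> fst z \<and> fst z \<le> t}"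
      have "norm (z - w) \<le> norm (fst (z - w)) + norm (snd (z - w))"
        unfolding norm_prod_def by (rule sqrt_sum_squares_le_sum) auto
      then show "norm (z - w) \<le> (t - s) + (v - u)" using zw by auto
    qed (use st uv in auto)
    then show "liftable \<phi> {z \<in> ?I \<times> {u..v}. s \<le> fst z \<and> fst z \<le> t}"
      using st(4) uv by (intro d(2)) auto
  next
    fix t :: real assume "0 \<le> t" "t \<le> 1"
    then have "{z \<in> ?I \<times> {u..v}. fst z = t} = {t} \<times> {u..v}" by auto
    then show "topological_space_class.connected {z \<in> ?I \<times> {u..v}. fst z = t} \<and> {z \<in> ?I \<times> {u..v}. fst z = t} \<noteq> {}"
      using uv by (auto intro: connected_Times)
  qed (use d(1) in \<open>auto intro: continuous_on_fst continuous_on_id closed_Times\<close>)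
  show ?thesis
  proof (rule liftable_slices[OF assms, of snd "d/2"])
    fix s t :: real assume st: "0 \<le> s" "s \<le> t" "t \<le> 1" "t - s < d/2"
    have "{z \<in> ?I \<times> ?I. s \<le> snd z \<and> snd z \<le> t} = ?I \<times> {s..t}" using st by auto
    then show "liftable \<phi> {z \<in> ?I \<times> ?I. s \<le> snd z \<and> snd z \<le> t}" using strip[OF st] by simp
  next
    fix t :: real assume "0 \<le> t" "t \<le> 1"
    then have "{z \<in> ?I \<times> ?I. snd z = t} = ?I \<times> {t}" by auto
    then show "topological_space_class.connected {z \<in> ?I \<times> ?I. snd z = t} \<and> {z \<in> ?I \<times> ?I. snd z = t} \<noteq> {}"
      by (auto intro: connected_Times)
  qed (use d(1) in \<open>auto intro: continuous_on_snd continuous_on_id closed_Times\<close>)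
qed

text \<open>The contraction of the loop is defined on a square, and a lift of it restricts to lifts over the four sides. It
  does not change along the side that is mapped to a single point, and it takes equal values on the two sides
  that follow the end of the loop if it does so at one point of them, because they are mapped to the same path.\<close>

lemma flat_lift_loop:
  assumes p: "pathin (surface S) p" "p 1 = p 0" and \<Lambda>: "flat_lift {0..1} p \<Lambda>" and a: "a \<in> p 0"
  shows "\<Lambda> 1 a = \<Lambda> 0 a"
proof -
  let ?I = "{0..1::real}"
  have "homotopic_with (\<lambda>r. r 1 = r 0) (top_of_set ?I) (surface S) p (\<lambda>_. p 0)"
    using simply_connected p unfolding simply_connected_space_def by blast
  then obtain h where h: "continuous_map (prod_topology (top_of_set ?I) (top_of_set ?I)) (surface S) h"
    "\<And>x. h (0, x) = p x" "\<And>x. h (1, x) = p 0" "\<And>t. t \<in> ?I \<Longrightarrow> h (t, 1) = h (t, 0)"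
    unfolding homotopic_with_def by auto
  have hc: "continuous_map (top_of_set (?I \<times> ?I)) (surface S) h"
    using h(1) by (simp add: prod_topology_subtopology_eu)
  obtain L where L: "flat_lift (?I \<times> ?I) h L" "L (0, 0) a = \<Lambda> 0 a"
    using liftable_square[OF hc, unfolded liftable_def, rule_format, of "(0, 0)" a "\<Lambda> 0 a"] h(2) a by auto
  have comp: "flat_lift ?I (\<lambda>z. h (f z)) (\<lambda>z. L (f z))" "continuous_map (top_of_set ?I) (surface S) (\<lambda>z. h (f z))"
    if "continuous_on ?I f" "f ` ?I \<subseteq> ?I \<times> ?I" for f
  proof -
    show "flat_lift ?I (\<lambda>z. h (f z)) (\<lambda>z. L (f z))" by (rule flat_lift_compose[OF L(1) that])
    have "continuous_map (top_of_set ?I) (top_of_set (?I \<times> ?I)) f" using that by (auto simp: continuous_map_in_subtopology)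
    from continuous_map_compose[OF this hc] show "continuous_map (top_of_set ?I) (surface S) (\<lambda>z. h (f z))"
      by (simp add: o_def)
  qed
  have left: "continuous_on ?I (\<lambda>x::real. (0::real, x))" "(\<lambda>x. (0, x)) ` ?I \<subseteq> ?I \<times> ?I"
    and right: "continuous_on ?I (\<lambda>x::real. (1::real, x))" "(\<lambda>x. (1, x)) ` ?I \<subseteq> ?I \<times> ?I"
    and bottom: "continuous_on ?I (\<lambda>t::real. (t, 0::real))" "(\<lambda>t. (t, 0)) ` ?I \<subseteq> ?I \<times> ?I"
    and top: "continuous_on ?I (\<lambda>t::real. (t, 1::real))" "(\<lambda>t. (t, 1)) ` ?I \<subseteq> ?I \<times> ?I"
    by (auto intro!: continuous_intros)
  have pc': "continuous_map (top_of_set ?I) (surface S) p" using p(1) by (simp add: pathin_def)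
  have conn: "topological_space_class.connected ?I" by simp
  \<comment> \<open>The first coordinate is the time of the contraction, the second one the parameter of the loop.\<close>
  have L01: "L (0, 1) a = \<Lambda> 1 a"
  proof (rule flat_lift_unique[OF pc' _ \<Lambda> conn, of "\<lambda>x. L (0, x)" 0 a])
    show "flat_lift ?I p (\<lambda>x. L (0, x))" using comp(1)[OF left] h(2) by simp
  qed (use L(2) a p(2) in auto)
  have "L (1, 1) a = L (1, 0) a"
  proof (rule flat_lift_unique[OF comp(2)[OF right] comp(1)[OF right] _ conn, of "\<lambda>_. L (1, 0)" 0 a])
    obtain W g d where "flat W g" "h (1, 0) \<subseteq> W" "d > 0"
      "\<And>z'. z' \<in> ?I \<times> ?I \<Longrightarrow> dist z' (1, 0) < d \<Longrightarrow> h z' \<subseteq> W \<and> (\<forall>b\<in>h z'. L z' b = g b)"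
      using L(1)[unfolded flat_lift_def, THEN bspec, of "(1, 0)"] zero_less_one by fastforce
    from this(1,2) this(3) this(4)[of "(1, 0)"]
    have "flat W g" "p 0 \<subseteq> W" "\<forall>b\<in>p 0. L (1, 0) b = g b" unfolding h(3) by simp_all
    then show "flat_lift ?I (\<lambda>x. h (1, x)) (\<lambda>_. L (1, 0))"
      unfolding flat_lift_def h(3) using zero_less_one by blast
  qed (use a h(3) in auto)
  moreover have "L (0, 1) a = L (0, 0) a \<longleftrightarrow> L (1, 1) a = L (1, 0) a"
  proof -
    have top': "flat_lift ?I (\<lambda>t. h (t, 0)) (\<lambda>t. L (t, 1))"
      by (rule flat_lift_cong[OF comp(1)[OF top]]) (use h(4) in auto)
    show ?thesis
      using flat_lift_unique[OF comp(2)[OF bottom] top' comp(1)[OF bottom] conn, of 0 a 1 a]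
        flat_lift_unique[OF comp(2)[OF bottom] top' comp(1)[OF bottom] conn, of 1 a 0 a] a h(2,3) by auto
  qed
  ultimately show ?thesis using L01 L(2) by simp
qed

section \<open>Global sections\<close>

text \<open>Continuation along a path. Since the surface is simply connected, \<open>y\<close> is determined by \<open>a\<close>, \<open>x\<close> and \<open>b\<close>
  and does not depend on the path (\<open>linked_unique\<close>).\<close>

definition linked where
  "linked a x b y \<longleftrightarrow> (\<exists>p \<Lambda>. pathin (surface S) p \<and> p 0 = proj S a \<and> p 1 = proj S b \<and>
     flat_lift {0..1} p \<Lambda> \<and> \<Lambda> 0 a = x \<and> \<Lambda> 1 b = y)"

lemma linked_sym: "linked a x b y \<Longrightarrow> linked b y a x"
proof -
  assume "linked a x b y"
  then obtain p \<Lambda> where *: "pathin (surface S) p" "p 0 = proj S a" "p 1 = proj S b"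
     "flat_lift {0..1} p \<Lambda>" "\<Lambda> 0 a = x" "\<Lambda> 1 b = y" unfolding linked_def by blast
  have c: "continuous_on {0..1} (\<lambda>t::real. 1 - t)" "(\<lambda>t::real. 1 - t) ` {0..1} \<subseteq> {0..1}"
    by (auto intro!: continuous_intros)
  have "continuous_map (top_of_set {0..1}) (top_of_set {0..1}) (\<lambda>t::real. 1 - t)"
    using c by (auto simp: continuous_map_in_subtopology)
  from continuous_map_compose[OF this *(1)[unfolded pathin_def]]
  have "pathin (surface S) (\<lambda>t. p (1 - t))" by (simp add: pathin_def o_def)
  moreover have "flat_lift {0..1} (\<lambda>t. p (1 - t)) (\<lambda>t. \<Lambda> (1 - t))" by (rule flat_lift_compose[OF *(4) c])
  ultimately show ?thesis unfolding linked_def using *(2,3,5,6)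
    by (intro exI[of _ "\<lambda>t. p (1 - t)"] exI[of _ "\<lambda>t. \<Lambda> (1 - t)"]) simp
qed

lemma linked_trans: "linked a x b y \<Longrightarrow> linked b y c z \<Longrightarrow> linked a x c z"
proof -
  assume "linked a x b y" "linked b y c z"
  then obtain p1 \<Lambda>1 p2 \<Lambda>2 where
    1: "pathin (surface S) p1" "p1 0 = proj S a" "p1 1 = proj S b"
     "flat_lift {0..1} p1 \<Lambda>1" "\<Lambda>1 0 a = x" "\<Lambda>1 1 b = y" and
    2: "pathin (surface S) p2" "p2 0 = proj S b" "p2 1 = proj S c"
     "flat_lift {0..1} p2 \<Lambda>2" "\<Lambda>2 0 b = y" "\<Lambda>2 1 c = z" unfolding linked_def by blast
  define p where "p t = (if t \<le> 1/2 then p1 (2 * t) else p2 (2 * t - 1))" for t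
  have c1: "continuous_on {0..1/2} (\<lambda>t::real. 2 * t)" "(\<lambda>t::real. 2 * t) ` {0..1/2} \<subseteq> {0..1}"
    and c2: "continuous_on {1/2..1} (\<lambda>t::real. 2 * t - 1)" "(\<lambda>t::real. 2 * t - 1) ` {1/2..1} \<subseteq> {0..1}"
    by (auto intro!: continuous_intros)
  have m1: "continuous_map (top_of_set {0..1/2}) (surface S) (\<lambda>t. p1 (2 * t))"
  proof -
    have "continuous_map (top_of_set {0..1/2}) (top_of_set {0..1}) (\<lambda>t::real. 2 * t)"
      using c1 by (auto simp: continuous_map_in_subtopology)
    from continuous_map_compose[OF this 1(1)[unfolded pathin_def]] show ?thesis by (simp add: o_def)
  qed
  have m2: "continuous_map (top_of_set {1/2..1}) (surface S) (\<lambda>t. p2 (2 * t - 1))"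
  proof -
    have "continuous_map (top_of_set {1/2..1}) (top_of_set {0..1}) (\<lambda>t::real. 2 * t - 1)"
      using c2 by (auto simp: continuous_map_in_subtopology)
    from continuous_map_compose[OF this 2(1)[unfolded pathin_def]] show ?thesis by (simp add: o_def)
  qed
  have p: "pathin (surface S) p"
    unfolding pathin_def p_def
  proof (rule continuous_map_cases_le)
    have s: "{t \<in> topspace (top_of_set {0..1::real}). t \<le> 1/2} = {0..1/2}"
      "{t \<in> topspace (top_of_set {0..1::real}). 1/2 \<le> t} = {1/2..1}"
      "{0..1} \<inter> {0..1/2::real} = {0..1/2}" "{0..1} \<inter> {1/2..1::real} = {1/2..1}" by auto
    show "continuous_map (subtopology (top_of_set {0..1}) {t \<in> topspace (top_of_set {0..1}). t \<le> 1/2}) (surface S) (\<lambda>t. p1 (2 * t))"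
      unfolding s subtopology_subtopology by (rule m1)
    show "continuous_map (subtopology (top_of_set {0..1}) {t \<in> topspace (top_of_set {0..1}). 1/2 \<le> t}) (surface S) (\<lambda>t. p2 (2 * t - 1))"
      unfolding s subtopology_subtopology by (rule m2)
    fix t :: real assume "t \<in> topspace (top_of_set {0..1})" "t = 1/2"
    then have "2 * t = 1" "2 * t - 1 = 0" by simp_all
    then show "p1 (2 * t) = p2 (2 * t - 1)" using 1(3) 2(2) by (simp only:)
  qed simp_all
  have un: "{0..1/2} \<union> {1/2..1} = {0..1::real}" by auto
  have l1: "flat_lift {0..1/2} p (\<lambda>t. \<Lambda>1 (2 * t))"
    by (rule flat_lift_cong[OF flat_lift_compose[OF 1(4) c1]]) (auto simp: p_def)
  have half: "p1 (2 * t) = p2 (2 * t - 1)" if "t = 1/2" for t :: real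
  proof -
    have "2 * t = 1" "2 * t - 1 = 0" using that by simp_all
    then show ?thesis using 1(3) 2(2) by (simp only:)
  qed
  have l2: "flat_lift {1/2..1} p (\<lambda>t. \<Lambda>2 (2 * t - 1))"
    by (rule flat_lift_cong[OF flat_lift_compose[OF 2(4) c2]]) (use half in \<open>auto simp: p_def\<close>)
  have pc': "continuous_map (top_of_set ({0..1/2} \<union> {1/2..1})) (surface S) p"
    using p by (simp add: un pathin_def)
  have ph: "continuous_map (top_of_set {1/2}) (surface S) p"
    by (rule continuous_map_from_subtopology_mono[OF p[unfolded pathin_def]]) auto
  have "\<Lambda>1 (2 * t) e = \<Lambda>2 (2 * t - 1) e" if t: "t \<in> {0..1/2}" "t \<in> {1/2..1}" and e: "e \<in> p t" for t e
  proof -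
    have t: "t = 1/2" using t by auto
    have "(\<lambda>t. \<Lambda>1 (2 * t)) (1/2) e = (\<lambda>t. \<Lambda>2 (2 * t - 1)) (1/2) e"
    proof (rule flat_lift_unique[OF ph flat_lift_subset[OF l1] flat_lift_subset[OF l2], of "1/2" b])
      show "b \<in> p (1/2)" using 1(3) by (simp add: p_def proj_self)
    qed (use 1(6) 2(5) e t in auto)
    then show ?thesis unfolding t .
  qed
  from flat_lift_glue[OF pc' l1 l2 _ _ this] have
    L: "flat_lift {0..1} p (\<lambda>t. if t \<in> {0..1/2} then \<Lambda>1 (2 * t) else \<Lambda>2 (2 * t - 1))" unfolding un by simp
  then show ?thesis unfolding linked_def
    using p 1(2,5) 2(3,6)
    by (intro exI[of _ p] exI[of _ "\<lambda>t. if t \<in> {0..1/2} then \<Lambda>1 (2 * t) else \<Lambda>2 (2 * t - 1)"])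
      (simp add: p_def)
qed

lemma linked_unique:
  assumes "linked a x b y" "linked a x b z" shows "y = z"
proof -
  have "linked b y b z" using linked_trans[OF linked_sym[OF assms(1)] assms(2)] .
  then obtain p \<Lambda> where "pathin (surface S) p" "p 0 = proj S b" "p 1 = proj S b"
     "flat_lift {0..1} p \<Lambda>" "\<Lambda> 0 b = y" "\<Lambda> 1 b = z" unfolding linked_def by blast
  then show ?thesis using flat_lift_loop[of p \<Lambda> b] proj_self by simp
qed

lemma linked_path:
  assumes "pathin (surface S) p" "p 0 = proj S a" "p 1 = proj S b"
  shows "\<exists>\<Lambda>. flat_lift {0..1} p \<Lambda> \<and> \<Lambda> 0 a = x \<and> linked a x b (\<Lambda> 1 b)"
proof -
  have "liftable p {0..1}" using liftable_interval assms(1) by (simp add: pathin_def)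
  moreover have "a \<in> p 0" "(0::real) \<in> {0..1}" using assms(2) proj_self by simp_all
  ultimately obtain \<Lambda> where "flat_lift {0..1} p \<Lambda>" "\<Lambda> 0 a = x"
    unfolding liftable_def by meson
  then show ?thesis unfolding linked_def using assms by blast
qed

lemma linked_exists:
  assumes "a \<in> pc S" "b \<in> pc S" shows "\<exists>y. linked a x b y"
proof -
  have "path_connected_space (surface S)" using simply_connected by (simp add: simply_connected_space_def)
  moreover have "proj S a \<in> topspace (surface S)" "proj S b \<in> topspace (surface S)"
    using assms by (simp_all add: topspace_surface)
  ultimately obtain p where "pathin (surface S) p" "p 0 = proj S a" "p 1 = proj S b"
    unfolding path_connected_space_def by meson
  from linked_path[OF this] show ?thesis by blast
qed

text \<open>Along a segment within one square the value of a lift is locally constant.\<close>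

lemma linked_square:
  assumes "q \<in> squares S" "p1 \<in> unit_square" "p2 \<in> unit_square"
  shows "linked (q, p1) x (q, p2) x"
proof -
  define s where "s t = (1 - t) *\<^sub>R p1 + t *\<^sub>R p2" for t :: real
  have "convex unit_square" unfolding unit_square_def by (intro convex_Times) simp_all
  then have s: "s t \<in> unit_square" if "0 \<le> t" "t \<le> 1" for t
    unfolding s_def using convexD_alt assms(2,3) that by blast
  have sc: "continuous_on {0..1} s" unfolding s_def by (intro continuous_intros)
  have qc: "continuous_map (top_of_set {0..1}) (pieces S) (\<lambda>t. (q, s t))"
    unfolding pieces_def continuous_map_paired using assms(1) s sc by (auto simp: continuous_map_in_subtopology)
  from continuous_map_compose[OF this continuous_map_proj]
  have p: "pathin (surface S) (\<lambda>t. proj S (q, s t))" by (simp add: pathin_def o_def)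
  obtain \<Lambda> where \<Lambda>: "flat_lift {0..1} (\<lambda>t. proj S (q, s t)) \<Lambda>" "\<Lambda> 0 (q, p1) = x"
    "linked (q, p1) x (q, p2) (\<Lambda> 1 (q, p2))"
    using linked_path[OF p, of "(q, p1)" "(q, p2)" x] by (auto simp: s_def)
  have "(\<lambda>t. \<Lambda> t (q, s t)) constant_on {0..1}"
  proof (rule locally_constant_imp_constant)
    fix t :: real assume t: "t \<in> {0..1}"
    obtain W g d where *: "flat W g" "proj S (q, s t) \<subseteq> W" "d > 0"
      "\<And>z'. z' \<in> {0..1} \<Longrightarrow> dist z' t < d \<Longrightarrow> proj S (q, s z') \<subseteq> W \<and> (\<forall>b\<in>proj S (q, s z'). \<Lambda> z' b = g b)"
      using \<Lambda>(1)[unfolded flat_lift_def, rule_format, OF t] by auto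
    have eq: "\<Lambda> z' (q, s z') = g (q, s z')" if "z' \<in> {0..1}" "dist z' t < d" for z'
      using *(4)[OF that] proj_self by blast
    have o: "openin (pieces S) {b \<in> W. g b = g (q, s t)}" using *(1) by (simp add: flat_def)
    define U where "U = {z' \<in> {0..1}. (q, s z') \<in> {b \<in> W. g b = g (q, s t)}}"
    have "openin (top_of_set {0..1}) U"
      using openin_continuous_map_preimage[OF qc o] by (simp add: U_def)
    then have "openin (top_of_set {0..1}) (U \<inter> ball t d)" by (simp add: openin_Int_open)
    moreover have "(q, s t) \<in> W" using *(2) proj_self by (rule subsetD)
    then have "t \<in> U \<inter> ball t d" using t *(3) by (simp add: U_def)
    moreover have "\<Lambda> z' (q, s z') = \<Lambda> t (q, s t)" if "z' \<in> U \<inter> ball t d" for z'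
      using eq[of z'] eq[OF t] that *(3) by (auto simp: U_def dist_commute)
    ultimately show "\<exists>T. openin (top_of_set {0..1}) T \<and> t \<in> T \<and> (\<forall>z'\<in>T. \<Lambda> z' (q, s z') = \<Lambda> t (q, s t))"
      by blast
  qed simp
  then have "\<Lambda> 1 (q, s 1) = \<Lambda> 0 (q, s 0)" unfolding constant_on_def by (metis atLeastAtMost_iff order_refl zero_le_one)
  then show ?thesis using \<Lambda>(2,3) by (simp add: s_def)
qed

lemma linked_paste:
  assumes "glue S (q, i) = Some (q', j)" "0 \<le> t" "t \<le> 1"
  shows "linked (q, side_point i t) x (q', side_point j (1 - t)) (transport q i x)"
proof -
  define a b where "a = (q, side_point i t)" and "b = (q', side_point j (1 - t))"
  have ab: "proj S a = proj S b" using proj_paste[OF glue_paste[OF assms]] by (simp add: a_def b_def)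
  have pa: "a \<in> pc S" using glueD(1)[OF assms(1)] assms side_point_in_unit_square by (simp add: a_def)
  obtain W where W: "chart W" "a \<in> W" using chart_exists[OF pa] by blast
  then obtain g where g: "flat W g" "g a = x" by (auto simp: chart_def)
  have top: "proj S a \<in> topspace (surface S)" using pa by (auto simp: topspace_surface)
  have sub: "proj S a \<subseteq> W" using class_subset_saturated[OF flat_saturated[OF g(1)] top proj_self W(2)] .
  have "pathin (surface S) (\<lambda>_. proj S a)" using top by (simp add: pathin_def)
  moreover have "flat_lift {0..1} (\<lambda>_::real. proj S a) (\<lambda>_. g)"
    unfolding flat_lift_def using g(1) sub zero_less_one by blast
  moreover have "g b = transport q i x"
    using g W(2) assms unfolding flat_def a_def b_def by blast
  ultimately show ?thesis unfolding linked_def a_def[symmetric] b_def[symmetric] using ab g(2)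
    by (intro exI[of _ "\<lambda>_. proj S a"] exI[of _ "\<lambda>_. g"]) simp
qed

theorem global_section:
  assumes "q0 \<in> squares S"
  shows "\<exists>f. f q0 = x0 \<and> (\<forall>q i q' j. glue S (q, i) = Some (q', j) \<longrightarrow> f q' = transport q i (f q))"
proof -
  have c: "(q, center) \<in> pc S" if "q \<in> squares S" for q using that center_in_unit_square by simp
  define f where "f q = (THE y. linked (q0, center) x0 (q, center) y)" for q
  have f: "f q = y" if "linked (q0, center) x0 (q, center) y" for q y
    unfolding f_def using that linked_unique by blast
  have lf: "linked (q0, center) x0 (q, center) (f q)" if "q \<in> squares S" for q
    using linked_exists[OF c[OF assms] c[OF that]] f by metis
  have "f q' = transport q i (f q)" if g: "glue S (q, i) = Some (q', j)" for q i q' j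
  proof -
    note q = glueD(1,3)[OF g]
    have m: "side_point k (1/2) \<in> unit_square" for k by (rule side_point_in_unit_square) simp_all
    have "linked (q, center) (f q) (q, side_point i (1/2)) (f q)"
      by (rule linked_square[OF q(1) center_in_unit_square m])
    moreover have "linked (q, side_point i (1/2)) (f q) (q', side_point j (1/2)) (transport q i (f q))"
      using linked_paste[OF g, of "1/2"] by simp
    moreover have "linked (q', side_point j (1/2)) (transport q i (f q)) (q', center) (transport q i (f q))"
      by (rule linked_square[OF q(2) m center_in_unit_square])
    ultimately show ?thesis using f linked_trans lf[OF q(1)] by meson
  qed
  moreover have "f q0 = x0"
    using f linked_square[OF assms center_in_unit_square center_in_unit_square] by blast
  ultimately show ?thesis by blast
qed

end

context tiled_disc
begin

section \<open>The developing map\<close>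

text \<open>The squares that have the property and those that do not would otherwise make up two disjoint open sets
  that cover the surface.\<close>

lemma squares_connected:
  assumes "q0 \<in> squares S" "P q0" "q \<in> squares S"
    and step: "\<And>q i q' j. glue S (q, i) = Some (q', j) \<Longrightarrow> P q \<Longrightarrow> P q'"
  shows "P q"
proof (rule ccontr)
  assume "\<not> P q"
  have sat: "saturated_open S {b \<in> pc S. Q (fst b)}"
    if Q: "\<And>q i q' j. glue S (q, i) = Some (q', j) \<Longrightarrow> Q q \<Longrightarrow> Q q'" for Q :: "'a \<Rightarrow> bool"
    unfolding saturated_open_def
  proof (intro conjI allI impI)
    have "{p. (q, p) \<in> {b \<in> pc S. Q (fst b)}} = (if Q q then unit_square else {})" if "q \<in> squares S" for q
      using that by auto
    then show "openin (pieces S) {b \<in> pc S. Q (fst b)}" unfolding openin_pieces by auto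
    fix a b assume ab: "(a, b) \<in> paste S" "a \<in> {b \<in> pc S. Q (fst b)}"
    then obtain q i q' j t where *: "a = (q, side_point i t)" "b = (q', side_point j (1 - t))"
      "glue S (q, i) = Some (q', j)" "0 \<le> t" "t \<le> 1"
      unfolding paste_iff by blast
    then show "b \<in> {b \<in> pc S. Q (fst b)}" using Q[OF *(3)] ab paste_pc[OF ab(1)] by simp
  qed
  define W1 W2 where "W1 = {b \<in> pc S. P (fst b)}" and "W2 = {b \<in> pc S. \<not> P (fst b)}"
  have W1: "saturated_open S W1" unfolding W1_def by (rule sat) (rule step)
  have W2: "saturated_open S W2" unfolding W2_def by (rule sat) (use step glueD(5) in blast)
  have "connected_space (surface S)"
    using simply_connected path_connected_imp_connected_space unfolding simply_connected_space_def by blast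
  moreover have "openin (surface S) (proj S ` W1)" "openin (surface S) (proj S ` W2)"
    using openin_surface_image W1 W2 by blast+
  moreover have "topspace (surface S) \<subseteq> proj S ` W1 \<union> proj S ` W2"
    unfolding topspace_surface W1_def W2_def by blast
  moreover have "proj S ` W1 \<inter> proj S ` W2 = {}"
  proof -
    have "b \<notin> W2" if "b \<in> W1" for b using that by (simp add: W1_def W2_def)
    then show ?thesis using proj_in_image_saturated[OF W2] by blast
  qed
  moreover have "(q0, center) \<in> W1" "(q, center) \<in> W2"
    using assms \<open>\<not> P q\<close> center_in_unit_square by (simp_all add: W1_def W2_def)
  then have "proj S ` W1 \<noteq> {}" "proj S ` W2 \<noteq> {}" by blast+
  ultimately show False unfolding connected_space_def by meson
qed

lemma ii_power_mod4 [simp]: "\<i> ^ (n mod 4) = \<i> ^ n"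
proof -
  have "\<i> ^ n = \<i> ^ (4 * (n div 4) + n mod 4)" by simp
  also have "\<dots> = (\<i> ^ 4) ^ (n div 4) * \<i> ^ (n mod 4)" by (simp only: power_add power_mult)
  finally show ?thesis by simp
qed

text \<open>The developing map draws the square \<open>q\<close> in the complex plane with its center at \<open>z\<close> and turned by \<open>u\<close>, so
  that the outward direction of its side \<open>i\<close> is \<open>- u * \<i> ^ (i + 1)\<close>. Crossing side \<open>i\<close> determines where the
  neighbour is drawn, because the two drawings have to share this side.\<close>

definition develop :: "'a \<Rightarrow> nat \<Rightarrow> complex \<times> complex \<Rightarrow> complex \<times> complex" where
  "develop q i uz = (- fst uz * \<i> ^ i / \<i> ^ snd (the (glue S (q, i))), snd uz - fst uz * \<i> ^ (i + 1))"

text \<open>The number \<open>u * \<i> ^ i\<close> is the direction in which side \<open>i\<close> leaves corner \<open>i\<close>. A turn around the corner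
  multiplies this direction by \<open>\<i>\<close> and moves the center by its negative. After four turns both are restored.\<close>

lemma develop_turn:
  assumes "turn a i b j"
  shows "develop a ((i + 3) mod 4) (u, z) = (\<i> * (u * \<i> ^ i) / \<i> ^ j, z - u * \<i> ^ i)"
proof -
  have "\<i> ^ ((i + 3) mod 4) = - \<i> * \<i> ^ i" by (simp add: power_add power3_eq_cube)
  moreover from this have "\<i> ^ ((i + 3) mod 4 + 1) = \<i> ^ i" by (simp add: power_add)
  ultimately show ?thesis using assms by (simp add: develop_def)
qed

lemma developing_map:
  "\<exists>u z :: 'a \<Rightarrow> complex. (\<forall>q\<in>squares S. u q \<noteq> 0) \<and> (\<forall>q i q' j. glue S (q, i) = Some (q', j) \<longrightarrow>
     z q' = z q - u q * \<i> ^ (i + 1) \<and> u q' * \<i> ^ j = - u q * \<i> ^ i)"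
proof (cases "squares S = {}")
  case True
  then have "glue S (q, i) \<noteq> Some (q', j)" for q i q' j using glueD(1) by blast
  then show ?thesis using True by simp
next
  case False
  then obtain q0 where q0: "q0 \<in> squares S" by blast
  interpret local_system S black develop
  proof unfold_locales
    fix q i q' j x assume g: "glue S (q, i) = Some (q', j)"
    show "develop q' j (develop q i x) = x"
      using g glueD(5)[OF g] by (cases x) (simp add: develop_def power_add field_simps)
  next
    fix a i b j c k d l and x :: "complex \<times> complex"
    assume g: "turn a i b j" "turn b j c k"
      "turn c k d l" "turn d l a i"
    obtain u z where x: "x = (u, z)" by (cases x)
    show "develop d ((l + 3) mod 4) (develop c ((k + 3) mod 4) (develop b ((j + 3) mod 4)
      (develop a ((i + 3) mod 4) x))) = x"
      unfolding x develop_turn[OF g(1)] develop_turn[OF g(2)] develop_turn[OF g(3)] develop_turn[OF g(4)]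
      by (simp add: algebra_simps)
  qed
  obtain f where f: "f q0 = (1, 0)" "\<And>q i q' j. glue S (q, i) = Some (q', j) \<Longrightarrow> f q' = develop q i (f q)"
    using global_section[OF q0, of "(1, 0)"] by blast
  show ?thesis
  proof (rule exI[of _ "\<lambda>q. fst (f q)"], rule exI[of _ "\<lambda>q. snd (f q)"], intro conjI ballI allI impI)
    show "fst (f q) \<noteq> 0" if "q \<in> squares S" for q
    proof (rule squares_connected[OF q0 _ that])
      fix q i q' j assume "glue S (q, i) = Some (q', j)" "fst (f q) \<noteq> 0"
      then show "fst (f q') \<noteq> 0" using f(2) by (simp add: develop_def)
    qed (simp add: f(1))
    show "snd (f q') = snd (f q) - fst (f q) * \<i> ^ (i + 1)" "fst (f q') * \<i> ^ j = - fst (f q) * \<i> ^ i"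
      if "glue S (q, i) = Some (q', j)" for q i q' j
      using f(2)[OF that] that by (simp_all add: develop_def)
  qed
qed

lemma ii_power_inject: "\<i> ^ i = \<i> ^ j \<Longrightarrow> i < 4 \<Longrightarrow> j < 4 \<Longrightarrow> i = j"
  unfolding less_4_cases by (elim disjE) (auto simp: power3_eq_cube complex_eq_iff)

text \<open>The neighbours across different sides are drawn at different places of the plane.\<close>

lemma neighbour_side_unique:
  assumes "glue S (q, i) = Some (q', j)" "glue S (q, i') = Some (q', j')"
  shows "i = i' \<and> j = j'"
proof -
  obtain u z :: "'a \<Rightarrow> complex" where uz0: "\<forall>q\<in>squares S. u q \<noteq> 0"
    "\<forall>q i q' j. glue S (q, i) = Some (q', j) \<longrightarrow> z q' = z q - u q * \<i> ^ (i + 1) \<and> u q' * \<i> ^ j = - u q * \<i> ^ i"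
    using developing_map by blast
  note uz = uz0(1)[rule_format] uz0(2)[rule_format]
  have "\<i> ^ i = \<i> ^ i'" using uz(2)[OF assms(1)] uz(2)[OF assms(2)] uz(1)[OF glueD(1)[OF assms(1)]] by simp
  then have "i = i'" using ii_power_inject glueD(2)[OF assms(1)] glueD(2)[OF assms(2)] by blast
  with assms show ?thesis by simp
qed

text \<open>In the drawing, two turns around a vertex move the center by \<open>- (1 + \<i>) * e\<close> for a number \<open>e\<close> that is
  not zero.\<close>

lemma around_distinct:
  assumes "turn a i b j" "turn b j c k"
    "turn c k d l" "turn d l a i"
  shows "distinct [a, b, c, d]"
proof -
  obtain u z :: "'a \<Rightarrow> complex" where uz0: "\<forall>q\<in>squares S. u q \<noteq> 0"
    "\<forall>q i q' j. glue S (q, i) = Some (q', j) \<longrightarrow> z q' = z q - u q * \<i> ^ (i + 1) \<and> u q' * \<i> ^ j = - u q * \<i> ^ i"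
    using developing_map by blast
  note uz = uz0(1)[rule_format] uz0(2)[rule_format]
  have opposite: "p \<noteq> r" if g: "turn p m q n" "turn q n r k"
    for p m q n r k
  proof -
    have p3: "\<i> ^ (n + 3) = - (\<i> * \<i> ^ n)" for n :: nat by (simp add: power_add power3_eq_cube)
    define e where "e = u p * \<i> ^ m"
    have "e \<noteq> 0" using uz(1)[OF glueD(1)[OF g(1)]] by (simp add: e_def)
    have "z q = z p - e" "u q * \<i> ^ n = \<i> * e" "z r = z q - u q * \<i> ^ n"
      using uz(2)[OF g(1)] uz(2)[OF g(2)] by (simp_all add: p3 e_def)
    then have "z r = z p - (1 + \<i>) * e" by (simp add: algebra_simps)
    moreover have "1 + \<i> \<noteq> 0" by (simp add: complex_eq_iff)
    ultimately show ?thesis using \<open>e \<noteq> 0\<close> by auto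
  qed
  show ?thesis
    using opposite[OF assms(1,2)] opposite[OF assms(2,3)] glue_neq[OF assms(1)] glue_neq[OF assms(2)]
      glue_neq[OF assms(3)] glue_neq[OF assms(4)] by auto
qed

text \<open>A square that is drawn furthest to the right has a side facing right, and no neighbour there.\<close>

lemma free_side_exists:
  assumes "squares S \<noteq> {}"
  shows "\<exists>q\<in>squares S. \<exists>i<4. glue S (q, i) = None"
proof (rule ccontr)
  assume "\<not> ?thesis"
  then have all: "\<exists>q' j. glue S (q, i) = Some (q', j)" if "q \<in> squares S" "i < 4" for q i
    using that by (metis option.exhaust surj_pair)
  obtain u z :: "'a \<Rightarrow> complex" where uz0: "\<forall>q\<in>squares S. u q \<noteq> 0"
    "\<forall>q i q' j. glue S (q, i) = Some (q', j) \<longrightarrow> z q' = z q - u q * \<i> ^ (i + 1) \<and> u q' * \<i> ^ j = - u q * \<i> ^ i"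
    using developing_map by blast
  note uz = uz0(1)[rule_format] uz0(2)[rule_format]
  have "Max ((\<lambda>r. Re (z r)) ` squares S) \<in> (\<lambda>r. Re (z r)) ` squares S"
    using finite_squares assms by (intro Max_in) simp_all
  then obtain q where q: "q \<in> squares S" "Re (z q) = Max ((\<lambda>r. Re (z r)) ` squares S)" by auto
  have q_max: "Re (z r) \<le> Re (z q)" if "r \<in> squares S" for r
    unfolding q(2) using finite_squares that by (intro Max_ge) simp_all
  have "\<exists>i<4. Re (u q * \<i> ^ (i + 1)) < 0"
  proof -
    have "Re (u q) \<noteq> 0 \<or> Im (u q) \<noteq> 0" using uz(1)[OF q(1)] by (simp add: complex_eq_iff)
    then consider "Im (u q) > 0" | "Re (u q) > 0" | "Im (u q) < 0" | "Re (u q) < 0" by linarith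
    then show ?thesis
    proof cases
      case 1 then show ?thesis by (intro exI[of _ 0]) simp
    next
      case 2 then show ?thesis by (intro exI[of _ 1]) (simp add: power2_eq_square)
    next
      case 3 then show ?thesis by (intro exI[of _ 2]) (simp add: power3_eq_cube eval_nat_numeral)
    next
      case 4 then show ?thesis by (intro exI[of _ 3]) simp
    qed
  qed
  then obtain i where i: "i < 4" "Re (u q * \<i> ^ (i + 1)) < 0" by blast
  obtain q' j where g: "glue S (q, i) = Some (q', j)" using all[OF q(1) i(1)] by blast
  have "Re (z q') > Re (z q)" using uz(2)[OF g] i(2) by simp
  then show False using q_max[OF glueD(3)[OF g]] by simp
qed

lemma vertices_connected:
  assumes step: "\<And>q i. q \<in> squares S \<Longrightarrow> i < 4 \<Longrightarrow> P (vx S q (Suc i)) \<longleftrightarrow> P (vx S q i)"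
    and "u \<in> vertices S" "P u" "v \<in> vertices S"
  shows "P v"
proof -
  have all: "P (vx S q k)" if "q \<in> squares S" "P (vx S q i)" "i < 4" for q i k
  proof -
    have "P (vx S q 1) \<longleftrightarrow> P (vx S q 0)" "P (vx S q 2) \<longleftrightarrow> P (vx S q 1)" "P (vx S q 3) \<longleftrightarrow> P (vx S q 2)"
      using step[OF that(1), of 0] step[OF that(1), of 1] step[OF that(1), of 2]
      by (simp_all add: numeral_2_eq_2 numeral_3_eq_3)
    then have "P (vx S q m)" if "m < 4" for m using that \<open>P (vx S q i)\<close> \<open>i < 4\<close> by (auto simp: less_4_cases)
    from this[of "k mod 4"] show ?thesis by simp
  qed
  obtain p m where u: "u = vx S p m" "p \<in> squares S" "m < 4" using assms(2) unfolding vertices_alt by blast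
  obtain q i where v: "v = vx S q i" "q \<in> squares S" using assms(4) unfolding vertices_alt by blast
  have "\<forall>k. P (vx S q k)"
  proof (rule squares_connected[of p "\<lambda>q. \<forall>k. P (vx S q k)"])
    show "\<forall>k. P (vx S p k)" using all u assms(3) by blast
    fix q i q' j assume g: "glue S (q, i) = Some (q', j)" "\<forall>k. P (vx S q k)"
    then have "P (vx S q' j)" using glue_vx(2)[OF g(1)] by metis
    then show "\<forall>k. P (vx S q' k)" using all glueD(3,4)[OF g(1)] by blast
  qed (use u v in auto)
  then show ?thesis using v by simp
qed

lemma boundary_vertex_exists: "q \<in> squares S \<Longrightarrow> \<exists>v\<in>vertices S. v \<in> boundary S"
proof -
  assume "q \<in> squares S"
  then have "squares S \<noteq> {}" by blast
  then obtain q i where "q \<in> squares S" "i < 4" "glue S (q, i) = None" using free_side_exists by blast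
  then show ?thesis using vx_boundary_iff[OF vx_in_vertices, of q i] vx_in_vertices by blast
qed

section \<open>Potentials and flows\<close>

lemma vertex_function:
  assumes "\<And>q i q' j. glue S (q, i) = Some (q', j) \<Longrightarrow> F q i = F q' ((j + 1) mod 4) \<and> F q ((i + 1) mod 4) = F q' j"
  shows "\<exists>h. \<forall>q i. i < 4 \<longrightarrow> h (vx S q i) = F q i"
proof -
  define h where "h v = (THE y. \<exists>q i. i < 4 \<and> vx S q i = v \<and> y = F q i)" for v
  have "h (vx S q i) = F q i" if "i < 4" for q i
    unfolding h_def
  proof (rule the_equality)
    show "\<exists>q' i'. i' < 4 \<and> vx S q' i' = vx S q i \<and> F q i = F q' i'" using that by blast
    fix y assume "\<exists>q' i'. i' < 4 \<and> vx S q' i' = vx S q i \<and> y = F q' i'"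
    then obtain q' i' where "i' < 4" "vx S q' i' = vx S q i" "y = F q' i'" by blast
    then show "y = F q i" using vx_eq_imp[where f = F, OF assms] that by blast
  qed
  then show ?thesis by blast
qed

text \<open>The value at corner \<open>0\<close> of a square determines the values at its other corners by adding up \<open>\<eta>\<close>, and this is
  consistent because \<open>\<eta>\<close> sums to zero around the square. Crossing a side keeps the values at its two ends.
  In particular turning around a vertex keeps the value at this vertex, so that the values at the corners \<open>0\<close>
  form a local system, and a global section of it is the required function.\<close>

lemma vertex_potential:
  fixes \<eta> :: "'a \<Rightarrow> nat \<Rightarrow> int"
  assumes anti: "\<And>q i q' j. glue S (q, i) = Some (q', j) \<Longrightarrow> \<eta> q' j = - \<eta> q i"
    and closed: "\<And>q. q \<in> squares S \<Longrightarrow> (\<Sum>i<4. \<eta> q i) = 0"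
  shows "\<exists>h. \<forall>q\<in>squares S. \<forall>i<4. h (vx S q (Suc i)) - h (vx S q i) = \<eta> q i"
proof (cases "squares S = {}")
  case False
  then obtain q0 where q0: "q0 \<in> squares S" by blast
  define A where "A q i = (\<Sum>m<i. \<eta> q m)" for q i
  have A: "A q ((i + 1) mod 4) = A q i + \<eta> q i" if "q \<in> squares S" "i < 4" for q i
  proof (cases "i = 3")
    case True
    have "(\<Sum>m<4. \<eta> q m) = A q 3 + \<eta> q 3"
      using sum.lessThan_Suc[of "\<eta> q" 3] by (simp add: A_def)
    then show ?thesis using True closed[OF that(1)] by (simp add: A_def)
  next
    case False then show ?thesis using that(2) by (simp add: A_def)
  qed
  define tr where "tr q i x = x + A q i - (case the (glue S (q, i)) of (q', j) \<Rightarrow> A q' ((j + 1) mod 4))" for q i x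
  have tr: "tr q i x = x + A q i - A q' ((j + 1) mod 4)" if "glue S (q, i) = Some (q', j)" for q i q' j x
    using that by (simp add: tr_def)
  interpret local_system S black tr
  proof unfold_locales
    fix q i q' j x assume g: "glue S (q, i) = Some (q', j)"
    show "tr q' j (tr q i x) = x"
      unfolding tr[OF g] tr[OF glueD(5)[OF g]] A[OF glueD(1,2)[OF g]] A[OF glueD(3,4)[OF g]] anti[OF g] by simp
  next
    fix a i b j c k d l x
    assume g: "turn a i b j" "turn b j c k"
      "turn c k d l" "turn d l a i"
    have turn: "tr p ((m + 3) mod 4) x = x + A p m - A q n"
      if "turn p m q n" "m < 4" for p m q n x
      using A[OF glueD(1,2)[OF that(1)]] A[OF glueD(3,4)[OF that(1)]] anti[OF that(1)]
      unfolding tr[OF that(1)] add3_mod[OF that(2)] by simp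
    show "tr d ((l + 3) mod 4) (tr c ((k + 3) mod 4) (tr b ((j + 3) mod 4) (tr a ((i + 3) mod 4) x))) = x"
      unfolding turn[OF g(1) glueD(4)[OF g(4)]] turn[OF g(2) glueD(4)[OF g(1)]]
        turn[OF g(3) glueD(4)[OF g(2)]] turn[OF g(4) glueD(4)[OF g(3)]] by simp
  qed
  obtain f where f: "\<And>q i q' j. glue S (q, i) = Some (q', j) \<Longrightarrow> f q' = tr q i (f q)"
    using global_section[OF q0] by blast
  define F where "F q i = f q + A q i" for q i
  have "F q i = F q' ((j + 1) mod 4) \<and> F q ((i + 1) mod 4) = F q' j"
    if g: "glue S (q, i) = Some (q', j)" for q i q' j
    using f[OF g] A[OF glueD(1,2)[OF g]] A[OF glueD(3,4)[OF g]] anti[OF g]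
    unfolding tr[OF g] F_def by simp
  then obtain h where h: "\<And>q i. i < 4 \<Longrightarrow> h (vx S q i) = F q i"
    using vertex_function[of F] by blast
  have "h (vx S q (Suc i)) - h (vx S q i) = \<eta> q i" if "q \<in> squares S" "i < 4" for q i
    using h[of "Suc i mod 4" q] h[OF that(2), of q] A[OF that] by (simp add: F_def)
  then show ?thesis by blast
qed simp

text \<open>A cycle of four turns is closed under turning, so it consists of all corners at the vertex. None of them
  belongs to a free side.\<close>

lemma around_interior:
  assumes g: "turn a i b j" "turn b j c k"
    "turn c k d l" "turn d l a i"
  shows "vx S a i \<in> interior_vertices S" "corners_at S (vx S a i) = {(a, i), (b, j), (c, k), (d, l)}"
proof -
  let ?A = "{(a, i), (b, j), (c, k), (d, l)}"
  let ?v = "vx S a i"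
  have lt: "i < 4" "j < 4" "k < 4" "l < 4" using glueD(4) g by blast+
  have sq: "a \<in> squares S" "b \<in> squares S" "c \<in> squares S" "d \<in> squares S" using glueD(3) g by blast+
  have ai: "(a, i) \<in> corners_at S ?v" using sq lt by (simp add: in_corners_at)
  have cor: "vx S b j = ?v" "vx S c k = ?v" "vx S d l = ?v"
    using glue_vx(2)[OF g(1)] glue_vx(2)[OF g(2)] glue_vx(2)[OF g(3)] lt by simp_all
  have sub: "corners_at S ?v \<subseteq> ?A"
    by (rule corners_at_next_closed[OF _ _ _ ai]) (use g lt in auto)
  have "?v \<notin> boundary S"
  proof
    assume "?v \<in> boundary S"
    then obtain q m where f: "q \<in> squares S" "m < 4" "glue S (q, m) = None" "?v = vx S q m \<or> ?v = vx S q (Suc m)"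
      using vx_boundary_iff[OF vx_in_vertices[OF sq(1)]] by blast
    from f(4) show False
    proof
      assume "?v = vx S q m"
      then have "(q, m) \<in> corners_at S ?v" using f by (simp add: in_corners_at)
      then have "(q, m) \<in> ?A" using sub by blast
      then show False using f(3) glueD(5)[OF g(1)] glueD(5)[OF g(2)] glueD(5)[OF g(3)] glueD(5)[OF g(4)] by auto
    next
      assume "?v = vx S q (Suc m)"
      then have "(q, (m + 1) mod 4) \<in> corners_at S ?v" using f by (simp add: in_corners_at)
      then have "(q, (m + 1) mod 4) \<in> ?A" using sub by blast
      then have "glue S (q, ((m + 1) mod 4 + 3) mod 4) \<noteq> None" using g by auto
      moreover have "((m + 1) mod 4 + 3) mod 4 = m" using f(2) by (auto simp: less_4_cases)
      ultimately show False using f(3) by simp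
    qed
  qed
  then show "?v \<in> interior_vertices S" using vx_in_vertices[OF sq(1)] by (simp add: interior_vertices_def)
  show "corners_at S ?v = ?A" using sub sq lt cor by (auto simp: in_corners_at)
qed

text \<open>In the cell structure dual to the squares, interior vertices are 2-cells and sides are edges, and \<open>\<beta>\<close> is
  the boundary of the 2-chain with coefficients \<open>h\<close>.\<close>

definition vertex_boundary :: "('a \<times> nat \<Rightarrow> int) \<Rightarrow> bool" where
  "vertex_boundary \<beta> \<longleftrightarrow> (\<exists>h. (\<forall>v. v \<notin> interior_vertices S \<longrightarrow> h v = 0) \<and>
     (\<forall>q\<in>squares S. \<forall>i<4. h (vx S q (Suc i)) - h (vx S q i) = \<beta> (q, i)))"

text \<open>The flow that crosses one side once. A flow takes opposite values at two sides that are pasted together, because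
  each of them counts what leaves its own square.\<close>

definition unit_flow :: "'a \<Rightarrow> nat \<Rightarrow> 'a \<times> nat \<Rightarrow> int" where
  "unit_flow q i s = (if s = (q, i) then 1 else 0) - (if glue S (q, i) = Some s then 1 else 0)"

lemma vertex_boundary_add:
  assumes "vertex_boundary \<beta>" "vertex_boundary \<beta>'"
  shows "vertex_boundary (\<lambda>s. \<beta> s + \<beta>' s)"
proof -
  obtain h h' where h: "\<forall>v. v \<notin> interior_vertices S \<longrightarrow> h v = 0"
    "\<forall>q\<in>squares S. \<forall>i<4. h (vx S q (Suc i)) - h (vx S q i) = \<beta> (q, i)"
    and h': "\<forall>v. v \<notin> interior_vertices S \<longrightarrow> h' v = 0"
    "\<forall>q\<in>squares S. \<forall>i<4. h' (vx S q (Suc i)) - h' (vx S q i) = \<beta>' (q, i)"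
    using assms unfolding vertex_boundary_def by blast
  show ?thesis unfolding vertex_boundary_def
  proof (intro exI[of _ "\<lambda>v. h v + h' v"] conjI ballI allI impI)
    fix q i assume "q \<in> squares S" "i < (4::nat)"
    then show "h (vx S q (Suc i)) + h' (vx S q (Suc i)) - (h (vx S q i) + h' (vx S q i)) = \<beta> (q, i) + \<beta>' (q, i)"
      using h(2)[rule_format, of q i] h'(2)[rule_format, of q i] by linarith
  qed (use h(1) h'(1) in simp)
qed

lemma vertex_boundary_uminus:
  assumes "vertex_boundary \<beta>" shows "vertex_boundary (\<lambda>s. - \<beta> s)"
proof -
  obtain h where h: "\<forall>v. v \<notin> interior_vertices S \<longrightarrow> h v = 0"
    "\<forall>q\<in>squares S. \<forall>i<4. h (vx S q (Suc i)) - h (vx S q i) = \<beta> (q, i)"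
    using assms unfolding vertex_boundary_def by blast
  show ?thesis unfolding vertex_boundary_def
  proof (intro exI[of _ "\<lambda>v. - h v"] conjI ballI allI impI)
    fix q i assume "q \<in> squares S" "i < (4::nat)"
    then show "- h (vx S q (Suc i)) - - h (vx S q i) = - \<beta> (q, i)"
      using h(2)[rule_format, of q i] by linarith
  qed (use h(1) in simp)
qed

lemma vertex_boundary_0: "vertex_boundary (\<lambda>_. 0)"
  unfolding vertex_boundary_def by (intro exI[of _ "\<lambda>_. 0"]) simp

text \<open>The side crossed by a turn around a vertex ends at this vertex when it is seen from the square that is left, and
  starts there when it is seen from the square that is entered. The four turns cross all sides at the vertex.\<close>

lemma vertex_indicator_step:
  assumes g: "turn a i b j" "turn b j c k"
    "turn c k d l" "turn d l a i"
    and q: "q \<in> squares S" "m < 4"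
  shows "(if vx S q (Suc m) = vx S a i then 1 else 0) - (if vx S q m = vx S a i then 1 else 0) =
    unit_flow a ((i + 3) mod 4) (q, m) + unit_flow b ((j + 3) mod 4) (q, m) +
    unit_flow c ((k + 3) mod 4) (q, m) + unit_flow d ((l + 3) mod 4) (q, m)"
proof -
  let ?v = "vx S a i"
  note ar = around_interior[OF g]
  have dist: "distinct [a, b, c, d]" by (rule around_distinct[OF g])
  have lt: "i < 4" "j < 4" "k < 4" "l < 4" using glueD(4) g by blast+
  have ind: "(if x = (a, i) then 1 else 0) + (if x = (b, j) then 1 else 0) + (if x = (c, k) then 1 else 0) +
    (if x = (d, l) then 1 else 0) = (if x \<in> corners_at S ?v then 1 else 0 :: int)" for x
    unfolding ar(2) using dist by auto
  have shift: "(q, m) = (p, (n + 3) mod 4) \<longleftrightarrow> (q, (m + 1) mod 4) = (p, n)" if "m < 4" "n < 4" for q m p and n :: nat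
  proof -
    have "((m + 1) mod 4 + 3) mod 4 = m" using that(1) by presburger
    then have "m = (n + 3) mod 4 \<longleftrightarrow> (m + 1) mod 4 = n" using add3_mod[OF that(2)] by auto
    then show ?thesis by simp
  qed
  define h where "h v = (if v = ?v then 1 else 0 :: int)" for v
    have h: "h (vx S q m) = (if (q, m) \<in> corners_at S ?v then 1 else 0)" if "m < 4" for m
      using q that by (simp add: h_def in_corners_at)
    have h1: "h (vx S q m) = (if (q, m) = (a, i) then 1 else 0) + (if (q, m) = (b, j) then 1 else 0) +
       (if (q, m) = (c, k) then 1 else 0) + (if (q, m) = (d, l) then 1 else 0)"
      unfolding ind using h[OF q(2)] .
    have "h (vx S q (Suc m)) = h (vx S q ((m + 1) mod 4))" by simp
    also have "\<dots> = (if (q, (m + 1) mod 4) = (a, i) then 1 else 0) + (if (q, (m + 1) mod 4) = (b, j) then 1 else 0) +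
       (if (q, (m + 1) mod 4) = (c, k) then 1 else 0) + (if (q, (m + 1) mod 4) = (d, l) then 1 else 0)"
      unfolding ind by (rule h) simp
    finally have h2: "h (vx S q (Suc m)) = (if (q, m) = (a, (i + 3) mod 4) then 1 else 0) +
      (if (q, m) = (b, (j + 3) mod 4) then 1 else 0) + (if (q, m) = (c, (k + 3) mod 4) then 1 else 0) +
      (if (q, m) = (d, (l + 3) mod 4) then 1 else 0)"
      unfolding shift[OF q(2) lt(1)] shift[OF q(2) lt(2)] shift[OF q(2) lt(3)] shift[OF q(2) lt(4)] .
    have sm: "(Some x = Some (q, m)) = ((q, m) = x)" for x by auto
    have "h (vx S q (Suc m)) - h (vx S q m) =
      unit_flow a ((i + 3) mod 4) (q, m) + unit_flow b ((j + 3) mod 4) (q, m) +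
      unit_flow c ((k + 3) mod 4) (q, m) + unit_flow d ((l + 3) mod 4) (q, m)"
      unfolding unit_flow_def g h1 h2 sm by simp
    then show ?thesis unfolding h_def .
qed

lemma vertex_boundary_around:
  assumes g: "turn a i b j" "turn b j c k"
    "turn c k d l" "turn d l a i"
  shows "vertex_boundary (\<lambda>s. unit_flow a ((i + 3) mod 4) s + unit_flow b ((j + 3) mod 4) s +
    unit_flow c ((k + 3) mod 4) s + unit_flow d ((l + 3) mod 4) s)"
  unfolding vertex_boundary_def
proof (intro exI[of _ "\<lambda>v. if v = vx S a i then 1 else 0"] conjI ballI allI impI)
  show "(if v = vx S a i then 1 else 0) = (0::int)" if "v \<notin> interior_vertices S" for v
    using around_interior(1)[OF g] that by auto
qed (rule vertex_indicator_step[OF g])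

definition coset :: "('a \<times> nat \<Rightarrow> int) \<Rightarrow> ('a \<times> nat \<Rightarrow> int) set" where
  "coset x = {y. vertex_boundary (\<lambda>s. y s - x s)}"

lemma coset_eq_iff: "coset x = coset y \<longleftrightarrow> vertex_boundary (\<lambda>s. x s - y s)"
proof
  assume "coset x = coset y"
  moreover have "x \<in> coset x" using vertex_boundary_0 by (simp add: coset_def)
  ultimately show "vertex_boundary (\<lambda>s. x s - y s)" by (simp add: coset_def)
next
  assume xy: "vertex_boundary (\<lambda>s. x s - y s)"
  have "vertex_boundary (\<lambda>s. z s - x s) \<longleftrightarrow> vertex_boundary (\<lambda>s. z s - y s)" for z
    using vertex_boundary_add[OF _ xy, of "\<lambda>s. z s - x s"]
      vertex_boundary_add[OF _ vertex_boundary_uminus[OF xy], of "\<lambda>s. z s - y s"] by auto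
  then show "coset x = coset y" by (simp add: coset_def)
qed

text \<open>Adding a unit of flow to a coset. Sets that are not cosets are left alone, which makes the map invertible
  and trivial around interior vertices on all sets.\<close>

definition shift_coset :: "'a \<Rightarrow> nat \<Rightarrow> ('a \<times> nat \<Rightarrow> int) set \<Rightarrow> ('a \<times> nat \<Rightarrow> int) set" where
  "shift_coset q i X = (if X \<in> range coset then coset (\<lambda>s. (SOME x. X = coset x) s + unit_flow q i s) else X)"

lemma shift_coset: "shift_coset q i (coset x) = coset (\<lambda>s. x s + unit_flow q i s)"
proof -
  define x' where "x' = (SOME y. coset x = coset y)"
  have "coset x = coset x'" unfolding x'_def by (rule someI[of _ x]) simp
  then have "vertex_boundary (\<lambda>s. (x' s + unit_flow q i s) - (x s + unit_flow q i s))"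
    using coset_eq_iff[of x' x] by simp
  then have "coset (\<lambda>s. x' s + unit_flow q i s) = coset (\<lambda>s. x s + unit_flow q i s)"
    by (simp only: coset_eq_iff)
  then show ?thesis by (simp add: shift_coset_def x'_def)
qed

lemma shift_coset_other: "X \<notin> range coset \<Longrightarrow> shift_coset q i X = X"
  by (simp add: shift_coset_def)

lemma unit_flow_back: "glue S (q, i) = Some (q', j) \<Longrightarrow> unit_flow q' j s = - unit_flow q i s"
  using glueD(5)[of q i q' j] by (auto simp: unit_flow_def)

text \<open>Attach to every square the cosets of the group of vertex boundaries, and let crossing a side add the unit
  flow through it; this is trivial around interior vertices because circulations are vertex boundaries. A
  consistent choice of cosets, with representatives \<open>r\<close>, writes every unit flow as \<open>r q' - r q\<close> up to a
  vertex boundary. In the sum of \<open>\<omega>\<close> times the unit flows the representatives cancel, because \<open>\<omega>\<close> has no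
  divergence, and only vertex boundaries remain. Summing over the sides of black squares counts each side
  once, so the coefficients stay integers.\<close>

lemma flow_is_boundary:
  fixes \<omega> :: "'a \<Rightarrow> nat \<Rightarrow> int"
  assumes anti: "\<And>q i q' j. glue S (q, i) = Some (q', j) \<Longrightarrow> \<omega> q' j = - \<omega> q i"
    and free: "\<And>q i. glue S (q, i) = None \<Longrightarrow> \<omega> q i = 0"
    and div: "\<And>q. q \<in> squares S \<Longrightarrow> (\<Sum>i<4. \<omega> q i) = 0"
  shows "\<exists>h. (\<forall>v. v \<notin> interior_vertices S \<longrightarrow> h v = 0) \<and>
     (\<forall>q\<in>squares S. \<forall>i<4. h (vx S q (Suc i)) - h (vx S q i) = \<omega> q i)"
proof (cases "squares S = {}")
  case True then show ?thesis by (intro exI[of _ "\<lambda>_. 0"]) simp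
next
  case False
  then obtain q0 where q0: "q0 \<in> squares S" by blast
  interpret local_system S black shift_coset
  proof unfold_locales
    fix q i q' j X assume g: "glue S (q, i) = Some (q', j)"
    show "shift_coset q' j (shift_coset q i X) = X"
    proof (cases "X \<in> range coset")
      case True
      then obtain x where X: "X = coset x" by blast
      show ?thesis unfolding X shift_coset unit_flow_back[OF g] by simp
    qed (simp add: shift_coset_other)
  next
    fix a i b j c k d l X
    assume g: "turn a i b j" "turn b j c k"
      "turn c k d l" "turn d l a i"
    show "shift_coset d ((l + 3) mod 4) (shift_coset c ((k + 3) mod 4) (shift_coset b ((j + 3) mod 4)
      (shift_coset a ((i + 3) mod 4) X))) = X"
    proof (cases "X \<in> range coset")
      case True
      then obtain x where X: "X = coset x" by blast
      show ?thesis unfolding X shift_coset coset_eq_iff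
        using vertex_boundary_around[OF g] by (simp add: algebra_simps)
    qed (simp add: shift_coset_other)
  qed
  obtain f where f: "f q0 = coset (\<lambda>_. 0)" "\<And>q i q' j. glue S (q, i) = Some (q', j) \<Longrightarrow> f q' = shift_coset q i (f q)"
    using global_section[OF q0, of "coset (\<lambda>_. 0)"] by blast
  have "\<exists>x. f q = coset x" if "q \<in> squares S" for q
  proof (rule squares_connected[OF q0 _ that])
    show "\<exists>x. f q0 = coset x" using f(1) by blast
    fix q i q' j assume "glue S (q, i) = Some (q', j)" "\<exists>x. f q = coset x"
    then show "\<exists>x. f q' = coset x" using f(2) shift_coset by metis
  qed
  then obtain r where r: "\<And>q. q \<in> squares S \<Longrightarrow> f q = coset (r q)" by metis
  have bd: "vertex_boundary (\<lambda>s. r q' s - (r q s + unit_flow q i s))" if g: "glue S (q, i) = Some (q', j)" for q i q' j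
    using f(2)[OF g] r[OF glueD(1)[OF g]] r[OF glueD(3)[OF g]] shift_coset coset_eq_iff by simp
  \<comment> \<open>The coefficients of the vertices are chosen once for every side, so that they can be added up.\<close>
  define good where "good q i q' h \<longleftrightarrow> (\<forall>v. v \<notin> interior_vertices S \<longrightarrow> h v = 0) \<and>
     (\<forall>p\<in>squares S. \<forall>m<4. h (vx S p (Suc m)) - h (vx S p m) = r q' (p, m) - (r q (p, m) + unit_flow q i (p, m)))"
    for q i q' h
  have ex: "\<exists>h. good q i q' h" if g: "glue S (q, i) = Some (q', j)" for q i q' j
    using bd[OF g]
    unfolding vertex_boundary_def good_def .
  define H where "H q i q' = (SOME h. good q i q' h)" for q i q'
  have good: "good q i q' (H q i q')" if g: "glue S (q, i) = Some (q', j)" for q i q' j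
    unfolding H_def using ex[OF g] by (rule someI_ex)
  have H: "\<And>q i q' j v. glue S (q, i) = Some (q', j) \<Longrightarrow> v \<notin> interior_vertices S \<Longrightarrow> H q i q' v = (0::int)"
    "\<And>q i q' j p m. glue S (q, i) = Some (q', j) \<Longrightarrow> p \<in> squares S \<Longrightarrow> m < 4 \<Longrightarrow>
       H q i q' (vx S p (Suc m)) - H q i q' (vx S p m) = r q' (p, m) - (r q (p, m) + unit_flow q i (p, m))"
    using good unfolding good_def by simp_all
  define G where "G = {s \<in> squares S \<times> {..<4}. black (fst s) \<and> glue S s \<noteq> None}"
  define G' where "G' = {s \<in> squares S \<times> {..<4}. \<not> black (fst s) \<and> glue S s \<noteq> None}"
  define w where "w s = \<omega> (fst s) (snd s)" for s
  define N where "N s = the (glue S s)" for s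
  define h where "h v = - (\<Sum>s\<in>G. w s * H (fst s) (snd s) (fst (N s)) v)" for v
  have fin: "finite G" "finite G'" using finite_squares by (auto simp: G_def G'_def)
  have N: "glue S (fst s, snd s) = Some (fst (N s), snd (N s))" if "s \<in> G" for s
    using that by (cases s) (auto simp: G_def N_def)
  have N': "glue S (fst s, snd s) = Some (fst (N s), snd (N s))" if "s \<in> G'" for s
    using that by (cases s) (auto simp: G'_def N_def)
  \<comment> \<open>Terms that depend only on the square, and not on the side, cancel because the flow has no divergence.\<close>
  have color: "(\<Sum>s\<in>{s \<in> squares S \<times> {..<4}. Q (fst s) \<and> glue S s \<noteq> None}. w s * R (fst s)) = 0" for Q R
  proof -
    have "(\<Sum>s\<in>{s \<in> squares S \<times> {..<4}. Q (fst s) \<and> glue S s \<noteq> None}. w s * R (fst s)) =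
      (\<Sum>s\<in>{q \<in> squares S. Q q} \<times> {..<4}. w s * R (fst s))"
    proof (rule sum.mono_neutral_left)
      show "\<forall>s\<in>{q \<in> squares S. Q q} \<times> {..<4} - {s \<in> squares S \<times> {..<4}. Q (fst s) \<and> glue S s \<noteq> None}. w s * R (fst s) = 0"
      proof
        fix s assume "s \<in> {q \<in> squares S. Q q} \<times> {..<4} - {s \<in> squares S \<times> {..<4}. Q (fst s) \<and> glue S s \<noteq> None}"
        then have "glue S (fst s, snd s) = None" by (simp add: mem_Times_iff del: not_None_eq)
        then show "w s * R (fst s) = 0" using free by (simp add: w_def)
      qed
    qed (use finite_squares in auto)
    also have "\<dots> = (\<Sum>q\<in>{q \<in> squares S. Q q}. \<Sum>i<4. w (q, i) * R q)"
      by (simp add: sum.cartesian_product case_prod_unfold)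
    also have "\<dots> = (\<Sum>q\<in>{q \<in> squares S. Q q}. (\<Sum>i<4. \<omega> q i) * R q)"
      unfolding w_def by (simp only: sum_distrib_right fst_conv snd_conv)
    also have "\<dots> = 0" using div by simp
    finally show ?thesis .
  qed
  have bij: "(\<Sum>s\<in>G. w s * R (fst (N s))) = (\<Sum>s\<in>G'. - w s * R (fst s))" for R :: "'a \<Rightarrow> int"
  proof (rule sum.reindex_bij_witness[of G N N])
    show "N (N s) = s" "N s \<in> G'" "- w (N s) * R (fst (N s)) = w s * R (fst (N s))" if "s \<in> G" for s
      using glueD[OF N[OF that]] glue_color[OF N[OF that]] anti[OF N[OF that]] that
      by (cases s; force simp: N_def G_def G'_def w_def)+
    show "N (N s) = s" "N s \<in> G" if "s \<in> G'" for s
      using glueD[OF N'[OF that]] glue_color[OF N'[OF that]] that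
      by (cases s; force simp: N_def G_def G'_def)+
  qed
  have "h (vx S p (Suc m)) - h (vx S p m) = \<omega> p m" if p: "p \<in> squares S" "m < 4" for p m
  proof -
    have "h (vx S p (Suc m)) - h (vx S p m) =
      - (\<Sum>s\<in>G. w s * (H (fst s) (snd s) (fst (N s)) (vx S p (Suc m)) - H (fst s) (snd s) (fst (N s)) (vx S p m)))"
      unfolding h_def by (simp add: sum_subtractf right_diff_distrib)
    also have "\<dots> = - (\<Sum>s\<in>G. w s * (r (fst (N s)) (p, m) - (r (fst s) (p, m) + unit_flow (fst s) (snd s) (p, m))))"
      by (intro arg_cong[of _ _ uminus] sum.cong refl) (simp add: H(2)[OF N p])
    also have "\<dots> = (\<Sum>s\<in>G. w s * unit_flow (fst s) (snd s) (p, m)) + (\<Sum>s\<in>G. w s * r (fst s) (p, m)) - (\<Sum>s\<in>G. w s * r (fst (N s)) (p, m))"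
      by (simp add: sum_subtractf sum.distrib algebra_simps)
    also have "(\<Sum>s\<in>G. w s * r (fst s) (p, m)) = 0"
      unfolding G_def by (rule color)
    also have "(\<Sum>s\<in>G. w s * r (fst (N s)) (p, m)) = 0"
    proof -
      have "(\<Sum>s\<in>G'. w s * r (fst s) (p, m)) = 0" unfolding G'_def by (rule color)
      then show ?thesis using bij[of "\<lambda>q. r q (p, m)"] by (simp add: sum_negf)
    qed
    also have "(\<Sum>s\<in>G. w s * unit_flow (fst s) (snd s) (p, m)) = \<omega> p m"
    proof (cases "glue S (p, m)")
      case None
      have "unit_flow (fst s) (snd s) (p, m) = 0" if "s \<in> G" for s
        using None that N[OF that] glueD(5)[OF N[OF that]] by (auto simp: unit_flow_def)
      then show ?thesis using free[OF None] by simp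
    next
      case (Some t)
      obtain q' j where t: "t = (q', j)" by (cases t)
      note g = Some[unfolded t]
      show ?thesis
      proof (cases "black p")
        case True
        have "unit_flow (fst s) (snd s) (p, m) = (if s = (p, m) then 1 else 0)" if s: "s \<in> G" for s
        proof -
          have "glue S (fst s, snd s) \<noteq> Some (p, m)" using glue_color[of "fst s" "snd s" p m] True s by (auto simp: G_def)
          then show ?thesis by (auto simp: unit_flow_def)
        qed
        moreover have "(p, m) \<in> G" using True p g by (simp add: G_def)
        moreover have "(\<Sum>s\<in>G. w s * (if s = (p, m) then 1 else 0)) = (\<Sum>s\<in>G. if s = (p, m) then w s else 0)"
          by (rule sum.cong) auto
        ultimately show ?thesis using fin by (simp add: w_def)
      next
        case False
        have "unit_flow (fst s) (snd s) (p, m) = (if s = (q', j) then - 1 else 0)" if s: "s \<in> G" for s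
        proof -
          have "s \<noteq> (p, m)" using False s by (auto simp: G_def)
          moreover have "glue S (fst s, snd s) = Some (p, m) \<longleftrightarrow> s = (q', j)"
            using glueD(5)[OF g] glueD(5)[of "fst s" "snd s" p m] g by (cases s) auto
          ultimately show ?thesis by (auto simp: unit_flow_def)
        qed
        moreover have "(q', j) \<in> G" using False glue_color[OF g] glueD[OF g] by (simp add: G_def)
        moreover have "(\<Sum>s\<in>G. w s * (if s = (q', j) then - 1 else 0)) = (\<Sum>s\<in>G. if s = (q', j) then - w s else 0)"
          by (rule sum.cong) auto
        ultimately show ?thesis using fin anti[OF g] by (simp add: w_def)
      qed
    qed
    finally show ?thesis by simp
  qed
  moreover have "h v = 0" if "v \<notin> interior_vertices S" for v
    unfolding h_def using H(1)[OF N that] by simp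
  ultimately show ?thesis by blast
qed

end

context tiled_disc
begin

section \<open>The flow of a pair of tilings\<close>

definition crosses :: "'a set set \<Rightarrow> 'a \<Rightarrow> nat \<Rightarrow> bool" where
  "crosses E q i \<longleftrightarrow> (\<exists>q' j. glue S (q, i) = Some (q', j) \<and> {q, q'} \<in> E)"

lemma crosses_glue: "glue S (q, i) = Some (q', j) \<Longrightarrow> crosses E q i \<longleftrightarrow> {q, q'} \<in> E"
  by (auto simp: crosses_def)

lemma crosses_back: "glue S (q, i) = Some (q', j) \<Longrightarrow> crosses E q' j \<longleftrightarrow> crosses E q i"
  using crosses_glue[of q i q' j E] crosses_glue[OF glueD(5), of q i q' j E] by (simp add: insert_commute)

lemma crosses_free: "glue S (q, i) = None \<Longrightarrow> \<not> crosses E q i"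
  by (simp add: crosses_def)

lemma crosses_squareD: "crosses E q i \<Longrightarrow> q \<in> squares S \<and> i < 4"
  unfolding crosses_def using glueD(1,2) by blast

lemma crosses_same_edge:
  assumes "glue S (q, i) = Some (q', j)" "glue S (q, k) = Some (q'', l)" "{q, q'} = {q, q''}"
  shows "i = k"
proof -
  have "q' = q''" using assms(3) glue_neq[OF assms(1)] glue_neq[OF assms(2)] by (auto simp: doubleton_eq_iff)
  then show ?thesis using neighbour_side_unique assms(1,2) by blast
qed

lemma dual_edge_side:
  assumes "e \<in> dual_edges S" "q \<in> e"
  shows "\<exists>i q' j. glue S (q, i) = Some (q', j) \<and> e = {q, q'}"
proof -
  obtain a b i j where e: "e = {a, b}" "glue S (a, i) = Some (b, j)"
    using assms(1) unfolding dual_edges_def by blast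
  from assms(2) e(1) consider "q = a" | "q = b" by blast
  then show ?thesis
  proof cases
    case 1 then show ?thesis using e by blast
  next
    case 2 then show ?thesis using e(1) glueD(5)[OF e(2)] by blast
  qed
qed

lemma tiling_side:
  assumes "domino_tiling S T" "q \<in> squares S"
  shows "\<exists>!i. crosses T q i"
proof -
  have sub: "T \<subseteq> dual_edges S" and ex: "\<exists>!e. e \<in> T \<and> q \<in> e"
    using assms unfolding domino_tiling_def by blast+
  from ex obtain e where e: "e \<in> T" "q \<in> e" "\<And>e'. e' \<in> T \<Longrightarrow> q \<in> e' \<Longrightarrow> e' = e" by blast
  from sub e(1) have "e \<in> dual_edges S" by blast
  from dual_edge_side[OF this e(2)] obtain i q' j where i: "glue S (q, i) = Some (q', j)" "e = {q, q'}" by blast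
  show ?thesis
  proof (rule ex1I[of _ i])
    show "crosses T q i" using i e(1) by (auto simp: crosses_def)
    fix k assume "crosses T q k"
    then obtain p l where k: "glue S (q, k) = Some (p, l)" "{q, p} \<in> T" unfolding crosses_def by blast
    have "{q, p} = {q, q'}" using e(3)[OF k(2)] i(2) by simp
    then show "k = i" using crosses_same_edge[OF k(1) i(1)] by simp
  qed
qed

definition side_of :: "'a set set \<Rightarrow> 'a \<Rightarrow> nat" where
  "side_of T q = (THE i. crosses T q i)"

lemma crosses_iff_side_of:
  assumes "domino_tiling S T" "q \<in> squares S"
  shows "crosses T q i \<longleftrightarrow> i = side_of T q"
  unfolding side_of_def using theI'[OF tiling_side[OF assms]] tiling_side[OF assms] by blast

lemma side_of_less: "domino_tiling S T \<Longrightarrow> q \<in> squares S \<Longrightarrow> side_of T q < 4"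
  using crosses_iff_side_of crosses_squareD by blast

definition colour_sign :: "'a \<Rightarrow> int" where
  "colour_sign q = (if black q then 1 else - 1)"

lemma colour_sign_glue: "glue S (q, i) = Some (q', j) \<Longrightarrow> colour_sign q' = - colour_sign q"
  using glue_color by (simp add: colour_sign_def)

text \<open>One unit from black to white through the dominoes of the first tiling and one unit from white to black
  through those of the second; dominoes of both tilings cancel.\<close>

definition tiling_flow :: "'a set set \<Rightarrow> 'a set set \<Rightarrow> 'a \<Rightarrow> nat \<Rightarrow> int" where
  "tiling_flow T T' q i = colour_sign q * (of_bool (crosses T q i) - of_bool (crosses T' q i))"

lemma tiling_flow_back: "glue S (q, i) = Some (q', j) \<Longrightarrow> tiling_flow T T' q' j = - tiling_flow T T' q i"
  by (simp add: tiling_flow_def crosses_back colour_sign_glue)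

lemma tiling_flow_free: "glue S (q, i) = None \<Longrightarrow> tiling_flow T T' q i = 0"
  by (simp add: tiling_flow_def crosses_free)

lemma sum_crosses:
  assumes "domino_tiling S T" "q \<in> squares S"
  shows "(\<Sum>i<4. of_bool (crosses T q i)) = (1 :: int)"
proof -
  have "(\<Sum>i<4. of_bool (crosses T q i)) = (\<Sum>i<4. if i = side_of T q then 1 else 0 :: int)"
    using crosses_iff_side_of[OF assms] by (intro sum.cong) auto
  then show ?thesis using side_of_less[OF assms] by simp
qed

end

section \<open>Cycles\<close>

locale tiling_pair = tiled_disc S black for S :: "'a square_pasting" and black +
  fixes T T' :: "'a set set"
  assumes tilings: "domino_tiling S T" "domino_tiling S T'"
begin

definition differing :: "'a set set" where
  "differing = (T - T') \<union> (T' - T)"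

definition touching :: "('a set \<times> 'a set) set" where
  "touching = {(e, f). e \<in> differing \<and> f \<in> differing \<and> e \<inter> f \<noteq> {}}"

lemma cycles_alt: "cycles T T' = differing // touching\<^sup>*"
  by (simp add: cycles_def differing_def touching_def)

lemma touching_sym: "(e, f) \<in> touching\<^sup>* \<Longrightarrow> (f, e) \<in> touching\<^sup>*"
proof -
  have "sym touching" by (auto simp: touching_def sym_def)
  then show "(e, f) \<in> touching\<^sup>* \<Longrightarrow> (f, e) \<in> touching\<^sup>*" using sym_rtrancl symD by metis
qed

lemma cycle_eq_class: "C \<in> cycles T T' \<Longrightarrow> e \<in> C \<Longrightarrow> C = touching\<^sup>* `` {e}"
proof -
  assume C: "C \<in> cycles T T'" "e \<in> C"
  then obtain e0 where e0: "C = touching\<^sup>* `` {e0}" unfolding cycles_alt quotient_def by blast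
  then have "(e0, e) \<in> touching\<^sup>*" using C(2) by blast
  then have ee0: "(e0, e) \<in> touching\<^sup>*" "(e, e0) \<in> touching\<^sup>*" using touching_sym by simp_all
  have "(e0, f) \<in> touching\<^sup>* \<longleftrightarrow> (e, f) \<in> touching\<^sup>*" for f
    using rtrancl_trans[OF ee0(1), of f] rtrancl_trans[OF ee0(2), of f] by iprover
  then show ?thesis unfolding e0 by (intro set_eqI) (simp only: Image_singleton_iff)
qed

lemma cycle_subset: "C \<in> cycles T T' \<Longrightarrow> C \<subseteq> differing"
proof
  fix e assume C: "C \<in> cycles T T'" "e \<in> C"
  then obtain e0 where e0: "C = touching\<^sup>* `` {e0}" "e0 \<in> differing" unfolding cycles_alt quotient_def by blast
  then have "(e0, e) \<in> touching\<^sup>*" using C(2) by blast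
  then show "e \<in> differing" using e0(2) by (induction rule: rtrancl_induct) (auto simp: touching_def)
qed

lemma cycle_nonempty: "C \<in> cycles T T' \<Longrightarrow> C \<noteq> {}"
  unfolding cycles_alt quotient_def by blast

lemma differing_dual: "differing \<subseteq> dual_edges S"
  using tilings unfolding domino_tiling_def differing_def by blast

lemma finite_cycles: "finite (cycles T T')"
proof -
  have "dual_edges S \<subseteq> Pow (squares S)"
    unfolding dual_edges_def using glueD(1,3) by blast
  then have "finite (dual_edges S)" using finite_squares finite_subset finite_Pow_iff by metis
  then have "finite differing" using differing_dual finite_subset by blast
  then show ?thesis unfolding cycles_alt quotient_def by simp
qed

definition cycle_flow :: "'a set set \<Rightarrow> 'a \<Rightarrow> nat \<Rightarrow> int" where
  "cycle_flow C q i = (if crosses C q i then tiling_flow T T' q i else 0)"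

lemma crosses_differing:
  "crosses differing q i \<longleftrightarrow> crosses T q i \<noteq> crosses T' q i"
proof (cases "glue S (q, i)")
  case None then show ?thesis by (simp add: crosses_free)
next
  case (Some s)
  obtain q' j where "s = (q', j)" by (cases s)
  then show ?thesis using crosses_glue[of q i q' j] Some by (auto simp: differing_def)
qed

lemma crosses_mono: "crosses C q i \<Longrightarrow> C \<subseteq> E \<Longrightarrow> crosses E q i"
  unfolding crosses_def by blast

lemma cycle_flow_cases:
  assumes "C \<in> cycles T T'" "crosses C q i"
  shows "cycle_flow C q i = 1 \<or> cycle_flow C q i = - 1"
proof -
  have "crosses T q i \<noteq> crosses T' q i"
    using crosses_mono[OF assms(2) cycle_subset[OF assms(1)]] crosses_differing by blast
  then show ?thesis using assms(2) by (auto simp: cycle_flow_def tiling_flow_def colour_sign_def)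
qed

lemma cycle_closed:
  assumes C: "C \<in> cycles T T'" "crosses C q i" "crosses differing q k"
  shows "crosses C q k"
proof -
  obtain q' j where i: "glue S (q, i) = Some (q', j)" "{q, q'} \<in> C" using C(2) unfolding crosses_def by blast
  obtain q'' l where k: "glue S (q, k) = Some (q'', l)" "{q, q''} \<in> differing" using C(3) unfolding crosses_def by blast
  have "({q, q'}, {q, q''}) \<in> touching"
    using cycle_subset[OF C(1)] i(2) k(2) unfolding touching_def by blast
  then have "{q, q''} \<in> C" using cycle_eq_class[OF C(1) i(2)] by blast
  then show ?thesis using k(1) unfolding crosses_def by blast
qed

text \<open>Each of the two tilings crosses exactly one side of the square. An edge of the cycle does not belong to both
  tilings, so the two sides are different, and the other edge belongs to the same cycle because the two
  dominoes have the square in common.\<close>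

lemma cycle_two_sides:
  assumes C: "C \<in> cycles T T'" "crosses C q i"
  obtains k where "k < 4" "k \<noteq> i" "crosses C q k" "cycle_flow C q k = - cycle_flow C q i"
    "\<And>m. crosses C q m \<Longrightarrow> m = i \<or> m = k"
proof -
  have q: "q \<in> squares S" using crosses_squareD[OF C(2)] by blast
  note t = crosses_iff_side_of[OF tilings(1) q] crosses_iff_side_of[OF tilings(2) q]
  define k where "k = (if i = side_of T q then side_of T' q else side_of T q)"
  have D: "crosses differing q m \<longleftrightarrow> (m = side_of T q) \<noteq> (m = side_of T' q)" for m
    unfolding crosses_differing t ..
  have i: "crosses differing q i" using crosses_mono[OF C(2) cycle_subset[OF C(1)]] .
  have k: "crosses differing q k" "k \<noteq> i" using i unfolding D k_def by auto
  have kC: "crosses C q k" using cycle_closed[OF C k(1)] .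
  show thesis
  proof (rule that[of k])
    show "k < 4" using crosses_squareD[OF kC] by blast
    show "cycle_flow C q k = - cycle_flow C q i"
    proof (cases "i = side_of T q")
      case True
      then have "crosses T q i" "\<not> crosses T' q i" "crosses T' q k" "\<not> crosses T q k"
        using i unfolding t D by (auto simp: k_def)
      then show ?thesis using kC C(2) by (simp add: cycle_flow_def tiling_flow_def)
    next
      case False
      then have "\<not> crosses T q i" "crosses T' q i" "\<not> crosses T' q k" "crosses T q k"
        using i unfolding t D by (auto simp: k_def)
      then show ?thesis using kC C(2) by (simp add: cycle_flow_def tiling_flow_def)
    qed
    show "m = i \<or> m = k" if "crosses C q m" for m
      using crosses_mono[OF that cycle_subset[OF C(1)]] i unfolding D k_def by auto
  qed (use k kC in auto)
qed

lemma sum_cycle_flow: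
  assumes "C \<in> cycles T T'" "q \<in> squares S"
  shows "(\<Sum>i<4. cycle_flow C q i) = 0"
proof (cases "\<exists>i. crosses C q i")
  case True
  then obtain i where i: "crosses C q i" ..
  obtain k where k: "k < 4" "k \<noteq> i" "crosses C q k" "cycle_flow C q k = - cycle_flow C q i"
    "\<And>m. crosses C q m \<Longrightarrow> m = i \<or> m = k"
    using cycle_two_sides[OF assms(1) i] by metis
  have "(\<Sum>i<4. cycle_flow C q i) = (\<Sum>m\<in>{i, k}. cycle_flow C q m)"
  proof (rule sum.mono_neutral_right)
    show "\<forall>m\<in>{..<4} - {i, k}. cycle_flow C q m = 0"
      using k(5) by (auto simp: cycle_flow_def)
  qed (use k(1) crosses_squareD[OF i] in auto)
  then show ?thesis using k(2,4) by simp
qed (simp add: cycle_flow_def)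

lemma cycle_flow_back: "glue S (q, i) = Some (q', j) \<Longrightarrow> cycle_flow C q' j = - cycle_flow C q i"
  by (simp add: cycle_flow_def crosses_back tiling_flow_back)

lemma cycle_flow_free: "glue S (q, i) = None \<Longrightarrow> cycle_flow C q i = 0"
  by (simp add: cycle_flow_def crosses_free)

lemma sum_over_cycles: "(\<Sum>C\<in>cycles T T'. cycle_flow C q i) = tiling_flow T T' q i"
proof (cases "crosses differing q i")
  case True
  then obtain q' j where g: "glue S (q, i) = Some (q', j)" "{q, q'} \<in> differing" unfolding crosses_def by blast
  define C0 where "C0 = touching\<^sup>* `` {{q, q'}}"
  have C0: "C0 \<in> cycles T T'" using g(2) unfolding cycles_alt C0_def by (rule quotientI)
  have "crosses C q i \<longleftrightarrow> C = C0" if "C \<in> cycles T T'" for C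
  proof
    assume "crosses C q i"
    then have "{q, q'} \<in> C" using crosses_glue[OF g(1)] by blast
    then show "C = C0" unfolding C0_def by (rule cycle_eq_class[OF that])
  next
    assume "C = C0" then show "crosses C q i" using crosses_glue[OF g(1)] by (auto simp: C0_def)
  qed
  then have "(\<Sum>C\<in>cycles T T'. cycle_flow C q i) = (\<Sum>C\<in>cycles T T'. if C = C0 then tiling_flow T T' q i else 0)"
    by (intro sum.cong) (auto simp: cycle_flow_def)
  then show ?thesis using C0 finite_cycles by simp
next
  case False
  then have "tiling_flow T T' q i = 0" unfolding crosses_differing tiling_flow_def by simp
  then have "cycle_flow C q i = 0" for C by (simp add: cycle_flow_def)
  then show ?thesis using \<open>tiling_flow T T' q i = 0\<close> by simp
qed

end

section \<open>The two sides of a cycle\<close>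

text \<open>One cycle together with the potential of its flow, which exists by \<open>flow_is_boundary\<close>.\<close>

locale tiling_cycle = tiling_pair S black T T' for S :: "'a square_pasting" and black T T' +
  fixes C :: "'a set set" and h :: "'a point set \<Rightarrow> int"
  assumes C: "C \<in> cycles T T'"
    and h_0: "\<And>v. v \<notin> interior_vertices S \<Longrightarrow> h v = 0"
    and h_step: "\<And>q i. q \<in> squares S \<Longrightarrow> i < 4 \<Longrightarrow> h (vx S q (Suc i)) - h (vx S q i) = cycle_flow C q i"
begin

text \<open>Two vertices are joined by sides off the cycle if and only if every property that is invariant along these
  sides takes the same value at both.\<close>

definition off_invariant :: "('a point set \<Rightarrow> bool) \<Rightarrow> bool" where
  "off_invariant P \<longleftrightarrow> (\<forall>q\<in>squares S. \<forall>i<4. \<not> crosses C q i \<longrightarrow> P (vx S q i) = P (vx S q (Suc i)))"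

definition off_cycle :: "'a point set \<Rightarrow> 'a point set \<Rightarrow> bool" where
  "off_cycle u v \<longleftrightarrow> (\<forall>P. off_invariant P \<longrightarrow> P u = P v)"

lemma off_cycleD:
  assumes "off_cycle u v"
    and "\<And>q i. q \<in> squares S \<Longrightarrow> i < 4 \<Longrightarrow> \<not> crosses C q i \<Longrightarrow> P (vx S q i) = P (vx S q (Suc i))" "P u"
  shows "P v"
proof -
  have "off_invariant P" using assms(2) unfolding off_invariant_def by blast
  then show ?thesis using assms(1,3) unfolding off_cycle_def by blast
qed

lemma off_cycle_refl: "off_cycle u u"
  by (simp add: off_cycle_def)

lemma off_cycle_trans: "off_cycle u v \<Longrightarrow> off_cycle v w \<Longrightarrow> off_cycle u w"
  unfolding off_cycle_def by metis

lemma off_cycle_sym: "off_cycle u v \<Longrightarrow> off_cycle v u"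
  unfolding off_cycle_def by metis

lemma off_cycle_step:
  assumes "q \<in> squares S" "\<not> crosses C q i" "i < 4"
  shows "off_cycle (vx S q i) (vx S q (Suc i))"
  using assms unfolding off_cycle_def off_invariant_def by blast

lemma off_cycle_walk:
  assumes "q \<in> squares S" "\<And>k. k < n \<Longrightarrow> \<not> crosses C q ((m + k) mod 4)"
  shows "off_cycle (vx S q m) (vx S q (m + n))"
  using assms(2)
proof (induction n)
  case 0 then show ?case by (simp add: off_cycle_refl)
next
  case (Suc n)
  have "off_cycle (vx S q ((m + n) mod 4)) (vx S q (Suc ((m + n) mod 4)))"
    by (rule off_cycle_step[OF assms(1)]) (use Suc.prems[of n] in auto)
  moreover have "off_cycle (vx S q m) (vx S q (m + n))" using Suc by simp
  ultimately show ?case using off_cycle_trans by simp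
qed

text \<open>The sides that follow counterclockwise after side \<open>i\<close> and before side \<open>k\<close> are neither \<open>i\<close> nor \<open>k\<close>, and the
  cycle crosses no other side of the square.\<close>

lemma off_cycle_within_square:
  assumes "crosses C q i" "crosses C q k" "k \<noteq> i" "\<And>m. crosses C q m \<Longrightarrow> m = i \<or> m = k"
  shows "off_cycle (vx S q (Suc i)) (vx S q k)"
proof -
  have lt: "q \<in> squares S" "i < 4" "k < 4" using crosses_squareD assms(1,2) by blast+
  \<comment> \<open>The number of steps from the end \<open>i + 1\<close> of side \<open>i\<close> to corner \<open>k\<close> is \<open>k - (i + 1)\<close> modulo \<open>4\<close>; the
    natural number \<open>k + 3 - i\<close> represents it.\<close>
  have "(Suc i + (k + 3 - i) mod 4) mod 4 = (Suc i + (k + 3 - i)) mod 4" by (rule mod_add_right_eq)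
  also have "\<dots> = k" using lt(2,3) by simp
  finally have ex: "(Suc i + (k + 3 - i) mod 4) mod 4 = k" .
  define n where "n = (LEAST n. (Suc i + n) mod 4 = k)"
  have n: "(Suc i + n) mod 4 = k" unfolding n_def using ex by (rule LeastI)
  have "n \<le> (k + 3 - i) mod 4" unfolding n_def using ex by (rule Least_le)
  then have "n \<le> 3" using mod_less_divisor[of 4 "k + 3 - i"] by linarith
  have "\<not> crosses C q ((Suc i + m) mod 4)" if m: "m < n" for m
  proof -
    have "(Suc i + m) mod 4 \<noteq> k" using not_less_Least[OF m[unfolded n_def]] .
    moreover have "m = 0 \<or> m = 1 \<or> m = 2" using m \<open>n \<le> 3\<close> by auto
    then have "(Suc i + m) mod 4 \<noteq> i" using lt(2) by (elim disjE; simp only:; presburger)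
    ultimately show ?thesis using assms(4) by blast
  qed
  from off_cycle_walk[OF lt(1), of n "Suc i", OF this] have "off_cycle (vx S q (Suc i)) (vx S q (Suc i + n))" .
  moreover have "vx S q (Suc i + n) = vx S q k" using vx_mod[of S q "Suc i + n"] by (simp only: n)
  ultimately show ?thesis by simp
qed

text \<open>The ends of a crossed side to the left and to the right of the cycle, which is followed in the direction of
  its flow: whoever leaves \<open>q\<close> through side \<open>i\<close> has corner \<open>i + 1\<close> on the left.\<close>

definition left where
  "left q i = (if cycle_flow C q i = 1 then vx S q (Suc i) else vx S q i)"

definition right where
  "right q i = (if cycle_flow C q i = 1 then vx S q i else vx S q (Suc i))"

lemma left_right_back:
  assumes "glue S (q, i) = Some (q', j)" "crosses C q i"
  shows "left q' j = left q i \<and> right q' j = right q i"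
  using cycle_flow_cases[OF C assms(2)] cycle_flow_back[OF assms(1), of C] glue_vx[OF assms(1)]
  by (auto simp: left_def right_def)

lemma left_right_within_square:
  assumes "crosses C q i" "crosses C q k"
  shows "off_cycle (left q i) (left q k) \<and> off_cycle (right q i) (right q k)"
proof (cases "k = i")
  case True then show ?thesis by (simp add: off_cycle_refl)
next
  case False
  obtain k' where k: "cycle_flow C q k' = - cycle_flow C q i" "\<And>m. crosses C q m \<Longrightarrow> m = i \<or> m = k'"
    using cycle_two_sides[OF C assms(1)] by metis
  have "k' = k" using k(2)[OF assms(2)] False by simp
  note k = k[unfolded this]
  have a: "off_cycle (vx S q (Suc i)) (vx S q k)"
    by (rule off_cycle_within_square[OF assms False]) (rule k(2))
  have b: "off_cycle (vx S q (Suc k)) (vx S q i)"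
    by (rule off_cycle_within_square[OF assms(2,1)]) (use False k(2) in auto)
  from cycle_flow_cases[OF C assms(1)] show ?thesis
  proof
    assume "cycle_flow C q i = 1"
    then show ?thesis using a off_cycle_sym[OF b] k(1) by (simp add: left_def right_def)
  next
    assume "cycle_flow C q i = - 1"
    then show ?thesis using a off_cycle_sym[OF b] k(1) by (simp add: left_def right_def)
  qed
qed

text \<open>Two successive sides of the cycle belong to a common square, where one can pass from one to the other on
  either side of the cycle. As a cycle is a chain of such steps, its left ends are all joined off the cycle, and
  so are its right ends.\<close>

lemma left_right_connected:
  assumes "crosses C q i" "crosses C p k"
  shows "off_cycle (left q i) (left p k) \<and> off_cycle (right q i) (right p k)"
proof -
  obtain q' j where g: "glue S (q, i) = Some (q', j)" "{q, q'} \<in> C" using assms(1) unfolding crosses_def by blast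
  obtain p' l where g': "glue S (p, k) = Some (p', l)" "{p, p'} \<in> C" using assms(2) unfolding crosses_def by blast
  have reach: "({q, q'}, {p, p'}) \<in> touching\<^sup>*" using cycle_eq_class[OF C g(2)] g'(2) by blast
  have all: "\<forall>p p' k l. glue S (p, k) = Some (p', l) \<longrightarrow> {p, p'} = e \<longrightarrow>
      off_cycle (left q i) (left p k) \<and> off_cycle (right q i) (right p k)"
    if "({q, q'}, e) \<in> touching\<^sup>*" for e
    using that
  proof (induction rule: rtrancl_induct)
    case base
    show ?case
    proof (intro allI impI)
      fix p p' k l assume *: "glue S (p, k) = Some (p', l)" "{p, p'} = {q, q'}"
      then consider "p = q" "p' = q'" | "p = q'" "p' = q" by (auto simp: doubleton_eq_iff)
      then show "off_cycle (left q i) (left p k) \<and> off_cycle (right q i) (right p k)"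
      proof cases
        case 1
        then have "k = i" using neighbour_side_unique *(1) g(1) by blast
        then show ?thesis using 1 off_cycle_refl by simp
      next
        case 2
        then have "k = j" using neighbour_side_unique[OF *(1)] glueD(5)[OF g(1)] by blast
        then show ?thesis using 2 left_right_back[OF g(1) assms(1)] off_cycle_refl by simp
      qed
    qed
  next
    case (step e f)
    have eC: "e \<in> C" using cycle_eq_class[OF C g(2)] step.hyps(1) by blast
    have fC: "f \<in> C" using cycle_eq_class[OF C g(2)] step.hyps by (blast intro: rtrancl_into_rtrancl)
    obtain r where r: "r \<in> e" "r \<in> f" using step.hyps(2) unfolding touching_def by blast
    have "e \<in> dual_edges S" "f \<in> dual_edges S" using eC fC cycle_subset[OF C] differing_dual by blast+
    then obtain m re n m' rf n' where
      e: "glue S (r, m) = Some (re, n)" "e = {r, re}" and f: "glue S (r, m') = Some (rf, n')" "f = {r, rf}"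
      using dual_edge_side r by metis
    have ce: "crosses C r m" using crosses_glue[OF e(1)] eC e(2) by simp
    have cf: "crosses C r m'" using crosses_glue[OF f(1)] fC f(2) by simp
    have "off_cycle (left q i) (left r m) \<and> off_cycle (right q i) (right r m)" using step.IH e by simp
    with left_right_within_square[OF ce cf] have
      rm: "off_cycle (left q i) (left r m') \<and> off_cycle (right q i) (right r m')" using off_cycle_trans by blast
    show ?case
    proof (intro allI impI)
      fix p p' k l assume *: "glue S (p, k) = Some (p', l)" "{p, p'} = f"
      then consider "p = r" "p' = rf" | "p = rf" "p' = r" unfolding f(2) by (auto simp: doubleton_eq_iff)
      then show "off_cycle (left q i) (left p k) \<and> off_cycle (right q i) (right p k)"
      proof cases
        case 1
        then have "k = m'" using neighbour_side_unique *(1) f(1) by blast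
        then show ?thesis using 1 rm by simp
      next
        case 2
        then have "k = n'" using neighbour_side_unique[OF *(1)] glueD(5)[OF f(1)] by blast
        then show ?thesis using 2 left_right_back[OF f(1) cf] rm by simp
      qed
    qed
  qed
  from all[OF reach] g'(1) show ?thesis by simp
qed

lemma h_off_cycle: "off_cycle u v \<Longrightarrow> h u = h v"
  by (erule off_cycleD[of u v "\<lambda>w. h u = h w"]) (use h_step in \<open>force simp: cycle_flow_def\<close>)+

lemma h_left_right: "crosses C q i \<Longrightarrow> h (left q i) = h (right q i) + 1"
  using cycle_flow_cases[OF C, of q i] h_step[of q i] crosses_squareD[of C q i]
  by (auto simp: left_def right_def)

lemma some_crossing: "\<exists>q i. crosses C q i"
proof -
  obtain e where e: "e \<in> C" using cycle_nonempty[OF C] by blast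
  then have "e \<in> dual_edges S" using cycle_subset[OF C] differing_dual by blast
  then obtain q q' i j where "e = {q, q'}" "glue S (q, i) = Some (q', j)" unfolding dual_edges_def by blast
  then show ?thesis using e unfolding crosses_def by blast
qed

text \<open>A walk from the cycle to the vertex either stays off the cycle or comes from its last crossing, on the left
  or on the right.\<close>

lemma vertex_left_or_right:
  assumes "crosses C q0 i0" "v \<in> vertices S"
  shows "off_cycle (left q0 i0) v \<or> off_cycle (right q0 i0) v"
proof -
  define A where "A v \<longleftrightarrow> off_cycle (left q0 i0) v \<or> off_cycle (right q0 i0) v" for v
  have tr: "A u \<Longrightarrow> off_cycle u v \<Longrightarrow> A v" for u v unfolding A_def using off_cycle_trans by blast
  have lr: "A (vx S q i) \<and> A (vx S q (Suc i))" if "crosses C q i" for q i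
    using left_right_connected[OF assms(1) that] unfolding A_def left_def right_def by (auto split: if_splits)
  have "A v"
  proof (rule vertices_connected[of A, OF _ _ _ assms(2)])
    show "A (vx S q (Suc i)) \<longleftrightarrow> A (vx S q i)" if "q \<in> squares S" "i < 4" for q i
      using lr[of q i] off_cycle_step[OF that(1) _ that(2)] tr off_cycle_sym by blast
    show "vx S q0 i0 \<in> vertices S" using vx_in_vertices crosses_squareD[OF assms(1)] by blast
    show "A (vx S q0 i0)" using lr[OF assms(1)] by blast
  qed
  then show ?thesis by (simp add: A_def)
qed

text \<open>There is a boundary vertex, where \<open>h\<close> vanishes, and it is joined off the cycle to the left or to the right end.
  Across the cycle \<open>h\<close> changes by one.\<close>

lemma h_values:
  assumes "crosses C q i"
  shows "h (left q i) = 1 \<and> h (right q i) = 0 \<or> h (left q i) = 0 \<and> h (right q i) = - 1"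
proof -
  obtain u where u: "u \<in> vertices S" "u \<in> boundary S" using boundary_vertex_exists some_crossing crosses_squareD by blast
  have "h u = 0" using u by (intro h_0) (auto simp: interior_vertices_def)
  then show ?thesis
    using vertex_left_or_right[OF assms u(1)] h_off_cycle h_left_right[OF assms] by fastforce
qed

text \<open>On each side of the cycle \<open>h\<close> is constant, and all boundary vertices lie on the side where it vanishes.\<close>

lemma h_zero_connected_to_boundary:
  assumes "v \<in> vertices S" "h v = 0"
  shows "\<exists>u\<in>vertices S. u \<in> boundary S \<and> off_cycle u v"
proof -
  obtain u where u: "u \<in> vertices S" "u \<in> boundary S" using boundary_vertex_exists some_crossing crosses_squareD by blast
  have "h u = 0" using u by (intro h_0) (auto simp: interior_vertices_def)
  obtain q i where qi: "crosses C q i" using some_crossing by blast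
  have "off_cycle u v"
    using vertex_left_or_right[OF qi u(1)] vertex_left_or_right[OF qi assms(1)] h_values[OF qi]
      h_off_cycle off_cycle_sym off_cycle_trans \<open>h u = 0\<close> assms(2) by (smt (verit, ccfv_SIG))
  then show ?thesis using u by blast
qed

section \<open>The enclosed region\<close>

lemma side_point_not_interior:
  assumes "i < 4" "0 \<le> t" "t \<le> 1"
  shows "\<not> (0 < fst (side_point i t) \<and> fst (side_point i t) < 1 \<and> 0 < snd (side_point i t) \<and> snd (side_point i t) < 1)"
  using assms unfolding less_4_cases by (elim disjE) (auto simp: side_point_simps)

text \<open>The segments of the drawing end at midpoints of crossed sides and otherwise stay inside the squares.\<close>

lemma side_point_in_drawing:
  assumes "proj S (q, side_point i t) \<in> drawing S C" "i < 4" "0 \<le> t" "t \<le> 1"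
  shows "crosses C q i \<and> t = 1/2"
proof -
  obtain q2 i2 q2' j2 p where *: "proj S (q, side_point i t) = proj S (q2, p)" "glue S (q2, i2) = Some (q2', j2)"
    "{q2, q2'} \<in> C" "p \<in> closed_segment center (side_point i2 (1/2))"
    using assms(1) unfolding drawing_def by blast
  have inp: "(q, side_point i t) \<in> proj S (q2, p)" using *(1) proj_self by metis
  note i2 = glueD(2)[OF *(2)]
  from closed_segment_center_side[OF *(4) i2] show ?thesis
  proof
    assume p: "p = side_point i2 (1/2)"
    have "proj S (q2, p) = {(q2, side_point i2 (1/2)), (q2', side_point j2 (1/2))}"
      unfolding p using proj_open_side[OF i2, of "1/2" q2] *(2) by auto
    with inp consider "q = q2" "side_point i t = side_point i2 (1/2)" | "q = q2'" "side_point i t = side_point j2 (1/2)"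
      by auto
    then show ?thesis
    proof cases
      case 1
      then have "i2 = i \<and> t = 1/2" using side_point_inject[of i2 "1/2" i t] i2 assms by simp
      then show ?thesis using 1 *(2,3) by (auto simp: crosses_def)
    next
      case 2
      then have "j2 = i \<and> t = 1/2" using side_point_inject[of j2 "1/2" i t] glueD(4)[OF *(2)] assms by simp
      then show ?thesis using 2 crosses_glue[OF *(2), of C] crosses_back[OF *(2), of C] *(3) by simp
    qed
  next
    assume "0 < fst p \<and> fst p < 1 \<and> 0 < snd p \<and> snd p < 1"
    then have "side_point i t = p" "0 < fst p \<and> fst p < 1 \<and> 0 < snd p \<and> snd p < 1"
      using proj_interior[of p q2] inp by auto
    then show ?thesis using side_point_not_interior[OF assms(2-4)] by simp
  qed
qed

abbreviation off_drawing where
  "off_drawing \<equiv> topspace (surface S) - drawing S C"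

lemma proj_in_topspace: "b \<in> pc S \<Longrightarrow> proj S b \<in> topspace (surface S)"
  unfolding topspace_surface by blast

lemma vertex_off_drawing:
  assumes "v \<in> vertices S"
  shows "v \<in> off_drawing"
proof -
  obtain q i where v: "v = vx S q i" "q \<in> squares S" "i < 4" using assms unfolding vertices_alt by blast
  have "v \<notin> drawing S C" using side_point_in_drawing[of q i 0] v by (auto simp: vx_def)
  then show ?thesis using v corner_in_unit_square proj_in_topspace by (simp add: vx_def)
qed

lemma off_cycle_component:
  assumes "off_cycle u v" "u \<in> vertices S"
  shows "connected_component_of (subtopology (surface S) off_drawing) u v"
proof -
  let ?Y = "subtopology (surface S) off_drawing"
  have one_step: "connected_component_of ?Y (vx S q i) (vx S q (Suc i))"
    if *: "q \<in> squares S" "i < 4" "\<not> crosses C q i" for q i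
  proof -
    let ?f = "\<lambda>t. proj S (q, side_point i t)"
    have "continuous_on {0..1} (side_point i)" unfolding side_point_def by (intro continuous_intros)
    then have "continuous_map (top_of_set {0..1}) (pieces S) (\<lambda>t. (q, side_point i t))"
      unfolding pieces_def continuous_map_paired using *(1) side_point_in_unit_square
      by (auto simp: continuous_map_in_subtopology)
    from continuous_map_compose[OF this continuous_map_proj]
    have "continuous_map (top_of_set {0..1}) (surface S) ?f" by (simp add: o_def)
    moreover have "connectedin (top_of_set {0..1::real}) {0..1}"
      by (simp add: connectedin_subtopology)
    ultimately have "connectedin (surface S) (?f ` {0..1})" by (rule connectedin_continuous_map_image)
    moreover have "?f ` {0..1} \<subseteq> off_drawing"
    proof
      fix y assume "y \<in> ?f ` {0..1}"
      then obtain t where t: "y = ?f t" "0 \<le> t" "t \<le> 1" by auto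
      have "y \<notin> drawing S C" using side_point_in_drawing[of q i t] t *(2,3) by blast
      moreover have "(q, side_point i t) \<in> pc S" using side_point_in_unit_square t *(1) by simp
      ultimately show "y \<in> off_drawing" using proj_in_topspace t(1) by simp
    qed
    ultimately have "connectedin ?Y (?f ` {0..1})" by (simp add: connectedin_subtopology)
    moreover have "vx S q i \<in> ?f ` {0..1}" by (rule image_eqI[of _ _ 0]) (simp_all add: vx_def)
    moreover have "vx S q (Suc i) \<in> ?f ` {0..1}" by (rule image_eqI[of _ _ 1]) (simp_all add: vx_def)
    ultimately show ?thesis unfolding connected_component_of_def by blast
  qed
  show ?thesis
  proof (rule off_cycleD[OF assms(1)])
    show "connected_component_of ?Y u (vx S q i) = connected_component_of ?Y u (vx S q (Suc i))"
      if "q \<in> squares S" "i < 4" "\<not> crosses C q i" for q i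
      using one_step[OF that] connected_component_of_trans[of ?Y u] connected_component_of_sym by metis
    show "connected_component_of ?Y u u" using vertex_off_drawing[OF assms(2)] by (simp add: connected_component_of_refl)
  qed
qed

lemma h_zero_not_enclosed:
  assumes "v \<in> vertices S" "h v = 0"
  shows "v \<notin> enclosed_region S C"
proof -
  obtain u where u: "u \<in> vertices S" "u \<in> boundary S" "off_cycle u v"
    using h_zero_connected_to_boundary[OF assms] by blast
  have "connected_component_of (subtopology (surface S) off_drawing) v u"
    using off_cycle_component[OF u(3,1)] connected_component_of_sym by metis
  then show ?thesis using u(2) unfolding enclosed_region_def by blast
qed

definition closed_quarter :: "nat \<Rightarrow> (real \<times> real) set" where
  "closed_quarter i = {p. \<bar>fst p - fst (corner i)\<bar> \<le> 1/2 \<and> \<bar>snd p - snd (corner i)\<bar> \<le> 1/2}"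

lemma closed_closed_quarter: "closed (closed_quarter i)"
  unfolding closed_quarter_def
  by (intro closed_Collect_conj closed_Collect_le continuous_intros)

lemma side_point_in_closed_quarter:
  assumes "m < 4" "i < 4" "0 \<le> s" "s \<le> 1"
  shows "side_point m s \<in> closed_quarter i \<longleftrightarrow> m = i \<and> s \<le> 1/2 \<or> (m + 1) mod 4 = i \<and> s \<ge> 1/2"
  using assms unfolding closed_quarter_def less_4_cases
  by (elim disjE) (auto simp: side_point_simps abs_if split: if_splits)

lemma closed_quarter_cover:
  assumes "p \<in> unit_square"
  shows "\<exists>i<4. p \<in> closed_quarter i"
proof -
  obtain x y where p: "p = (x, y)" "0 \<le> x" "x \<le> 1" "0 \<le> y" "y \<le> 1" using assms by (cases p) (auto simp: unit_square_def)
  consider "x \<le> 1/2" "y \<le> 1/2" | "x \<ge> 1/2" "y \<le> 1/2" | "x \<ge> 1/2" "y \<ge> 1/2" | "x \<le> 1/2" "y \<ge> 1/2" by linarith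
  then show ?thesis
  proof cases
    case 1 then show ?thesis using p by (intro exI[of _ 0]) (simp add: closed_quarter_def)
  next
    case 2 then show ?thesis using p by (intro exI[of _ 1]) (simp add: closed_quarter_def)
  next
    case 3 then show ?thesis using p by (intro exI[of _ 2]) (simp add: closed_quarter_def)
  next
    case 4 then show ?thesis using p by (intro exI[of _ 3]) (simp add: closed_quarter_def)
  qed
qed

lemma closed_quarter_adjacent:
  assumes "p \<in> unit_square" "i < 4" "p \<in> closed_quarter i" "p \<in> closed_quarter ((i + 1) mod 4)"
  shows "p \<in> closed_segment center (side_point i (1/2))"
proof -
  obtain x y where p: "p = (x, y)" "0 \<le> x" "x \<le> 1" "0 \<le> y" "y \<le> 1" using assms by (cases p) (auto simp: unit_square_def)
  from assms(2) consider "i = 0" | "i = 1" | "i = 2" | "i = 3" unfolding less_4_cases by blast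
  then show ?thesis
  proof cases
    case 1
    then have "x = 1/2" "y \<le> 1/2" using assms(3,4) p by (auto simp: closed_quarter_def)
    then show ?thesis using p 1 unfolding in_segment
      by (intro exI[of _ "1 - 2 * y"]) (auto simp: center_def side_point_simps field_simps)
  next
    case 2
    then have "y = 1/2" "x \<ge> 1/2" using assms(3,4) p by (auto simp: closed_quarter_def)
    then show ?thesis using p 2 unfolding in_segment
      by (intro exI[of _ "2 * x - 1"]) (auto simp: center_def side_point_simps field_simps)
  next
    case 3
    then have "x = 1/2" "y \<ge> 1/2" using assms(3,4) p by (auto simp: closed_quarter_def)
    then show ?thesis using p 3 unfolding in_segment
      by (intro exI[of _ "2 * y - 1"]) (auto simp: center_def side_point_simps field_simps)
  next
    case 4
    then have "y = 1/2" "x \<le> 1/2" using assms(3,4) p by (auto simp: closed_quarter_def)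
    then show ?thesis using p 4 unfolding in_segment
      by (intro exI[of _ "1 - 2 * x"]) (auto simp: center_def side_point_simps field_simps)
  qed
qed

lemma closed_quarter_opposite:
  assumes "i < 4" "p \<in> closed_quarter i" "p \<in> closed_quarter ((i + 2) mod 4)"
  shows "p = center"
  using assms unfolding less_4_cases
  by (elim disjE; cases p) (auto simp: closed_quarter_def center_def abs_if split: if_splits)

lemma h_side: "q \<in> squares S \<Longrightarrow> i < 4 \<Longrightarrow> \<not> crosses C q i \<Longrightarrow> h (vx S q ((i + 1) mod 4)) = h (vx S q i)"
  using h_step[of q i] by (simp add: cycle_flow_def)

lemma segment_in_drawing:
  assumes "crosses C q i" "p \<in> closed_segment center (side_point i (1/2))"
  shows "proj S (q, p) \<in> drawing S C"
  using assms unfolding crosses_def drawing_def by blast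

text \<open>Two closed quarters of a square meet in a segment from the center to the midpoint of a side, or in the
  center only. If the common point is not on the drawing, the cycle does not separate their corners.\<close>

lemma h_unambiguous:
  assumes q: "q \<in> squares S" "p \<in> unit_square" "proj S (q, p) \<notin> drawing S C"
    and ik: "i < 4" "k < 4" "p \<in> closed_quarter i" "p \<in> closed_quarter k"
  shows "h (vx S q i) = h (vx S q k)"
proof -
  have adj: "h (vx S q ((i + 1) mod 4)) = h (vx S q i)"
    if "i < 4" "p \<in> closed_quarter i" "p \<in> closed_quarter ((i + 1) mod 4)" for i
    using h_side[OF q(1) that(1)] segment_in_drawing[of q i p] closed_quarter_adjacent[OF q(2) that] q(3) by blast
  have opp: "h (vx S q ((i + 2) mod 4)) = h (vx S q i)"
    if "i < 4" "p \<in> closed_quarter i" "p \<in> closed_quarter ((i + 2) mod 4)" for i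
  proof -
    have "p = center" by (rule closed_quarter_opposite[OF that])
    then have "\<not> crosses C q m" for m using segment_in_drawing[of q m p] q(3) by auto
    then have *: "h (vx S q ((m + 1) mod 4)) = h (vx S q m)" if "m < 4" for m using h_side[OF q(1) that] by blast
    have "((i + 1) mod 4 + 1) mod 4 = (i + 2) mod 4" by presburger
    then show ?thesis using *[OF that(1)] *[of "(i + 1) mod 4"] by simp
  qed
  have "k = i \<or> k = (i + 1) mod 4 \<or> k = (i + 2) mod 4 \<or> i = (k + 1) mod 4"
    using ik(1,2) by (auto simp: less_4_cases)
  then show ?thesis using adj[of i] opp[of i] adj[of k] ik by auto
qed

text \<open>The locally constant extension of \<open>h\<close> to the complement of the drawing takes the value \<open>c\<close> at a point if
  all corners nearest to it have this value. The condition excludes finitely many closed quarters, so it is open.\<close>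

definition level :: "int \<Rightarrow> 'a point set" where
  "level c = {b \<in> pc S. \<forall>i<4. snd b \<in> closed_quarter i \<longrightarrow> h (vx S (fst b) i) = c}"

lemma saturated_open_level: "saturated_open S (level c)"
  unfolding saturated_open_def
proof (intro conjI allI impI)
  have "openin (top_of_set unit_square) {p. (q, p) \<in> level c}" if q: "q \<in> squares S" for q
  proof -
    have "{p. (q, p) \<in> level c} = unit_square \<inter> (\<Inter>i\<in>{i. i < 4 \<and> h (vx S q i) \<noteq> c}. - closed_quarter i)"
      using q by (auto simp: level_def)
    moreover have "open (\<Inter>i\<in>{i. i < 4 \<and> h (vx S q i) \<noteq> c}. - closed_quarter i)"
      by (rule open_INT) (use closed_closed_quarter in auto)
    ultimately show ?thesis by (simp add: openin_open_Int)
  qed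
  then show "openin (pieces S) (level c)" unfolding openin_pieces by (auto simp: level_def)
  fix a b assume "(a, b) \<in> paste S" "a \<in> level c"
  then obtain q i q' j t where *: "a = (q, side_point i t)" "b = (q', side_point j (1 - t))"
    "glue S (q, i) = Some (q', j)" "0 \<le> t" "t \<le> 1"
    unfolding paste_iff by blast
  note g = glueD[OF *(3)]
  have a: "h (vx S q m) = c" if "m < 4" "side_point i t \<in> closed_quarter m" for m
    using \<open>a \<in> level c\<close> that unfolding level_def *(1) by simp
  have "h (vx S q' k) = c" if k: "k < 4" "side_point j (1 - t) \<in> closed_quarter k" for k
  proof -
    have "j = k \<and> 1 - t \<le> 1/2 \<or> (j + 1) mod 4 = k \<and> 1 - t \<ge> 1/2"
      using side_point_in_closed_quarter[of j k "1 - t"] g k *(4,5) by simp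
    then show ?thesis
    proof
      assume c: "j = k \<and> 1 - t \<le> 1/2"
      then have "side_point i t \<in> closed_quarter ((i + 1) mod 4)"
        using side_point_in_closed_quarter[of i "(i + 1) mod 4" t] g *(4,5) by simp
      then have "h (vx S q ((i + 1) mod 4)) = c" by (rule a[rotated]) simp
      then show ?thesis using glue_vx(2)[OF *(3)] c by simp
    next
      assume c: "(j + 1) mod 4 = k \<and> 1 - t \<ge> 1/2"
      then have "side_point i t \<in> closed_quarter i"
        using side_point_in_closed_quarter[of i i t] g *(4,5) by simp
      then have "h (vx S q i) = c" by (rule a[rotated]) (rule g)
      then show ?thesis using glue_vx(1)[OF *(3)] c by auto
    qed
  qed
  then show "b \<in> level c" using g(3) side_point_in_unit_square[of "1 - t" j] *(4,5) unfolding *(2) level_def by simp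
qed

lemma in_level:
  assumes "b \<in> pc S" "proj S b \<notin> drawing S C" "i < 4" "snd b \<in> closed_quarter i"
  shows "b \<in> level (h (vx S (fst b) i))"
proof -
  have "h (vx S (fst b) k) = h (vx S (fst b) i)" if "k < 4" "snd b \<in> closed_quarter k" for k
    by (rule h_unambiguous[of "fst b" "snd b"]) (use assms that in \<open>simp_all add: mem_Times_iff\<close>)
  then show ?thesis using assms(1) by (simp add: level_def)
qed

text \<open>The boundary lies in the level \<open>0\<close>. A component of the complement of the drawing stays within one level.\<close>

lemma h_nonzero_enclosed:
  assumes "v \<in> vertices S" "h v \<noteq> 0"
  shows "v \<in> enclosed_region S C"
proof -
  let ?Y = "subtopology (surface S) off_drawing"
  let ?K = "connected_component_of_set ?Y v"
  obtain q i where v: "v = vx S q i" "q \<in> squares S" "i < 4" using assms(1) unfolding vertices_alt by blast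
  define c where "c = h v"
  have "?K \<inter> boundary S = {}"
  proof (rule ccontr)
    assume "?K \<inter> boundary S \<noteq> {}"
    then obtain x where x: "x \<in> ?K" "x \<in> boundary S" by blast
    have K: "connectedin ?Y ?K" by (rule connectedin_connected_component_of)
    then have K': "connectedin (surface S) ?K" "?K \<subseteq> off_drawing" by (simp_all add: connectedin_subtopology)
    define U where "U = proj S ` level c"
    define V where "V = (\<Union>c'\<in>- {c}. proj S ` level c')"
    have disj: "proj S ` level c1 \<inter> proj S ` level c2 = {}" if "c1 \<noteq> c2" for c1 c2
    proof -
      have "b \<notin> level c2" if b: "b \<in> level c1" for b
      proof -
        obtain k where "k < 4" "snd b \<in> closed_quarter k"
          using closed_quarter_cover[of "snd b"] b by (auto simp: level_def)
        then show ?thesis using b \<open>c1 \<noteq> c2\<close> by (auto simp: level_def)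
      qed
      then show ?thesis using proj_in_image_saturated[OF saturated_open_level] by blast
    qed
    have in_U: "y = proj S b \<Longrightarrow> b \<in> pc S \<Longrightarrow> y \<in> off_drawing \<Longrightarrow> k < 4 \<Longrightarrow> snd b \<in> closed_quarter k \<Longrightarrow>
        y \<in> proj S ` level (h (vx S (fst b) k))" for y b k
      using in_level[of b k] by blast
    have vU: "v \<in> U"
      using in_U[of v "(q, corner i)" i] v vertex_off_drawing[OF assms(1)] corner_in_unit_square
      by (simp add: U_def c_def vx_def closed_quarter_def)
    obtain p m t where b: "x = proj S (p, side_point m t)" "p \<in> squares S" "m < 4" "glue S (p, m) = None" "0 \<le> t" "t \<le> 1"
      using x(2) unfolding boundary_def by auto
    have "vx S p k \<in> boundary S" if "k = m \<or> k = Suc m" for k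
      using vx_boundary_iff[OF vx_in_vertices[OF b(2)]] b that by blast
    then have zero: "h (vx S p k) = 0" if "k = m \<or> k = Suc m" for k
      using that by (intro h_0) (auto simp: interior_vertices_def)
    have "\<exists>k<4. side_point m t \<in> closed_quarter k \<and> h (vx S p k) = 0"
    proof (cases "t \<le> 1/2")
      case True
      then show ?thesis using side_point_in_closed_quarter[of m m t] b zero[of m] by auto
    next
      case False
      then show ?thesis using side_point_in_closed_quarter[of m "(m + 1) mod 4" t] b zero[of "Suc m"]
        by (intro exI[of _ "(m + 1) mod 4"]) auto
    qed
    then obtain k where k: "k < 4" "side_point m t \<in> closed_quarter k" "h (vx S p k) = 0" by blast
    have "x \<in> proj S ` level 0"
      using in_U[of x "(p, side_point m t)" k] b k K'(2) x(1) side_point_in_unit_square by auto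
    then have xV: "x \<in> V" using assms(2) by (auto simp: V_def c_def)
    have cover: "?K \<subseteq> U \<union> V"
    proof
      fix y assume y: "y \<in> ?K"
      then have yo: "y \<in> off_drawing" using K'(2) by blast
      then obtain b where b: "b \<in> pc S" "y = proj S b" unfolding topspace_surface by blast
      obtain k where k: "k < 4" "snd b \<in> closed_quarter k" using closed_quarter_cover[of "snd b"] b by auto
      have "y \<in> proj S ` level (h (vx S (fst b) k))" by (rule in_U[OF b(2,1) yo k])
      then show "y \<in> U \<union> V"
        unfolding U_def V_def by (cases "h (vx S (fst b) k) = c") auto
    qed
    have "openin (surface S) U" "openin (surface S) V"
      unfolding U_def V_def using openin_surface_image[OF saturated_open_level] by auto
    moreover have "U \<inter> V = {}" unfolding U_def V_def using disj by blast
    moreover have "v \<in> ?K"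
      using vertex_off_drawing[OF assms(1)] by (simp add: connected_component_of_refl)
    ultimately show False using K'(1) cover vU xV x(1) unfolding connectedin by blast
  qed
  then show ?thesis using vertex_off_drawing[OF assms(1)] unfolding enclosed_region_def by blast
qed

lemma enclosed_iff: "v \<in> vertices S \<Longrightarrow> v \<in> enclosed_region S C \<longleftrightarrow> h v \<noteq> 0"
  using h_nonzero_enclosed h_zero_not_enclosed by blast

lemma directed_edge_left:
  assumes "glue S (q, i) = Some (q', j)"
  shows "(q, q') \<in> directed_edges black T C \<longleftrightarrow> cycle_flow C q i = 1"
proof (cases "crosses C q i")
  case True
  have "crosses T q i \<noteq> crosses T' q i"
    using crosses_mono[OF True cycle_subset[OF C]] crosses_differing by blast
  then show ?thesis using True crosses_glue[OF assms, of C] crosses_glue[OF assms, of T]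
    by (auto simp: directed_edges_def cycle_flow_def tiling_flow_def colour_sign_def)
next
  case False
  then show ?thesis using crosses_glue[OF assms, of C] by (simp add: directed_edges_def cycle_flow_def)
qed

text \<open>All left ends have the same potential, which is \<open>1\<close> or \<open>0\<close>; they are enclosed in the first case and not in
  the second.\<close>

lemma positive_iff:
  assumes "crosses C q i"
  shows "positive_cycle S black T C \<longleftrightarrow> h (left q i) = 1"
proof -
  have lh: "h (left p k) = h (left q i)" if "crosses C p k" for p k
    using left_right_connected[OF that assms] h_off_cycle by blast
  have enc: "vx S p (Suc k) \<in> enclosed_region S C \<longleftrightarrow> h (left q i) = 1"
    if "glue S (p, k) = Some (p', l)" "cycle_flow C p k = 1" for p k p' l
  proof -
    have "crosses C p k" using that(2) unfolding cycle_flow_def by (auto split: if_splits)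
    from lh[OF this] have "h (vx S p (Suc k)) = h (left q i)" using that(2) by (simp add: left_def)
    then show ?thesis using enclosed_iff[OF vx_in_vertices[OF glueD(1)[OF that(1)]]] h_values[OF assms] by auto
  qed
  obtain p k p' l where e: "glue S (p, k) = Some (p', l)" "cycle_flow C p k = 1"
  proof -
    obtain q' j where g: "glue S (q, i) = Some (q', j)" using assms unfolding crosses_def by blast
    from cycle_flow_cases[OF C assms] show thesis
    proof
      assume "cycle_flow C q i = 1" then show thesis using that g by blast
    next
      assume "cycle_flow C q i = - 1"
      then show thesis using that[OF glueD(5)[OF g]] cycle_flow_back[OF g, of C] by simp
    qed
  qed
  show ?thesis
  proof
    assume "positive_cycle S black T C"
    then have "vx S p (Suc k) \<in> enclosed_region S C"
      using directed_edge_left[OF e(1)] e unfolding positive_cycle_def vx_def by fastforce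
    then show "h (left q i) = 1" using enc[OF e] by blast
  next
    assume "h (left q i) = 1"
    then show "positive_cycle S black T C"
      using enc directed_edge_left unfolding positive_cycle_def vx_def by fastforce
  qed
qed

lemma h_enclosed:
  assumes "v \<in> vertices S"
  shows "h v = (if v \<in> enclosed_region S C then if positive_cycle S black T C then 1 else - 1 else 0)"
proof -
  obtain q i where qi: "crosses C q i" using some_crossing by blast
  have "h v = h (left q i) \<or> h v = h (right q i)"
    using vertex_left_or_right[OF qi assms] h_off_cycle by metis
  then show ?thesis using h_values[OF qi] positive_iff[OF qi] enclosed_iff[OF assms] by auto
qed

end

context tiling_pair
begin

text \<open>The potentials of the flows along the cycles add up to the signed height, and the flows themselves to the
  flow of the pair.\<close>

theorem shows signed_height_step: "q \<in> squares S \<Longrightarrow> i < 4 \<Longrightarrow>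
      signed_height S black T T' (vx S q (Suc i)) - signed_height S black T T' (vx S q i) = tiling_flow T T' q i"
    and signed_height_boundary: "v \<in> vertices S \<Longrightarrow> v \<in> boundary S \<Longrightarrow> signed_height S black T T' v = 0"
proof -
  have ex: "\<exists>h. (\<forall>v. v \<notin> interior_vertices S \<longrightarrow> h v = 0) \<and>
     (\<forall>q\<in>squares S. \<forall>i<4. h (vx S q (Suc i)) - h (vx S q i) = cycle_flow C q i)" if "C \<in> cycles T T'" for C
    by (rule flow_is_boundary[OF cycle_flow_back cycle_flow_free sum_cycle_flow[OF that]])
  define H where "H C = (SOME h. (\<forall>v. v \<notin> interior_vertices S \<longrightarrow> h v = 0) \<and>
     (\<forall>q\<in>squares S. \<forall>i<4. h (vx S q (Suc i)) - h (vx S q i) = cycle_flow C q i))" for C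
  have H: "tiling_cycle S black T T' C (H C)" if "C \<in> cycles T T'" for C
    using someI_ex[OF ex[OF that]] that unfolding H_def[symmetric] by unfold_locales auto
  have sum: "signed_height S black T T' v = (\<Sum>C\<in>cycles T T'. H C v)" if v: "v \<in> vertices S" for v
  proof -
    have "int (card {C \<in> cycles T T'. P C}) = (\<Sum>C\<in>cycles T T'. of_bool (P C))" for P
      using finite_cycles by (simp add: sum_of_bool_eq Int_def)
    then have "signed_height S black T T' v = (\<Sum>C\<in>cycles T T'.
        of_bool (positive_cycle S black T C \<and> v \<in> enclosed_region S C) - of_bool (\<not> positive_cycle S black T C \<and> v \<in> enclosed_region S C))"
      unfolding signed_height_def by (simp only: sum_subtractf)
    also have "\<dots> = (\<Sum>C\<in>cycles T T'. H C v)"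
      using tiling_cycle.h_enclosed[OF H v] by (intro sum.cong) auto
    finally show ?thesis .
  qed
  show "signed_height S black T T' (vx S q (Suc i)) - signed_height S black T T' (vx S q i) = tiling_flow T T' q i"
    if "q \<in> squares S" "i < 4"
  proof -
    have "signed_height S black T T' (vx S q (Suc i)) - signed_height S black T T' (vx S q i) =
      (\<Sum>C\<in>cycles T T'. H C (vx S q (Suc i)) - H C (vx S q i))"
      using sum vx_in_vertices[OF that(1)] by (simp add: sum_subtractf)
    also have "\<dots> = (\<Sum>C\<in>cycles T T'. cycle_flow C q i)"
      using tiling_cycle.h_step[OF H that] by (intro sum.cong) auto
    finally show ?thesis using sum_over_cycles by simp
  qed
  show "signed_height S black T T' v = 0" if "v \<in> vertices S" "v \<in> boundary S"
    using sum[OF that(1)] tiling_cycle.h_0[OF H, of _ v] that by (simp add: interior_vertices_def)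
qed

end

context tiled_disc
begin

section \<open>Heights and flips\<close>

abbreviation height :: "'a set set \<Rightarrow> 'a set set \<Rightarrow> 'a point set \<Rightarrow> int" where
  "height \<equiv> signed_height S black"

lemma tiling_pairI: "domino_tiling S T \<Longrightarrow> domino_tiling S T' \<Longrightarrow> tiling_pair S black T T'"
  by unfold_locales

lemma height_step:
  assumes "domino_tiling S T" "domino_tiling S T'" "q \<in> squares S" "i < 4"
  shows "height T T' (vx S q (Suc i)) - height T T' (vx S q i) = tiling_flow T T' q i"
  using tiling_pair.signed_height_step[OF tiling_pairI[OF assms(1,2)] assms(3,4)] .

lemma height_boundary:
  assumes "domino_tiling S T" "domino_tiling S T'" "v \<in> vertices S" "v \<in> boundary S"
  shows "height T T' v = 0"
  using tiling_pair.signed_height_boundary[OF tiling_pairI[OF assms(1,2)] assms(3,4)] .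

text \<open>The difference is constant along sides, and there is a boundary vertex where it vanishes.\<close>

lemma height_unique:
  assumes "\<And>q i. q \<in> squares S \<Longrightarrow> i < 4 \<Longrightarrow> f (vx S q (Suc i)) - f (vx S q i) = g (vx S q (Suc i)) - g (vx S q i)"
    and "\<And>v. v \<in> vertices S \<Longrightarrow> v \<in> boundary S \<Longrightarrow> f v = (g v :: int)"
    and "v \<in> vertices S"
  shows "f v = g v"
proof -
  obtain q i where "q \<in> squares S" using assms(3) unfolding vertices_alt by blast
  then obtain u where u: "u \<in> vertices S" "u \<in> boundary S" using boundary_vertex_exists by blast
  show ?thesis
  proof (rule vertices_connected[of "\<lambda>v. f v = g v", OF _ u(1) _ assms(3)])
    show "f u = g u" using assms(2) u by blast
    show "(f (vx S q (Suc i)) = g (vx S q (Suc i))) = (f (vx S q i) = g (vx S q i))"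
      if "q \<in> squares S" "i < 4" for q i using assms(1)[OF that] by auto
  qed
qed

lemma height_add:
  assumes "domino_tiling S T1" "domino_tiling S T2" "domino_tiling S T3" "v \<in> vertices S"
  shows "height T1 T3 v = height T1 T2 v + height T2 T3 v"
proof (rule height_unique[OF _ _ assms(4)])
  fix q i assume "q \<in> squares S" "i < (4::nat)"
  note st = height_step[OF assms(1,3) this] height_step[OF assms(1,2) this] height_step[OF assms(2,3) this]
  have "tiling_flow T1 T3 q i = tiling_flow T1 T2 q i + tiling_flow T2 T3 q i"
    by (simp add: tiling_flow_def algebra_simps)
  then show "height T1 T3 (vx S q (Suc i)) - height T1 T3 (vx S q i) =
    height T1 T2 (vx S q (Suc i)) + height T2 T3 (vx S q (Suc i)) - (height T1 T2 (vx S q i) + height T2 T3 (vx S q i))"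
    using st by linarith
qed (simp add: height_boundary assms)

lemma height_self: "domino_tiling S T \<Longrightarrow> v \<in> vertices S \<Longrightarrow> height T T v = 0"
  using height_add[of T T T v] by simp

lemma height_swap: "domino_tiling S T \<Longrightarrow> domino_tiling S T' \<Longrightarrow> v \<in> vertices S \<Longrightarrow> height T' T v = - height T T' v"
  using height_add[of T T' T v] height_self[of T v] by simp

definition total_height :: "'a set set \<Rightarrow> 'a set set \<Rightarrow> nat" where
  "total_height T T' = nat (\<Sum>v\<in>interior_vertices S. \<bar>height T T' v\<bar>)"

lemma finite_interior: "finite (interior_vertices S)"
  using finite_vertices by (simp add: interior_vertices_def)

lemma int_total_height: "int (total_height T T') = (\<Sum>v\<in>interior_vertices S. \<bar>height T T' v\<bar>)"
  by (simp add: total_height_def sum_nonneg)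

lemma interior_in_vertices: "v \<in> interior_vertices S \<Longrightarrow> v \<in> vertices S"
  by (simp add: interior_vertices_def)

lemma total_height_swap:
  assumes "domino_tiling S T" "domino_tiling S T'"
  shows "total_height T' T = total_height T T'"
proof -
  have "\<bar>height T' T v\<bar> = \<bar>height T T' v\<bar>" if "v \<in> interior_vertices S" for v
    using height_swap[OF assms interior_in_vertices[OF that]] by simp
  then show ?thesis by (simp add: total_height_def)
qed

lemma total_height_triangle:
  assumes "domino_tiling S T1" "domino_tiling S T2" "domino_tiling S T3"
  shows "total_height T1 T3 \<le> total_height T1 T2 + total_height T2 T3"
proof -
  have "int (total_height T1 T3) \<le> (\<Sum>v\<in>interior_vertices S. \<bar>height T1 T2 v\<bar> + \<bar>height T2 T3 v\<bar>)"
    unfolding int_total_height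
  proof (rule sum_mono)
    fix v assume "v \<in> interior_vertices S"
    from height_add[OF assms interior_in_vertices[OF this]]
    show "\<bar>height T1 T3 v\<bar> \<le> \<bar>height T1 T2 v\<bar> + \<bar>height T2 T3 v\<bar>" by simp
  qed
  then show ?thesis by (simp add: sum.distrib flip: int_total_height)
qed

lemma total_height_self: "domino_tiling S T \<Longrightarrow> total_height T T = 0"
  using height_self interior_in_vertices by (simp add: total_height_def)

lemma total_height_0:
  assumes "domino_tiling S T" "domino_tiling S T'" "total_height T T' = 0"
  shows "T = T'"
proof -
  have "(\<Sum>v\<in>interior_vertices S. \<bar>height T T' v\<bar>) = 0" using int_total_height[of T T'] assms(3) by simp
  then have int0: "height T T' v = 0" if "v \<in> interior_vertices S" for v
    using that finite_interior by (simp add: sum_nonneg_eq_0_iff)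
  have zero: "height T T' v = 0" if "v \<in> vertices S" for v
    using int0[of v] height_boundary[OF assms(1,2) that] that by (auto simp: interior_vertices_def)
  have cr: "crosses T q i \<longleftrightarrow> crosses T' q i" if "q \<in> squares S" "i < 4" for q i
    using height_step[OF assms(1,2) that] zero[OF vx_in_vertices[OF that(1)]]
    by (auto simp: tiling_flow_def colour_sign_def split: if_splits)
  have "e \<in> A \<Longrightarrow> e \<in> B" if AB: "domino_tiling S A" "\<And>q i. q \<in> squares S \<Longrightarrow> i < 4 \<Longrightarrow> crosses A q i \<longleftrightarrow> crosses B q i" for A B e
  proof -
    assume e: "e \<in> A"
    then have "e \<in> dual_edges S" using AB(1) unfolding domino_tiling_def by blast
    then obtain q q' i j where q: "e = {q, q'}" "glue S (q, i) = Some (q', j)" unfolding dual_edges_def by blast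
    have "crosses A q i" using crosses_glue[OF q(2)] e q(1) by blast
    then have "crosses B q i" using AB(2) glueD(1,2)[OF q(2)] by blast
    then show "e \<in> B" using crosses_glue[OF q(2)] q(1) by blast
  qed
  from this[OF assms(1)] this[OF assms(2)] cr show ?thesis by blast
qed

lemma edge_eq_iff:
  assumes "glue S (q, m) = Some (q', n)" "glue S (a, x) = Some (b, y)"
  shows "{q, q'} = {a, b} \<longleftrightarrow> (q, m) = (a, x) \<or> (q, m) = (b, y)"
proof
  assume "{q, q'} = {a, b}"
  then consider "q = a" "q' = b" | "q = b" "q' = a" by (auto simp: doubleton_eq_iff)
  then show "(q, m) = (a, x) \<or> (q, m) = (b, y)"
  proof cases
    case 1 then show ?thesis using neighbour_side_unique assms by blast
  next
    case 2 then show ?thesis using neighbour_side_unique[OF assms(1)] glueD(5)[OF assms(2)] by blast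
  qed
next
  assume "(q, m) = (a, x) \<or> (q, m) = (b, y)"
  then show "{q, q'} = {a, b}" using assms glueD(5)[OF assms(2)] by auto
qed

text \<open>A flip moves the two dominoes of a 2-by-2 square to the other pair of opposite positions, so the
  flow of the pair circulates once around its midpoint. The circulation is counterclockwise or clockwise depending
  on the colour of \<open>a\<close>.\<close>

lemma flip_around:
  assumes T: "domino_tiling S T" and g: "turn a i b j" "turn b j c k"
    "turn c k d l" "turn d l a i"
    and ab: "{a, b} \<in> T" "{c, d} \<in> T" and T2: "T2 = T - {{a, b}, {c, d}} \<union> {{b, c}, {d, a}}"
  shows "domino_tiling S T2"
    and "v \<in> vertices S \<Longrightarrow> height T T2 v = (if v = vx S a i then colour_sign a else 0)"
proof -
  have "distinct [a, b, c, d]" by (rule around_distinct[OF g])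
  then have dist: "a \<noteq> b" "a \<noteq> c" "a \<noteq> d" "b \<noteq> c" "b \<noteq> d" "c \<noteq> d" by auto
  have T_dual: "T \<subseteq> dual_edges S" and T_ex: "\<And>q. q \<in> squares S \<Longrightarrow> \<exists>!e. e \<in> T \<and> q \<in> e"
    using T unfolding domino_tiling_def by blast+
  have sq: "a \<in> squares S" "b \<in> squares S" "c \<in> squares S" "d \<in> squares S" using glueD(3) g by blast+
  have un: "e = f" if "e \<in> T" "q \<in> e" "f \<in> T" "q \<in> f" "q \<in> squares S" for e f q
    using T_ex[OF that(5)] that by blast
  have at: "e \<in> T \<Longrightarrow> a \<in> e \<or> b \<in> e \<Longrightarrow> e = {a, b}" "e \<in> T \<Longrightarrow> c \<in> e \<or> d \<in> e \<Longrightarrow> e = {c, d}" for e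
    using un[of e _ "{a, b}"] un[of e _ "{c, d}"] ab sq by blast+
  show tT2: "domino_tiling S T2"
    unfolding domino_tiling_def
  proof (intro conjI ballI)
    have "{b, c} \<in> dual_edges S" "{d, a} \<in> dual_edges S"
      unfolding dual_edges_def using g(2,4) dist by blast+
    then show "T2 \<subseteq> dual_edges S" using T_dual T2 by blast
    fix q assume q: "q \<in> squares S"
    consider "q = b \<or> q = c" | "q = d \<or> q = a" | "q \<notin> {a, b, c, d}" by blast
    then show "\<exists>!e. e \<in> T2 \<and> q \<in> e"
    proof cases
      case 1
      show ?thesis
      proof (rule ex1I[of _ "{b, c}"])
        show "{b, c} \<in> T2 \<and> q \<in> {b, c}" using 1 T2 by blast
        show "e = {b, c}" if e: "e \<in> T2 \<and> q \<in> e" for e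
        proof -
          have "e = {b, c} \<or> e = {d, a} \<or> e \<in> T \<and> e \<noteq> {a, b} \<and> e \<noteq> {c, d}" using e unfolding T2 by blast
          then show ?thesis
          proof (elim disjE conjE)
            assume "e = {d, a}" then show ?thesis using e 1 dist by auto
          next
            assume "e \<in> T" "e \<noteq> {a, b}" "e \<noteq> {c, d}"
            then have "a \<notin> e" "b \<notin> e" "c \<notin> e" "d \<notin> e" using at[of e] by auto
            then show ?thesis using e 1 by auto
          qed
        qed
      qed
    next
      case 2
      show ?thesis
      proof (rule ex1I[of _ "{d, a}"])
        show "{d, a} \<in> T2 \<and> q \<in> {d, a}" using 2 T2 by blast
        show "e = {d, a}" if e: "e \<in> T2 \<and> q \<in> e" for e
        proof -
          have "e = {d, a} \<or> e = {b, c} \<or> e \<in> T \<and> e \<noteq> {a, b} \<and> e \<noteq> {c, d}" using e unfolding T2 by blast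
          then show ?thesis
          proof (elim disjE conjE)
            assume "e = {b, c}" then show ?thesis using e 2 dist by auto
          next
            assume "e \<in> T" "e \<noteq> {a, b}" "e \<noteq> {c, d}"
            then have "a \<notin> e" "b \<notin> e" "c \<notin> e" "d \<notin> e" using at[of e] by auto
            then show ?thesis using e 2 by auto
          qed
        qed
      qed
    next
      case 3
      then have "e \<in> T2 \<and> q \<in> e \<longleftrightarrow> e \<in> T \<and> q \<in> e" for e unfolding T2 by auto
      then show ?thesis using T_ex[OF q] by simp
    qed
  qed
  have new: "{b, c} \<notin> T" "{d, a} \<notin> T" using at[of "{b, c}"] at[of "{d, a}"] dist by (auto simp: doubleton_eq_iff)
  have T2_mem: "(of_bool (e \<in> T) - of_bool (e \<in> T2) :: int) =
      of_bool (e = {a, b}) + of_bool (e = {c, d}) - of_bool (e = {b, c}) - of_bool (e = {d, a})" for e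
  proof -
    have ne: "{a, b} \<noteq> {c, d}" "{b, c} \<noteq> {d, a}" using dist by (auto simp: doubleton_eq_iff)
    have T2': "f \<in> T2 \<longleftrightarrow> f \<in> T \<and> f \<noteq> {a, b} \<and> f \<noteq> {c, d} \<or> f = {b, c} \<or> f = {d, a}" for f
      unfolding T2 by blast
    have "(of_bool (e \<in> T) - of_bool (e \<in> T \<and> e \<noteq> P \<and> e \<noteq> Q \<or> e = R \<or> e = U) :: int) =
        of_bool (e = P) + of_bool (e = Q) - of_bool (e = R) - of_bool (e = U)"
      if "P \<in> T" "Q \<in> T" "R \<notin> T" "U \<notin> T" "P \<noteq> Q" "R \<noteq> U" for P Q R U using that by auto
    from this[OF ab new ne] show ?thesis unfolding T2' .
  qed
  have col: "colour_sign b = - colour_sign a" "colour_sign c = colour_sign a" "colour_sign d = - colour_sign a"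
    using colour_sign_glue[OF g(1)] colour_sign_glue[OF g(2)] colour_sign_glue[OF g(3)] by simp_all
  have unit: "unit_flow p x (q, m) = of_bool ((q, m) = (p, x)) - of_bool ((q, m) = (r, y))"
    if "glue S (p, x) = Some (r, y)" for p x r y q m
    using that by (auto simp: unit_flow_def)
  have flow: "tiling_flow T T2 q m = colour_sign a * (unit_flow a ((i + 3) mod 4) (q, m) + unit_flow b ((j + 3) mod 4) (q, m) +
    unit_flow c ((k + 3) mod 4) (q, m) + unit_flow d ((l + 3) mod 4) (q, m))" for q m
  proof (cases "glue S (q, m)")
    case None
    have ne: "(q, m) \<noteq> s" if "glue S s = Some t" for s t using None that by auto
    have "unit_flow p x (q, m) = 0" if g': "glue S (p, x) = Some (r, y)" for p x r y
      unfolding unit[OF g'] using ne[OF g'] ne[OF glueD(5)[OF g']] by (simp del: prod.inject)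
    from this[OF g(1)] this[OF g(2)] this[OF g(3)] this[OF g(4)]
    show ?thesis using tiling_flow_free[OF None] by simp
  next
    case (Some t)
    obtain q' n where "t = (q', n)" by (cases t)
    note qm = Some[unfolded this]
    have edge: "of_bool ({q, q'} = {p, r}) = (of_bool ((q, m) = (p, x)) + of_bool ((q, m) = (r, y)) :: int)"
      if "glue S (p, x) = Some (r, y)" for p x r y
      using edge_eq_iff[OF qm that] glue_neq[OF that] by auto
    have sgn: "colour_sign q * of_bool ((q, m) = (p, x)) = colour_sign p * of_bool ((q, m) = (p, x))" for p x
      by auto
    have "tiling_flow T T2 q m = colour_sign q * (of_bool ({q, q'} \<in> T) - of_bool ({q, q'} \<in> T2))"
      by (simp add: tiling_flow_def crosses_glue[OF qm])
    also have "\<dots> = colour_sign q * of_bool ((q, m) = (a, (i + 3) mod 4)) + colour_sign q * of_bool ((q, m) = (b, j)) +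
        (colour_sign q * of_bool ((q, m) = (c, (k + 3) mod 4)) + colour_sign q * of_bool ((q, m) = (d, l))) -
        (colour_sign q * of_bool ((q, m) = (b, (j + 3) mod 4)) + colour_sign q * of_bool ((q, m) = (c, k))) -
        (colour_sign q * of_bool ((q, m) = (d, (l + 3) mod 4)) + colour_sign q * of_bool ((q, m) = (a, i)))"
      unfolding T2_mem edge[OF g(1)] edge[OF g(2)] edge[OF g(3)] edge[OF g(4)] by (simp only: algebra_simps)
    also have "\<dots> = colour_sign a * (unit_flow a ((i + 3) mod 4) (q, m) + unit_flow b ((j + 3) mod 4) (q, m) +
        unit_flow c ((k + 3) mod 4) (q, m) + unit_flow d ((l + 3) mod 4) (q, m))"
      unfolding sgn col unit[OF g(1)] unit[OF g(2)] unit[OF g(3)] unit[OF g(4)] by (simp only: algebra_simps)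
    finally show ?thesis .
  qed
  show "height T T2 v = (if v = vx S a i then colour_sign a else 0)" if "v \<in> vertices S"
  proof (rule height_unique[OF _ _ that])
    fix q m assume q: "q \<in> squares S" "m < (4::nat)"
    have "tiling_flow T T2 q m = colour_sign a * ((if vx S q (Suc m) = vx S a i then 1 else 0) - (if vx S q m = vx S a i then 1 else 0))"
      unfolding flow vertex_indicator_step[OF g q] ..
    then show "height T T2 (vx S q (Suc m)) - height T T2 (vx S q m) =
      (if vx S q (Suc m) = vx S a i then colour_sign a else 0) - (if vx S q m = vx S a i then colour_sign a else 0)"
      using height_step[OF T tT2 q] by auto
  next
    fix v assume "v \<in> vertices S" "v \<in> boundary S"
    moreover have "vx S a i \<notin> boundary S" using around_interior(1)[OF g] by (simp add: interior_vertices_def)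
    ultimately show "height T T2 v = (if v = vx S a i then colour_sign a else 0)"
      using height_boundary[OF T tT2] by auto
  qed
qed

lemma total_height_flip:
  assumes "domino_tiling S T" "flip S T T2"
  shows "total_height T T2 = 1"
proof -
  obtain a b c d i j k l where g: "turn a i b j" "turn b j c k"
    "turn c k d l" "turn d l a i"
    and ab: "{a, b} \<in> T" "{c, d} \<in> T" and T2: "T2 = T - {{a, b}, {c, d}} \<union> {{b, c}, {d, a}}"
    using assms(2) unfolding flip_def two_by_two_def by blast
  have "int (total_height T T2) = (\<Sum>v\<in>interior_vertices S. if v = vx S a i then 1 else 0)"
    unfolding int_total_height
  proof (rule sum.cong[OF refl])
    fix v assume "v \<in> interior_vertices S"
    from flip_around(2)[OF assms(1) g ab T2 interior_in_vertices[OF this]]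
    show "\<bar>height T T2 v\<bar> = (if v = vx S a i then 1 else 0)" by (simp add: colour_sign_def)
  qed
  also have "\<dots> = 1" using finite_interior around_interior(1)[OF g] by simp
  finally show ?thesis by simp
qed

text \<open>The maximum is taken with respect to the height function \<open>h\<close> of the first tiling alone, among the vertices
  where the first tiling is above the second. From there \<open>h\<close> cannot rise to another such vertex, and this forces
  the position of the dominoes around it.\<close>

lemma flip_towards:
  assumes T: "domino_tiling S T" "domino_tiling S T'" and pos: "v0 \<in> vertices S" "height T T' v0 > 0"
  shows "\<exists>T2. domino_tiling S T2 \<and> flip S T T2 \<and> Suc (total_height T2 T') = total_height T T'"
proof -
  \<comment> \<open>Every square has one side with a domino and three without, so these increments sum to zero.\<close>
  define \<eta> where "\<eta> q i = colour_sign q * (4 * of_bool (crosses T q i) - 1)" for q i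
  have "\<exists>h. \<forall>q\<in>squares S. \<forall>i<4. h (vx S q (Suc i)) - h (vx S q i) = \<eta> q i"
  proof (rule vertex_potential)
    show "\<eta> q' j = - \<eta> q i" if "glue S (q, i) = Some (q', j)" for q i q' j
      using crosses_back[OF that] colour_sign_glue[OF that] by (simp add: \<eta>_def)
    show "(\<Sum>i<4. \<eta> q i) = 0" if "q \<in> squares S" for q
    proof -
      have "(\<Sum>i<4. \<eta> q i) = colour_sign q * (4 * (\<Sum>i<4. of_bool (crosses T q i)) - (\<Sum>i<(4::nat). 1))"
        unfolding \<eta>_def by (simp only: sum_distrib_left sum_subtractf right_diff_distrib mult_1_right)
      then show ?thesis unfolding sum_crosses[OF T(1) that] by simp
    qed
  qed
  then obtain h where h: "\<And>q i. q \<in> squares S \<Longrightarrow> i < 4 \<Longrightarrow> h (vx S q (Suc i)) - h (vx S q i) = \<eta> q i" by blast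
  define P where "P = {v \<in> vertices S. height T T' v > 0}"
  have P: "finite P" "P \<noteq> {}" using finite_vertices pos by (auto simp: P_def)
  have "Max (h ` P) \<in> h ` P" using P by (intro Max_in) simp_all
  then obtain v where v: "v \<in> P" "h v = Max (h ` P)" by auto
  have max: "h w \<le> h v" if "w \<in> P" for w unfolding v(2) using P that by (intro Max_ge) simp_all
  have vv: "v \<in> vertices S" "height T T' v > 0" using v(1) by (simp_all add: P_def)
  then have vi: "v \<in> interior_vertices S" using height_boundary[OF T, of v] by (auto simp: interior_vertices_def)
  \<comment> \<open>Side \<open>m\<close> of a white square at \<open>v\<close> leaves \<open>v\<close> with this square on its left. Without a domino of \<open>T\<close> across it,
    \<open>h\<close> would rise along it, and the signed height would not fall.\<close>
  have white: "crosses T q m" if "(q, m) \<in> corners_at S v" "\<not> black q" for q m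
  proof (rule ccontr)
    assume "\<not> crosses T q m"
    have q: "q \<in> squares S" "m < 4" "vx S q m = v" using that(1) by (auto simp: in_corners_at)
    have "h (vx S q (Suc m)) = h v + 1" using h[OF q(1,2)] q(3) \<open>\<not> crosses T q m\<close> that(2) by (simp add: \<eta>_def colour_sign_def)
    moreover have "height T T' (vx S q (Suc m)) \<ge> height T T' v"
      using height_step[OF T q(1,2)] q(3) \<open>\<not> crosses T q m\<close> that(2)
      by (cases "crosses T' q m") (simp_all add: tiling_flow_def colour_sign_def)
    then have "vx S q (Suc m) \<in> P" using vv(2) vx_in_vertices[OF q(1)] by (simp add: P_def)
    ultimately show False using max by fastforce
  qed
  have "\<exists>a i. (a, i) \<in> corners_at S v \<and> black a"
  proof -
    obtain q m where qm: "(q, m) \<in> corners_at S v" using vv(1) unfolding vertices_alt in_corners_at[of _ _ v] by auto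
    show ?thesis
    proof (cases "black q")
      case True then show ?thesis using qm by blast
    next
      case False
      obtain b j where "turn q m b j" "(b, j) \<in> corners_at S v"
        using interior_vertex_next[OF vi qm] .
      then show ?thesis using glue_color False by blast
    qed
  qed
  then obtain a i where ai: "(a, i) \<in> corners_at S v" "black a" by blast
  obtain b j c k d l where g:
    "turn a i b j" "turn b j c k"
    "turn c k d l" "turn d l a i"
    and all: "corners_at S v = {(a, i), (b, j), (c, k), (d, l)}"
    using interior_vertex_cycle[OF vi ai(1)] .
  have cols: "\<not> black b" "black c" "\<not> black d"
    using glue_color[OF g(1)] glue_color[OF g(2)] glue_color[OF g(3)] ai(2) by auto
  have "crosses T b j" "crosses T d l" using white all cols by auto
  then have ab: "{a, b} \<in> T" "{c, d} \<in> T"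
    using crosses_back[OF g(1), of T] crosses_glue[OF g(1), of T] crosses_back[OF g(3), of T] crosses_glue[OF g(3), of T] by auto
  define T2 where "T2 = T - {{a, b}, {c, d}} \<union> {{b, c}, {d, a}}"
  have vai: "vx S a i = v" using ai(1) by (simp add: in_corners_at)
  note fl = flip_around[OF T(1) g ab T2_def, unfolded vai]
  have "flip S T T2" unfolding flip_def two_by_two_def using g ab T2_def by blast
  moreover have "int (total_height T T') = (\<Sum>w\<in>interior_vertices S. \<bar>height T2 T' w\<bar> + (if w = v then 1 else 0))"
    unfolding int_total_height
  proof (rule sum.cong[OF refl])
    fix w assume w: "w \<in> interior_vertices S"
    have "height T T' w = (if w = v then 1 else 0) + height T2 T' w"
      using height_add[OF T(1) fl(1) T(2) interior_in_vertices[OF w]] fl(2)[OF interior_in_vertices[OF w]] ai(2)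
      by (simp add: colour_sign_def)
    then show "\<bar>height T T' w\<bar> = \<bar>height T2 T' w\<bar> + (if w = v then 1 else 0)" using vv(2) by auto
  qed
  then have "int (total_height T T') = int (total_height T2 T') + 1"
    using finite_interior vi by (simp add: sum.distrib flip: int_total_height)
  ultimately show ?thesis using fl(1) by (intro exI[of _ T2]) simp
qed

sublocale flips: wf_digraph "with_proj (flip_graph S)"
  by unfold_locales (auto simp: flip_graph_def)

text \<open>If the signed height is positive somewhere, the first tiling is flipped, and if it is negative somewhere, the
  second one.\<close>

lemma walk_exists:
  assumes "domino_tiling S T" "domino_tiling S T'"
  shows "\<exists>p. flips.awalk T p T' \<and> length p = total_height T T'"
  using assms
proof (induction n \<equiv> "total_height T T'" arbitrary: T T')
  case 0
  then have "T = T'" using total_height_0 by simp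
  moreover have "T \<in> pverts (flip_graph S)" using 0 by (simp add: flip_graph_def)
  ultimately have "flips.awalk T [] T'" by (simp add: flips.awalk_Nil_iff)
  then show ?case using 0 by (intro exI[of _ "[]"]) simp
next
  case (Suc n)
  have "(\<Sum>v\<in>interior_vertices S. \<bar>height T T' v\<bar>) \<noteq> 0" using int_total_height[of T T'] Suc.hyps(2) by simp
  then obtain v where v: "v \<in> interior_vertices S" "height T T' v \<noteq> 0" by (metis abs_eq_0 sum.neutral)
  note vv = interior_in_vertices[OF v(1)]
  show ?case
  proof (cases "height T T' v > 0")
    case True
    from flip_towards[OF Suc.prems vv True] obtain T2 where
      T2: "domino_tiling S T2" "flip S T T2" "Suc (total_height T2 T') = total_height T T'" by blast
    then have "n = total_height T2 T'" using Suc.hyps(2) by simp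
    from Suc.hyps(1)[OF this T2(1) Suc.prems(2)] obtain p where
      p: "flips.awalk T2 p T'" "length p = total_height T2 T'" by blast
    have "(T, T2) \<in> parcs (flip_graph S)" using T2 Suc.prems(1) by (simp add: flip_graph_def)
    then have "flips.awalk T ((T, T2) # p) T'" using p(1) by (simp add: flips.awalk_Cons_iff)
    then show ?thesis using p(2) T2(3) by (intro exI[of _ "(T, T2) # p"]) simp
  next
    case False
    then have "height T' T v > 0" using height_swap[OF Suc.prems vv] v(2) by simp
    from flip_towards[OF Suc.prems(2,1) vv this] obtain T2 where
      T2: "domino_tiling S T2" "flip S T' T2" "Suc (total_height T2 T) = total_height T' T" by blast
    have s: "total_height T2 T = total_height T T2" "total_height T' T = total_height T T'"
      using total_height_swap Suc.prems T2(1) by blast+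
    then have "n = total_height T T2" using T2(3) Suc.hyps(2) by simp
    from Suc.hyps(1)[OF this Suc.prems(1) T2(1)] obtain p where
      p: "flips.awalk T p T2" "length p = total_height T T2" by blast
    have "(T2, T') \<in> parcs (flip_graph S)" using T2 Suc.prems(2) by (simp add: flip_graph_def)
    moreover have "T' \<in> pverts (flip_graph S)" using Suc.prems(2) by (simp add: flip_graph_def)
    ultimately have "flips.awalk T2 [(T2, T')] T'" by (simp add: flips.awalk_Cons_iff flips.awalk_Nil_iff)
    with p(1) have "flips.awalk T (p @ [(T2, T')]) T'" by (rule flips.awalk_appendI)
    then show ?thesis using p(2) T2(3) s by (intro exI[of _ "p @ [(T2, T')]"]) simp
  qed
qed

lemma total_height_le_walk:
  "flips.awalk T p T' \<Longrightarrow> domino_tiling S T' \<Longrightarrow> total_height T T' \<le> length p"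
proof (induction p arbitrary: T)
  case Nil
  then show ?case by (auto simp: flips.awalk_Nil_iff total_height_self)
next
  case (Cons e p)
  have e: "e \<in> parcs (flip_graph S)" "T = fst e" "flips.awalk (snd e) p T'"
    using Cons.prems(1) by (simp_all add: flips.awalk_Cons_iff)
  then have t: "domino_tiling S T" "domino_tiling S (snd e)" "flip S T (snd e) \<or> flip S (snd e) T"
    by (auto simp: flip_graph_def)
  have "total_height T (snd e) = 1"
    using t total_height_flip[of T "snd e"] total_height_flip[of "snd e" T] total_height_swap[OF t(1,2)] by auto
  then show ?case
    using total_height_triangle[OF t(1,2) Cons.prems(2)] Cons.IH[OF e(3) Cons.prems(2)] by simp
qed

theorem flip_distance_eq:
  assumes "domino_tiling S T" "domino_tiling S T'"
  shows "flip_distance S T T' = ereal (real (total_height T T'))"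
  unfolding flip_distance_def flips.\<mu>_def
proof (rule antisym)
  have cost: "flips.awalk_cost (\<lambda>_. 1) p = real (length p)" for p :: "('a set set \<times> 'a set set) list"
    by (induction p) (simp_all add: flips.awalk_cost_Nil flips.awalk_cost_Cons)
  obtain p where "flips.awalk T p T'" "length p = total_height T T'" using walk_exists[OF assms] by blast
  then show "(INF p\<in>{p. flips.awalk T p T'}. ereal (flips.awalk_cost (\<lambda>_. 1) p)) \<le> ereal (real (total_height T T'))"
    by (intro INF_lower2[of p]) (simp_all add: cost)
  show "ereal (real (total_height T T')) \<le> (INF p\<in>{p. flips.awalk T p T'}. ereal (flips.awalk_cost (\<lambda>_. 1) p))"
    using total_height_le_walk[OF _ assms(2)] by (intro INF_greatest) (simp add: cost)
qed

section \<open>Volume\<close>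

text \<open>The four open quarters into which the center lines cut the unit square.\<close>

definition subsquare :: "nat \<Rightarrow> (real \<times> real) set" where
  "subsquare i = {p. fst (corner i) / 2 < fst p \<and> fst p < fst (corner i) / 2 + 1/2 \<and>
     snd (corner i) / 2 < snd p \<and> snd p < snd (corner i) / 2 + 1/2}"

text \<open>Up to a null set, the set is a union of four disjoint boxes with base area \<open>1/4\<close>.\<close>

lemma quarter_volume:
  fixes lo hi :: "nat \<Rightarrow> real"
  assumes le: "\<And>i. i < 4 \<Longrightarrow> lo i \<le> hi i" and Z: "finite Z"
    and A: "\<And>x y z. x \<notin> {0, 1/2, 1} \<Longrightarrow> y \<notin> {0, 1/2, 1} \<Longrightarrow> z \<notin> Z \<Longrightarrow>
      (x, y, z) \<in> A \<longleftrightarrow> (\<exists>i<4. (x, y) \<in> subsquare i \<and> lo i < z \<and> z < hi i)"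
  shows "measure lebesgue A = (\<Sum>i<4. (hi i - lo i) / 4)"
proof -
  define lx where "lx i = fst (corner i) / 2" for i
  define ly where "ly i = snd (corner i) / 2" for i
  define B where "B i = box (lx i, ly i, lo i) (lx i + 1/2, ly i + 1/2, hi i)" for i
  have memB: "(x, y, z) \<in> B i \<longleftrightarrow> lx i < x \<and> x < lx i + 1/2 \<and> ly i < y \<and> y < ly i + 1/2 \<and> lo i < z \<and> z < hi i" for x y z i
    by (auto simp: B_def mem_box Basis_prod_def)
  have memb: "(x, y) \<in> subsquare i \<longleftrightarrow>
    lx i < x \<and> x < lx i + 1/2 \<and> ly i < y \<and> y < ly i + 1/2" for x y i
    by (simp add: lx_def ly_def subsquare_def)
  have measB: "measure lebesgue (B i) = (hi i - lo i) / 4" if "i < 4" for i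
  proof -
    have "measure lebesgue (B i) = measure lborel (B i)" by (simp add: B_def)
    also have "\<dots> = measure lborel (cbox (lx i, ly i, lo i) (lx i + 1/2, ly i + 1/2, hi i))"
      unfolding B_def measure_lborel_box_eq measure_lborel_cbox_eq ..
    also have "\<dots> = (1/2) * ((1/2) * (hi i - lo i))"
      using le[OF that] by (simp add: content_Pair)
    finally show ?thesis by simp
  qed
  have lm: "B i \<in> lmeasurable" for i by (simp add: B_def)
  have disj: "disjoint_family_on B {..<4}"
    unfolding disjoint_family_on_def
  proof (intro ballI impI)
    fix i k :: nat assume "i \<in> {..<4}" "k \<in> {..<4}" "i \<noteq> k"
    then have "\<not> ((x, y, z) \<in> B i \<and> (x, y, z) \<in> B k)" for x y z
      unfolding memB lx_def ly_def lessThan_iff less_4_cases by (elim disjE) auto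
    then show "B i \<inter> B k = {}" by auto
  qed
  define U where "U = (\<Union>i<4. B i)"
  have mU: "measure lebesgue U = (\<Sum>i<4. (hi i - lo i) / 4)"
  proof -
    have "measure lebesgue U = (\<Sum>i<4. measure lebesgue (B i))"
      unfolding U_def
      by (rule measure_finite_Union) (use fmeasurableD[OF lm] fmeasurableD2[OF lm] disj in auto)
    then show ?thesis using measB by simp
  qed
  have U: "U \<in> lmeasurable" unfolding U_def using lm by (intro fmeasurable.finite_UN) auto
  \<comment> \<open>The planes on which the description of \<open>A\<close> may fail.\<close>
  define N where "N = (\<Union>c\<in>{0, 1/2, 1}. {p. p \<bullet> (1::real, 0::real, 0::real) = c}) \<union> (\<Union>c\<in>{0, 1/2, 1}. {p. p \<bullet> (0, 1, 0) = c}) \<union>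
    (\<Union>c\<in>Z. {p. p \<bullet> (0, 0, 1) = c})"
  have neg: "negligible (\<Union>c\<in>F. {p. p \<bullet> b = c})" if "finite F" "b \<in> Basis" for F and b :: "real \<times> real \<times> real"
  proof (rule negligible_Union)
    show "finite ((\<lambda>c. {p. p \<bullet> b = c}) ` F)" using that(1) by simp
    show "negligible t" if "t \<in> (\<lambda>c. {p. p \<bullet> b = c}) ` F" for t
      using that negligible_standard_hyperplane[OF \<open>b \<in> Basis\<close>] by blast
  qed
  have "negligible N"
    unfolding N_def
    by (intro negligible_Un neg Z; simp add: Basis_prod_def zero_prod_def)
  moreover have "(U - A) \<union> (A - U) \<subseteq> N"
  proof
    fix p assume p: "p \<in> (U - A) \<union> (A - U)"
    obtain x y z where xyz: "p = (x, y, z)" by (cases p)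
    show "p \<in> N"
    proof (rule ccontr)
      assume "p \<notin> N"
      then have n: "x \<notin> {0, 1/2, 1}" "y \<notin> {0, 1/2, 1}" "z \<notin> Z" unfolding xyz N_def by auto
      have "(x, y, z) \<in> A \<longleftrightarrow> (x, y, z) \<in> U" unfolding A[OF n] U_def memb using memB by auto
      then show False using p xyz by auto
    qed
  qed
  ultimately have "negligible ((U - A) \<union> (A - U))" by (rule negligible_subset)
  from measure_negligible_symdiff[OF U this] mU show ?thesis by simp
qed

lemma in_cell_iff:
  assumes "x \<notin> {0, 1/2, 1}" "y \<notin> {0, 1/2, 1}" "(x, y) \<in> unit_square" "q \<in> squares S"
  shows "proj S (q, x, y) \<in> cell S v \<longleftrightarrow>
    (\<exists>i<4. vx S q i = v \<and> (x, y) \<in> subsquare i)"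
proof -
  have int: "0 < x" "x < 1" "0 < y" "y < 1" using assms by (auto simp: unit_square_def order.order_iff_strict)
  have sing: "proj S (q, x, y) = {(q, x, y)}" using proj_interior[of "(x, y)" q] int by simp
  have inj: "proj S (q, x, y) = proj S (q', x', y') \<longleftrightarrow> (q', x', y') = (q, x, y)" for q' x' y'
    using sing proj_self[of "(q', x', y')"] by (metis singletonD)
  have box: "\<bar>x - fst (corner i)\<bar> \<le> 1/2 \<and> \<bar>y - snd (corner i)\<bar> \<le> 1/2 \<longleftrightarrow>
    (x, y) \<in> subsquare i" if "i < 4" for i
    using that assms(1,2) int unfolding less_4_cases
    by (elim disjE) (auto simp: subsquare_def abs_if split: if_splits)
  have "proj S (q, x, y) \<in> cell S v \<longleftrightarrow> (\<exists>q' i x' y'. proj S (q, x, y) = proj S (q', x', y') \<and> (q', i) \<in> corners_at S v \<and>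
     (x', y') \<in> unit_square \<and> \<bar>x' - fst (corner i)\<bar> \<le> 1/2 \<and> \<bar>y' - snd (corner i)\<bar> \<le> 1/2)"
    unfolding cell_def by blast
  also have "\<dots> \<longleftrightarrow> (\<exists>i. (q, i) \<in> corners_at S v \<and> \<bar>x - fst (corner i)\<bar> \<le> 1/2 \<and> \<bar>y - snd (corner i)\<bar> \<le> 1/2)"
    unfolding inj using assms(3) by auto
  also have "\<dots> \<longleftrightarrow> (\<exists>i<4. vx S q i = v \<and> (x, y) \<in> subsquare i)"
    using box assms(4) unfolding in_corners_at by blast
  finally show ?thesis .
qed

text \<open>Every interior vertex is met by four corners.\<close>

lemma sum_over_corners:
  assumes "\<And>v. v \<in> vertices S \<Longrightarrow> v \<in> boundary S \<Longrightarrow> f v = (0::real)"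
  shows "(\<Sum>q\<in>squares S. \<Sum>i<4. f (vx S q i) / 4) = (\<Sum>v\<in>interior_vertices S. f v)"
proof -
  let ?D = "squares S \<times> {..<4::nat}"
  have "(\<Sum>q\<in>squares S. \<Sum>i<4. f (vx S q i) / 4) = (\<Sum>c\<in>?D. f (vx S (fst c) (snd c)) / 4)"
    by (simp add: sum.cartesian_product case_prod_unfold)
  also have "\<dots> = (\<Sum>v\<in>vertices S. \<Sum>c\<in>{c \<in> ?D. vx S (fst c) (snd c) = v}. f (vx S (fst c) (snd c)) / 4)"
    by (rule sum.group[symmetric]) (use finite_squares finite_vertices vx_in_vertices in auto)
  also have "\<dots> = (\<Sum>v\<in>vertices S. real (card (corners_at S v)) * (f v / 4))"
  proof (rule sum.cong[OF refl])
    fix v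
    have "{c \<in> ?D. vx S (fst c) (snd c) = v} = corners_at S v" by (auto simp: in_corners_at)
    moreover have "(\<Sum>c\<in>{c \<in> ?D. vx S (fst c) (snd c) = v}. f (vx S (fst c) (snd c)) / 4) =
      (\<Sum>c\<in>{c \<in> ?D. vx S (fst c) (snd c) = v}. f v / 4)" by (rule sum.cong) auto
    ultimately show "(\<Sum>c\<in>{c \<in> ?D. vx S (fst c) (snd c) = v}. f (vx S (fst c) (snd c)) / 4) =
      real (card (corners_at S v)) * (f v / 4)" by simp
  qed
  also have "\<dots> = (\<Sum>v\<in>interior_vertices S. real (card (corners_at S v)) * (f v / 4))"
    by (rule sum.mono_neutral_right) (use finite_vertices assms in \<open>auto simp: interior_vertices_def\<close>)
  also have "\<dots> = (\<Sum>v\<in>interior_vertices S. f v)"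
    using four_squares unfolding four_squares_around_interior_vertices_def by (intro sum.cong) auto
  finally show ?thesis .
qed

lemma interior_iff_nonzero_height:
  assumes "domino_tiling S T" "domino_tiling S T'" "q \<in> squares S" "height T T' (vx S q i) \<noteq> 0"
  shows "vx S q i \<in> interior_vertices S"
  using assms height_boundary[OF assms(1,2)] vx_in_vertices[OF assms(3)] by (auto simp: interior_vertices_def)

lemma in_filling_shape:
  fixes z :: real
  assumes T: "domino_tiling S T" "domino_tiling S T'" and xy: "x \<notin> {0, 1/2, 1}" "y \<notin> {0, 1/2, 1}" "(x, y) \<in> unit_square"
    and q: "q \<in> squares S" and z: "z \<noteq> 0"
  shows "(proj S (q, x, y), z) \<in> filling_shape S black T T' \<longleftrightarrow>
    (\<exists>i<4. (x, y) \<in> subsquare i \<and>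
      (0 < z \<and> z \<le> height T T' (vx S q i) \<or> height T T' (vx S q i) \<le> z \<and> z < 0))"
proof -
  have "(proj S (q, x, y), z) \<in> filling_shape S black T T' \<longleftrightarrow>
    (\<exists>v\<in>interior_vertices S. proj S (q, x, y) \<in> cell S v \<and>
      (0 < height T T' v \<and> 0 \<le> z \<and> z \<le> height T T' v \<or> height T T' v < 0 \<and> height T T' v \<le> z \<and> z \<le> 0))"
    unfolding filling_shape_def by auto
  also have "\<dots> \<longleftrightarrow> (\<exists>v\<in>interior_vertices S. proj S (q, x, y) \<in> cell S v \<and>
      (0 < z \<and> z \<le> height T T' v \<or> height T T' v \<le> z \<and> z < 0))"
    using z by (intro bex_cong refl conj_cong) linarith
  also have "\<dots> \<longleftrightarrow> (\<exists>i<4. (x, y) \<in> subsquare i \<and>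
      (0 < z \<and> z \<le> height T T' (vx S q i) \<or> height T T' (vx S q i) \<le> z \<and> z < 0))" (is "?L \<longleftrightarrow> ?R")
  proof
    assume ?L then show ?R unfolding in_cell_iff[OF xy q] by blast
  next
    assume ?R
    then obtain i where i: "i < 4" "(x, y) \<in> subsquare i"
      "0 < z \<and> z \<le> height T T' (vx S q i) \<or> height T T' (vx S q i) \<le> z \<and> z < 0" by blast
    then have "height T T' (vx S q i) \<noteq> 0" by linarith
    from interior_iff_nonzero_height[OF T q this] i show ?L unfolding in_cell_iff[OF xy q] by blast
  qed
  finally show ?thesis .
qed

lemma box_in_unit_square:
  "(x, y) \<in> subsquare i \<Longrightarrow> (x, y) \<in> unit_square"
  using corner_in_unit_square[of i] by (auto simp: subsquare_def unit_square_def)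

lemma volume_part:
  assumes T: "domino_tiling S T" "domino_tiling S T'" and s: "s = 1 \<or> s = - 1"
  shows "volume S {(p, z) \<in> filling_shape S black T T'. 0 \<le> s * z} =
    (\<Sum>v\<in>interior_vertices S. max 0 (s * real_of_int (height T T' v)))"
proof -
  define H where "H q i = real_of_int (height T T' (vx S q i))" for q i
  define lo where "lo q i = (if s = 1 then 0 else min 0 (H q i))" for q i
  define hi where "hi q i = (if s = 1 then max 0 (H q i) else 0)" for q i
  have "measure lebesgue {(x, y, z). (x, y) \<in> unit_square \<and>
      (proj S (q, x, y), z) \<in> {(p, z) \<in> filling_shape S black T T'. 0 \<le> s * z}} =
      (\<Sum>i<4. (hi q i - lo q i) / 4)" (is "measure lebesgue ?A = _") if q: "q \<in> squares S" for q
  proof (rule quarter_volume[of _ _ "insert 0 (H q ` {..<4})"])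
    fix x y z :: real
    assume xy: "x \<notin> {0, 1/2, 1}" "y \<notin> {0, 1/2, 1}" and z: "z \<notin> insert 0 (H q ` {..<4})"
    have zH: "z \<noteq> H q i" if "i < 4" for i using z that by auto
    show "(x, y, z) \<in> ?A \<longleftrightarrow> (\<exists>i<4. (x, y) \<in> subsquare i \<and> lo q i < z \<and> z < hi q i)"
    proof (cases "(x, y) \<in> unit_square")
      case True
      have "(x, y, z) \<in> ?A \<longleftrightarrow> (\<exists>i<4. (x, y) \<in> subsquare i \<and>
        ((0 < z \<and> z \<le> H q i \<or> H q i \<le> z \<and> z < 0) \<and> 0 \<le> s * z))"
        using in_filling_shape[OF T xy True q, of z] z True by (auto simp: H_def)
      also have "\<dots> \<longleftrightarrow> (\<exists>i<4. (x, y) \<in> subsquare i \<and> lo q i < z \<and> z < hi q i)"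
      proof -
        have "(0 < z \<and> z \<le> H q i \<or> H q i \<le> z \<and> z < 0) \<and> 0 \<le> s * z \<longleftrightarrow> lo q i < z \<and> z < hi q i"
          if "i < 4" for i using s z zH[OF that] by (auto simp: lo_def hi_def)
        then show ?thesis by blast
      qed
      finally show ?thesis .
    next
      case False
      then show ?thesis using box_in_unit_square by auto
    qed
  qed (auto simp: lo_def hi_def)
  moreover have "hi q i - lo q i = max 0 (s * H q i)" for q i
    using s by (auto simp: lo_def hi_def)
  ultimately have "volume S {(p, z) \<in> filling_shape S black T T'. 0 \<le> s * z} =
      (\<Sum>q\<in>squares S. \<Sum>i<4. max 0 (s * H q i) / 4)"
    unfolding volume_def by simp
  also have "\<dots> = (\<Sum>v\<in>interior_vertices S. max 0 (s * real_of_int (height T T' v)))"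
    unfolding H_def
    by (rule sum_over_corners[of "\<lambda>v. max 0 (s * real_of_int (height T T' v))"]) (simp add: height_boundary[OF T])
  finally show ?thesis .
qed

lemma volume_eq_total_height:
  assumes "domino_tiling S T" "domino_tiling S T'"
  shows "vol_above S (filling_shape S black T T') - vol_below S (filling_shape S black T T') = real (total_height T T')"
proof -
  let ?F = "filling_shape S black T T'"
  have parts: "part_above ?F = {(p, z) \<in> ?F. 0 \<le> 1 * z}" "part_below ?F = {(p, z) \<in> ?F. 0 \<le> (- 1) * z}"
    by (auto simp: part_above_def part_below_def)
  have "max 0 (1 * r) + max 0 ((- 1) * r) = \<bar>r\<bar>" for r :: real by simp
  moreover have "vol_above S ?F = (\<Sum>v\<in>interior_vertices S. max 0 (1 * real_of_int (height T T' v)))"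
    "vol_below S ?F = - (\<Sum>v\<in>interior_vertices S. max 0 ((- 1) * real_of_int (height T T' v)))"
    unfolding vol_above_def vol_below_def parts by (subst volume_part[OF assms]; simp)+
  ultimately have "vol_above S ?F - vol_below S ?F = (\<Sum>v\<in>interior_vertices S. \<bar>real_of_int (height T T' v)\<bar>)"
    by (simp only: diff_minus_eq_add flip: sum.distrib)
  also have "\<dots> = real_of_int (\<Sum>v\<in>interior_vertices S. \<bar>height T T' v\<bar>)" by simp
  finally show ?thesis by (simp flip: int_total_height)
qed

end

theorem theoremB:
  fixes S :: "'a square_pasting"
    and black :: "'a \<Rightarrow> bool"
    and T T' :: "'a set set"
    and F :: "(('a \<times> real \<times> real) set \<times> real) set"
  assumes "square_tiled_surface S"
    and "simply_connected_space (surface S)"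
    and "four_squares_around_interior_vertices S"
    and "chessboard_coloring S black"
    and "domino_tiling S T"
    and "domino_tiling S T'"
    and "F = filling_shape S black T T'"
  shows "flip_distance S T T' = ereal (vol_above S F - vol_below S F)"
proof -
  interpret tiled_disc S black by unfold_locales (use assms in auto)
  show ?thesis
    unfolding assms(7) volume_eq_total_height[OF assms(5,6)] by (rule flip_distance_eq[OF assms(5,6)])
qed

end
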